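(* Let $p_1<p_2$ be real numbers, let $N\geqslant 1$ be an integer, let $\rho_1,\rho_2\geqslant 1$ and $0<\mu_1,\mu_2\leqslant 1$. Let $\psi\in\mathcal{C}^1([p_1,p_2],\mathbb{R})$ satisfy $\psi'(p)=(p-p_1)^{\rho_1-1}(p_2-p)^{\rho_2-1}\tilde\psi(p)$ for all $p\in[p_1,p_2]$, where $\tilde\psi\in\mathcal{C}^N([p_1,p_2],\mathbb{R})$ is positive. Let $U:(p_1,p_2)\to\mathbb{C}$ be given by $U(p)=(p-p_1)^{\mu_1-1}(p_2-p)^{\mu_2-1}\tilde u(p)$, where $\tilde u\in\mathcal{C}^N([p_1,p_2],\mathbb{C})$ and $\tilde u(p_m)\neq0$ whenever $\mu_m\neq 1$ ($m=1,2$). Assume that $\mu_j=1$ and $\rho_j\geqslant 2$ for a certain $j\in\{1,2\}$. Let $s_m,k_m,\nu_m,\Lambda^{(m)}(s)$, and for $\omega>0$ the quantities $A_N^{(m)}(\omega)$, $R_N^{(m)}(\omega)$ ($m=1,2$), be as defined in the context. Then for all $\omega>0$, $$\int_{p_1}^{p_2}U(p)e^{i\omega\psi(p)}\,dp=\sum_{m=1,2}\Big(A_N^{(m)}(\omega)+R_N^{(m)}(\omega)\Big),$$ $$\big|R_N^{(m)}(\omega)\big|\leqslant\frac{1}{(N-1)!}\,\frac{1}{\rho_m}\,\Gamma\Big(\frac{N}{\rho_m}\Big)\int_0^{s_m}s^{\mu_m-1}\left|\frac{d^N}{ds^N}(\nu_mk_m)(s)\right|ds\;\,\omega^{-\frac{N}{\rho_m}}\qquad(m=1,2),$$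 and moreover, for every $\gamma\in(0,1)$, with $\delta:=\rho_j^{-1}(\gamma+N)\in\big(\frac{N}{\rho_j},\frac{N+1}{\rho_j}\big)$, $$\big|R_N^{(j)}(\omega)\big|\leqslant L_{\gamma,\rho_j,N}\int_0^{s_j}s^{-\gamma}\left|\frac{d^N}{ds^N}(\nu_jk_j)(s)\right|ds\;\,\omega^{-\delta}\qquad\text{for all }\omega>0,$$ where $L_{\gamma,\rho_j,N}>0$ is the constant given in the context.
   Context: Fix $\eta\in(0,\frac{p_2-p_1}{2})$ and a smooth function $\nu:[p_1,p_2]\to\mathbb{R}$ with $0\leqslant\nu\leqslant 1$, $\nu=1$ on $[p_1,p_1+\eta]$ and $\nu=0$ on $[p_2-\eta,p_2]$. Put $I_1:=[p_1,p_2-\eta]$, $I_2:=[p_1+\eta,p_2]$, and define $\varphi_m:I_m\to\mathbb{R}$ by $\varphi_1(p):=(\psi(p)-\psi(p_1))^{1/\rho_1}$, $\varphi_2(p):=(\psi(p_2)-\psi(p))^{1/\rho_2}$. Put $s_1:=\varphi_1(p_2-\eta)$, $s_2:=\varphi_2(p_1+\eta)$; each $\varphi_m$ is a bijection from $I_m$ onto $[0,s_m]$. For $m=1,2$, $k_m:(0,s_m]\to\mathbb{C}$ is $k_m(s):=U(\varphi_m^{-1}(s))\,s^{1-\mu_m}\,(\varphi_m^{-1})'(s)$, which extends to a $\mathcal{C}^N$ function on $[0,s_m]$ (still denoted $k_m$). Also $\nu_1:=\nu\circ\varphi_1^{-1}$ on $[0,s_1]$ and $\nu_2:=(1-\nu)\circ\varphi_2^{-1}$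 on $[0,s_2]$. For $s>0$, $\Lambda^{(m)}(s):=\{s+te^{(-1)^{m+1}i\frac{\pi}{2\rho_m}}\mid t\geqslant 0\}$, oriented by increasing $t$. Complex powers are taken with the principal branch on $\mathbb{C}\setminus(-\infty,0]$. For $\omega>0$ and $n=0,\dots,N-1$: $$\Theta_{n+1}^{(m)}(\rho_m,\mu_m):=\frac{(-1)^{m+1}}{n!\,\rho_m}\,\Gamma\Big(\frac{n+\mu_m}{\rho_m}\Big)\,e^{(-1)^{m+1}i\frac{\pi}{2}\frac{n+\mu_m}{\rho_m}},$$ $$\phi_{n+1}^{(m)}(s,\omega,\rho_m,\mu_m):=\frac{(-1)^{n+1}}{n!}\int_{\Lambda^{(m)}(s)}(z-s)^n z^{\mu_m-1}e^{(-1)^{m+1}i\omega z^{\rho_m}}\,dz,$$ $$A_N^{(m)}(\omega):=e^{i\omega\psi(p_m)}\sum_{n=0}^{N-1}\Theta_{n+1}^{(m)}(\rho_m,\mu_m)\,\frac{d^n k_m}{ds^n}(0)\,\omega^{-\frac{n+\mu_m}{\rho_m}},$$ $$R_N^{(m)}(\omega):=(-1)^{N+1+m}e^{i\omega\psi(p_m)}\int_0^{s_m}\phi_N^{(m)}(s,\omega,\rho_m,\mu_m)\,\frac{d^N}{ds^N}(\nu_mk_m)(s)\,ds.$$ The constant: for $\rho\geqslant2$ put $a:=\frac{1}{(N-1)!\,\rho}\Gamma\big(\frac N\rho\big)$; $b:=\frac1\rho$ if $N=1$ and $b:=\frac{1}{\rho^2(N-2)!}\Gamma\big(\frac{N-1}{\rho}\big)$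 if $N\geqslant2$; $c:=\frac{\rho-1}{\rho^2(N-1)!}\Gamma\big(\frac N\rho\big)$. Let $K>0$ be the unique positive solution of $aK^{\rho}-bK-c=0$. Then $L_{\gamma,\rho,N}:=a\,K^{\gamma}$. *)

theory Defs
  imports "HOL-Analysis.Analysis"
begin

text \<open>
  Convention: \<open>m \<in> {1, 2}\<close> is the index of an end point, and the data attached to the end points
  (\<open>p\<close>, \<open>\<rho>\<close>, \<open>\<mu>\<close>) are families indexed by \<open>m\<close>. All integrals are Lebesgue integrals.
\<close>

text \<open>
  Iterated derivatives on a set \<open>S\<close>; when \<open>S\<close> is a nondegenerate compact interval, the derivatives
  at its end points are one-sided. Only the values at points of \<open>S\<close> are meaningful.
\<close>

definition nth_deriv_on :: "nat \<Rightarrow> real set \<Rightarrow> (real \<Rightarrow> 'a::real_normed_vector) \<Rightarrow> real \<Rightarrow> 'a" where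
  "nth_deriv_on n S f = ((\<lambda>g x. vector_derivative g (at x within S)) ^^ n) f"

definition C_on :: "nat \<Rightarrow> real set \<Rightarrow> (real \<Rightarrow> 'a::real_normed_vector) \<Rightarrow> bool" where
  "C_on k S f \<longleftrightarrow>
     (\<forall>n<k. \<forall>x\<in>S. nth_deriv_on n S f differentiable (at x within S)) \<and>
     (\<forall>n\<le>k. continuous_on S (nth_deriv_on n S f))"

definition smooth_on :: "real set \<Rightarrow> (real \<Rightarrow> 'a::real_normed_vector) \<Rightarrow> bool" where
  "smooth_on S f \<longleftrightarrow> (\<forall>k. C_on k S f)"

text \<open>
  Real power of a nonnegative base with \<open>0 ^ 0 = 1\<close>. (The library has \<open>0 powr 0 = 0\<close>, which would be
  wrong for a factor such as \<open>(x - p 1) ^ (\<rho> 1 - 1)\<close> at \<open>x = p 1\<close> when \<open>\<rho> 1 = 1\<close>.)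
\<close>

definition rpow :: "real \<Rightarrow> real \<Rightarrow> real" where
  "rpow x a = (if a = 0 then 1 else x powr a)"

definition I_int :: "(nat \<Rightarrow> real) \<Rightarrow> real \<Rightarrow> nat \<Rightarrow> real set" where
  "I_int p \<eta> m = (if m = 1 then {p 1 .. p 2 - \<eta>} else {p 1 + \<eta> .. p 2})"

definition phi :: "(nat \<Rightarrow> real) \<Rightarrow> (nat \<Rightarrow> real) \<Rightarrow> (real \<Rightarrow> real) \<Rightarrow> nat \<Rightarrow> real \<Rightarrow> real" where
  "phi p \<rho> \<psi> m x =
     (if m = 1 then (\<psi> x - \<psi> (p 1)) powr (1 / \<rho> 1) else (\<psi> (p 2) - \<psi> x) powr (1 / \<rho> 2))"

definition s_end :: "(nat \<Rightarrow> real) \<Rightarrow> real \<Rightarrow> (nat \<Rightarrow> real) \<Rightarrow> (real \<Rightarrow> real) \<Rightarrow> nat \<Rightarrow> real" where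
  "s_end p \<eta> \<rho> \<psi> m = phi p \<rho> \<psi> m (if m = 1 then p 2 - \<eta> else p 1 + \<eta>)"

definition phi_inv :: "(nat \<Rightarrow> real) \<Rightarrow> real \<Rightarrow> (nat \<Rightarrow> real) \<Rightarrow> (real \<Rightarrow> real) \<Rightarrow> nat \<Rightarrow> real \<Rightarrow> real" where
  "phi_inv p \<eta> \<rho> \<psi> m = inv_into (I_int p \<eta> m) (phi p \<rho> \<psi> m)"

definition k_pos :: "(nat \<Rightarrow> real) \<Rightarrow> real \<Rightarrow> (nat \<Rightarrow> real) \<Rightarrow> (nat \<Rightarrow> real) \<Rightarrow> (real \<Rightarrow> real) \<Rightarrow>
    (real \<Rightarrow> complex) \<Rightarrow> nat \<Rightarrow> real \<Rightarrow> complex" where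
  "k_pos p \<eta> \<rho> \<mu> \<psi> U m s =
     U (phi_inv p \<eta> \<rho> \<psi> m s) * of_real (s powr (1 - \<mu> m)) *
     of_real (vector_derivative (phi_inv p \<eta> \<rho> \<psi> m) (at s within {0 .. s_end p \<eta> \<rho> \<psi> m}))"

text \<open>
  The formula for \<open>k_pos\<close> only makes sense for \<open>0 < s\<close>; \<open>k_fun\<close> is its extension to \<open>0\<close> by continuity.
\<close>

definition k_fun :: "(nat \<Rightarrow> real) \<Rightarrow> real \<Rightarrow> (nat \<Rightarrow> real) \<Rightarrow> (nat \<Rightarrow> real) \<Rightarrow> (real \<Rightarrow> real) \<Rightarrow>
    (real \<Rightarrow> complex) \<Rightarrow> nat \<Rightarrow> real \<Rightarrow> complex" where
  "k_fun p \<eta> \<rho> \<mu> \<psi> U m s =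
     (if s = 0 then Lim (at_right 0) (k_pos p \<eta> \<rho> \<mu> \<psi> U m) else k_pos p \<eta> \<rho> \<mu> \<psi> U m s)"

definition nu_fun :: "(nat \<Rightarrow> real) \<Rightarrow> real \<Rightarrow> (nat \<Rightarrow> real) \<Rightarrow> (real \<Rightarrow> real) \<Rightarrow> (real \<Rightarrow> real) \<Rightarrow>
    nat \<Rightarrow> real \<Rightarrow> real" where
  "nu_fun p \<eta> \<rho> \<psi> \<nu> m s =
     (if m = 1 then \<nu> (phi_inv p \<eta> \<rho> \<psi> 1 s) else 1 - \<nu> (phi_inv p \<eta> \<rho> \<psi> 2 s))"

definition deriv_nu_k :: "(nat \<Rightarrow> real) \<Rightarrow> real \<Rightarrow> (nat \<Rightarrow> real) \<Rightarrow> (nat \<Rightarrow> real) \<Rightarrow> (real \<Rightarrow> real) \<Rightarrow>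
    (real \<Rightarrow> complex) \<Rightarrow> (real \<Rightarrow> real) \<Rightarrow> nat \<Rightarrow> nat \<Rightarrow> real \<Rightarrow> complex" where
  "deriv_nu_k p \<eta> \<rho> \<mu> \<psi> U \<nu> m N =
     nth_deriv_on N {0 .. s_end p \<eta> \<rho> \<psi> m}
       (\<lambda>s. of_real (nu_fun p \<eta> \<rho> \<psi> \<nu> m s) * k_fun p \<eta> \<rho> \<mu> \<psi> U m s)"

text \<open>
  The ray \<open>\<Lambda>\<^sup>(\<^sup>m\<^sup>)(s)\<close>, parametrised by \<open>t \<ge> 0\<close> with constant velocity \<open>Lambda_dir m r\<close>, and the integral
  along it. (The library's contour integrals only cover paths parametrised by \<open>[0, 1]\<close>.)
\<close>

definition Lambda_dir :: "nat \<Rightarrow> real \<Rightarrow> complex" where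
  "Lambda_dir m r = cis ((-1) ^ (m + 1) * (pi / (2 * r)))"

definition Lambda :: "nat \<Rightarrow> real \<Rightarrow> real \<Rightarrow> real \<Rightarrow> complex" where
  "Lambda m r s t = of_real s + of_real t * Lambda_dir m r"

definition Lambda_integral :: "nat \<Rightarrow> real \<Rightarrow> real \<Rightarrow> (complex \<Rightarrow> complex) \<Rightarrow> complex" where
  "Lambda_integral m r s f = (LBINT t=0..\<infinity>. f (Lambda m r s t) * Lambda_dir m r)"

text \<open>In the next two definitions the index \<open>n\<close> ranges over \<open>n \<ge> 1\<close>.\<close>

definition Theta :: "nat \<Rightarrow> nat \<Rightarrow> real \<Rightarrow> real \<Rightarrow> complex" where
  "Theta m n r \<mu> =
     of_real ((-1) ^ (m + 1) / (fact (n - 1) * r) * Gamma ((real (n - 1) + \<mu>) / r)) *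
     cis ((-1) ^ (m + 1) * (pi / 2) * ((real (n - 1) + \<mu>) / r))"

definition phi_prim :: "nat \<Rightarrow> nat \<Rightarrow> real \<Rightarrow> real \<Rightarrow> real \<Rightarrow> real \<Rightarrow> complex" where
  "phi_prim m n s \<omega> r \<mu> =
     (-1) ^ n / fact (n - 1) *
     Lambda_integral m r s (\<lambda>z. (z - of_real s) ^ (n - 1) * z powr of_real (\<mu> - 1) *
       exp ((-1) ^ (m + 1) * \<i> * of_real \<omega> * z powr of_real r))"

definition A_term :: "(nat \<Rightarrow> real) \<Rightarrow> real \<Rightarrow> (nat \<Rightarrow> real) \<Rightarrow> (nat \<Rightarrow> real) \<Rightarrow> (real \<Rightarrow> real) \<Rightarrow>
    (real \<Rightarrow> complex) \<Rightarrow> nat \<Rightarrow> nat \<Rightarrow> real \<Rightarrow> complex" where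
  "A_term p \<eta> \<rho> \<mu> \<psi> U m N \<omega> =
     exp (\<i> * of_real (\<omega> * \<psi> (p m))) *
     (\<Sum>n<N. Theta m (n + 1) (\<rho> m) (\<mu> m) *
        nth_deriv_on n {0 .. s_end p \<eta> \<rho> \<psi> m} (k_fun p \<eta> \<rho> \<mu> \<psi> U m) 0 *
        of_real (\<omega> powr (- ((real n + \<mu> m) / \<rho> m))))"

definition R_term :: "(nat \<Rightarrow> real) \<Rightarrow> real \<Rightarrow> (nat \<Rightarrow> real) \<Rightarrow> (nat \<Rightarrow> real) \<Rightarrow> (real \<Rightarrow> real) \<Rightarrow>
    (real \<Rightarrow> complex) \<Rightarrow> (real \<Rightarrow> real) \<Rightarrow> nat \<Rightarrow> nat \<Rightarrow> real \<Rightarrow> complex" where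
  "R_term p \<eta> \<rho> \<mu> \<psi> U \<nu> m N \<omega> =
     (-1) ^ (N + 1 + m) * exp (\<i> * of_real (\<omega> * \<psi> (p m))) *
     (LBINT s=0..s_end p \<eta> \<rho> \<psi> m.
        phi_prim m N s \<omega> (\<rho> m) (\<mu> m) * deriv_nu_k p \<eta> \<rho> \<mu> \<psi> U \<nu> m N s)"

definition L_a :: "real \<Rightarrow> nat \<Rightarrow> real" where
  "L_a r N = 1 / (fact (N - 1) * r) * Gamma (real N / r)"

definition L_b :: "real \<Rightarrow> nat \<Rightarrow> real" where
  "L_b r N = (if N = 1 then 1 / r else 1 / (r\<^sup>2 * fact (N - 2)) * Gamma (real (N - 1) / r))"

definition L_c :: "real \<Rightarrow> nat \<Rightarrow> real" where
  "L_c r N = (r - 1) / (r\<^sup>2 * fact (N - 1)) * Gamma (real N / r)"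

definition L_K :: "real \<Rightarrow> nat \<Rightarrow> real" where
  "L_K r N = (THE K. K > 0 \<and> L_a r N * K powr r - L_b r N * K - L_c r N = 0)"

definition L_const :: "real \<Rightarrow> real \<Rightarrow> nat \<Rightarrow> real" where
  "L_const \<gamma> r N = L_a r N * L_K r N powr \<gamma>"

end

theory Submission
  imports Defs "HOL-Real_Asymp.Real_Asymp"
begin

text \<open>
  A cutoff splits the integral into two pieces, one for each end point. In the coordinate \<open>s = \<phi>\<^sub>m p\<close>
  the phase is exactly \<open>\<psi> (p m) \<plusminus> s powr \<rho>\<close>, and one integrates by parts \<open>N\<close> times. The iterated
  primitives of \<open>s powr (\<mu> - 1) * exp (\<plusminus> \<i> \<omega> s powr \<rho>)\<close> are integrals along a ray on which the
  exponential decays like \<open>exp (- \<omega> t powr \<rho>)\<close>. That they are primitives needs no contour shift: for a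
  function of \<open>s + t d\<close>, the derivatives in \<open>s\<close> and in \<open>t\<close> agree up to the factor \<open>d\<close>. For \<open>\<mu> = 1\<close>, one
  more integration by parts along the ray gives a bound that decays faster in \<open>\<omega>\<close> but is singular at
  \<open>s = 0\<close>. In the variable \<open>s \<omega> powr (1 / \<rho>)\<close> the two bounds cross at \<open>K\<close>, and interpolating between
  them produces the constant \<open>a K powr \<gamma>\<close>.
\<close>

section \<open>Functions of class \<open>C\<^sup>k\<close> on an interval\<close>

text \<open>The delicate point is regularity. The amplitude in the coordinate s contains the
  derivative of the inverse coordinate, so this inverse must be of class N + 1 although the data are
  only of class N. If the phase increment is written as y^r J(y), with J a weighted mean over [0, y]
  of the remaining factor g of the derivative of the phase, the coordinate is y J(y)^(1/r), which
  looks only as smooth as J. The identity r J + y J' = g removes J' from its derivative, which is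
  therefore as smooth as g. The second obstacle is the singularity at s = 0. The primitives extend
  continuously to 0, because t^(\<mu> - 1) controls the integrand along the ray uniformly in s;
  their values at 0 are Gamma integrals and form A. The constants: a is the integral of t^(N-1)
  exp(- t^r) divided by (N-1)!. For b and c, exp (i \<omega> z^r) is written as the derivative of
  z^(1-r) exp (i \<omega> z^r) / (i \<omega> r) plus a multiple of z^(-r) exp (i \<omega> z^r) /
  \<omega>; the first part yields b, the second c.\<close>

lemma nth_deriv_on_0 [simp]: "nth_deriv_on 0 S f = f"
  by (simp add: nth_deriv_on_def)

text \<open>A derivative can be split off on the inside, as here, or on the outside, as in
  \<open>nth_deriv_on_Suc'\<close>. The inside form drives inductions on the order of smoothness,
  the outside form pointwise computations.\<close>

lemma nth_deriv_on_Suc: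
  "nth_deriv_on (Suc n) S f = nth_deriv_on n S (\<lambda>x. vector_derivative f (at x within S))"
  by (simp add: nth_deriv_on_def funpow_Suc_right del: funpow.simps)

lemma nth_deriv_on_Suc':
  "nth_deriv_on (Suc n) S f x = vector_derivative (nth_deriv_on n S f) (at x within S)"
  by (simp add: nth_deriv_on_def)

lemma vector_derivative_within_cong:
  assumes "\<And>y. y \<in> S \<Longrightarrow> f y = g y" "x \<in> S"
  shows "vector_derivative f (at x within S) = vector_derivative g (at x within S)"
proof -
  have "(f has_vector_derivative D) (at x within S) \<longleftrightarrow> (g has_vector_derivative D) (at x within S)" for D
    using assms by (auto elim: has_vector_derivative_transform[rotated 2])
  then show ?thesis by (simp add: vector_derivative_def)
qed

lemma nth_deriv_on_cong:
  assumes "\<And>y. y \<in> S \<Longrightarrow> f y = g y" "x \<in> S"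
  shows "nth_deriv_on n S f x = nth_deriv_on n S g x"
  using assms(2)
proof (induction n arbitrary: x)
  case 0 then show ?case using assms by simp
next
  case (Suc n)
  then show ?case unfolding nth_deriv_on_Suc' by (intro vector_derivative_within_cong)
qed

lemma C_on_0 [simp]: "C_on 0 S f \<longleftrightarrow> continuous_on S f"
  by (simp add: C_on_def)

lemma C_on_mono: "C_on k S f \<Longrightarrow> n \<le> k \<Longrightarrow> C_on n S f"
  by (auto simp: C_on_def)

lemma C_on_imp_continuous: "C_on k S f \<Longrightarrow> continuous_on S f"
  using C_on_mono[of k S f 0] by simp

text \<open>The definition lists all derivatives at once; this recursion on the order allows the
  closure properties below to be proved by induction with the functions generalised.\<close>

lemma C_on_Suc_iff:
  "C_on (Suc k) S f \<longleftrightarrow> (\<forall>x\<in>S. f differentiable (at x within S)) \<and>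
     C_on k S (\<lambda>x. vector_derivative f (at x within S))" (is "?l \<longleftrightarrow> ?r")
proof
  assume l: ?l
  have "f differentiable (at x within S)" if "x \<in> S" for x
    using l that unfolding C_on_def by (metis nth_deriv_on_0 zero_less_Suc)
  moreover have "C_on k S (\<lambda>x. vector_derivative f (at x within S))"
    using l unfolding C_on_def nth_deriv_on_Suc[symmetric] by auto
  ultimately show ?r by blast
next
  assume r: ?r
  then have c: "continuous_on S f"
    by (auto simp: continuous_on_eq_continuous_within intro: differentiable_imp_continuous_within)
  show ?l unfolding C_on_def
  proof (intro conjI ballI allI impI)
    fix n x assume "n < Suc k" "x \<in> S"
    then show "nth_deriv_on n S f differentiable at x within S"
      using r by (cases n) (auto simp: C_on_def nth_deriv_on_Suc)
  next
    fix n assume "n \<le> Suc k"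
    then show "continuous_on S (nth_deriv_on n S f)"
      using r c by (cases n) (auto simp: C_on_def nth_deriv_on_Suc)
  qed
qed

lemma C_on_cong:
  assumes "\<And>y. y \<in> S \<Longrightarrow> f y = g y"
  shows "C_on k S f \<longleftrightarrow> C_on k S g"
  using assms
proof (induction k arbitrary: f g)
  case 0 then show ?case by (simp cong: continuous_on_cong)
next
  case (Suc k)
  have "f differentiable (at x within S) \<longleftrightarrow> g differentiable (at x within S)" if "x \<in> S" for x
    using that Suc.prems by (metis differentiable_transform_within zero_less_one)
  moreover have "C_on k S (\<lambda>x. vector_derivative f (at x within S)) \<longleftrightarrow>
      C_on k S (\<lambda>x. vector_derivative g (at x within S))"
    by (rule Suc.IH) (use Suc.prems in \<open>auto intro: vector_derivative_within_cong\<close>)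
  ultimately show ?case by (simp add: C_on_Suc_iff)
qed

text \<open>One-sided derivatives at the end points are unique because the interval has positive
  length; this is the origin of the hypothesis \<open>a < b\<close> that recurs below.\<close>

lemma vector_derivative_within_Icc:
  fixes f :: "real \<Rightarrow> 'a::real_normed_vector"
  assumes "a < b" "x \<in> {a..b}" "(f has_vector_derivative f') (at x within {a..b})"
  shows "vector_derivative f (at x within {a..b}) = f'"
  using vector_derivative_within_cbox[of a b x f f'] assms by simp

text \<open>Any derivative may be supplied, not only the one chosen by
  \<open>vector_derivative\<close>: the two agree on the interval, and \<open>C_on\<close> depends
  only on values there.\<close>

lemma C_on_SucI:
  fixes f :: "real \<Rightarrow> 'a::real_normed_vector"
  assumes "a < b" "\<And>x. x \<in> {a..b} \<Longrightarrow> (f has_vector_derivative f' x) (at x within {a..b})"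
    and "C_on k {a..b} f'"
  shows "C_on (Suc k) {a..b} f"
proof -
  have "C_on k {a..b} (\<lambda>x. vector_derivative f (at x within {a..b})) \<longleftrightarrow> C_on k {a..b} f'"
    by (rule C_on_cong, rule vector_derivative_within_Icc[OF assms(1)]) (use assms(2) in blast)+
  then show ?thesis
    using assms(3) differentiableI_vector[OF assms(2)] unfolding C_on_Suc_iff by blast
qed

lemma C_on_SucE:
  assumes "C_on (Suc k) S f"
  obtains f' where "\<And>x. x \<in> S \<Longrightarrow> (f has_vector_derivative f' x) (at x within S)" "C_on k S f'"
  using assms that[of "\<lambda>x. vector_derivative f (at x within S)"]
  by (auto simp: C_on_Suc_iff vector_derivative_works)

lemma C_on_nth_deriv:
  assumes "C_on k S f" "n < k" "x \<in> S"
  shows "(nth_deriv_on n S f has_vector_derivative nth_deriv_on (Suc n) S f x) (at x within S)"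
  using assms by (auto simp: C_on_def nth_deriv_on_Suc' simp flip: vector_derivative_works)

lemma C_on_const: "a < b \<Longrightarrow> C_on k {a..b} (\<lambda>x. c)"
proof (induction k arbitrary: c)
  case (Suc k)
  then show ?case by (intro C_on_SucI[where f' = "\<lambda>x. 0"]) auto
qed auto

lemma C_on_ident: "a < b \<Longrightarrow> C_on k {a..b} (\<lambda>x. x)"
proof (cases k)
  case (Suc l)
  assume "a < b"
  then show ?thesis unfolding Suc
    by (intro C_on_SucI[where f' = "\<lambda>x. 1"] C_on_const) (auto intro!: derivative_eq_intros)
qed auto

lemma C_on_add:
  assumes "a < b" "C_on k {a..b} f" "C_on k {a..b} g"
  shows "C_on k {a..b} (\<lambda>x. f x + g x)"
  using assms(2,3)
proof (induction k arbitrary: f g)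
  case 0 then show ?case by (auto intro: continuous_intros)
next
  case (Suc k)
  obtain f' where f: "\<And>x. x \<in> {a..b} \<Longrightarrow> (f has_vector_derivative f' x) (at x within {a..b})" "C_on k {a..b} f'"
    using C_on_SucE[OF Suc.prems(1)] by blast
  obtain g' where g: "\<And>x. x \<in> {a..b} \<Longrightarrow> (g has_vector_derivative g' x) (at x within {a..b})" "C_on k {a..b} g'"
    using C_on_SucE[OF Suc.prems(2)] by blast
  show ?case
    by (rule C_on_SucI[OF assms(1), where f' = "\<lambda>x. f' x + g' x"])
       (use f g Suc.IH in \<open>auto intro!: derivative_intros\<close>)
qed

lemma C_on_scaleR:
  assumes "a < b" "C_on k {a..b} f" "C_on k {a..b} g"
  shows "C_on k {a..b} (\<lambda>x. f x *\<^sub>R g x)"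
  using assms(2,3)
proof (induction k arbitrary: f g)
  case 0 then show ?case by (auto intro: continuous_intros)
next
  case (Suc k)
  obtain f' where f: "\<And>x. x \<in> {a..b} \<Longrightarrow> (f has_vector_derivative f' x) (at x within {a..b})" "C_on k {a..b} f'"
    using C_on_SucE[OF Suc.prems(1)] by blast
  obtain g' where g: "\<And>x. x \<in> {a..b} \<Longrightarrow> (g has_vector_derivative g' x) (at x within {a..b})" "C_on k {a..b} g'"
    using C_on_SucE[OF Suc.prems(2)] by blast
  \<comment> \<open>The product rule pairs each derivative with the other factor itself, which the
    induction hypothesis wants one order lower.\<close>
  have fg: "C_on k {a..b} f" "C_on k {a..b} g"
    using Suc.prems by (auto intro: C_on_mono)
  show ?case
    by (rule C_on_SucI[OF assms(1), where f' = "\<lambda>x. f x *\<^sub>R g' x + f' x *\<^sub>R g x"])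
       (use f g fg Suc.IH in \<open>auto intro!: C_on_add[OF assms(1)] has_vector_derivative_scaleR
          simp: has_real_derivative_iff_has_vector_derivative\<close>)
qed

lemma C_on_mult:
  fixes f g :: "real \<Rightarrow> real"
  shows "a < b \<Longrightarrow> C_on k {a..b} f \<Longrightarrow> C_on k {a..b} g \<Longrightarrow> C_on k {a..b} (\<lambda>x. f x * g x)"
  using C_on_scaleR[of a b k f g] by simp

lemma C_on_diff:
  assumes "a < b" "C_on k {a..b} f" "C_on k {a..b} g"
  shows "C_on k {a..b} (\<lambda>x. f x - g x)"
  using C_on_add[OF assms(1,2) C_on_scaleR[OF assms(1) C_on_const[OF assms(1), where c = "-1"] assms(3)]]
  by simp

lemma C_on_compose:
  fixes f :: "real \<Rightarrow> 'a::real_normed_vector" and g :: "real \<Rightarrow> real"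
  assumes "a < b" "C_on k {a..b} g" "C_on k T f" "g ` {a..b} \<subseteq> T"
  shows "C_on k {a..b} (\<lambda>x. f (g x))"
  using assms(2,3)
proof (induction k arbitrary: f)
  case 0 then show ?case using assms(4) continuous_on_compose2 by auto
next
  case (Suc k)
  obtain f' where f: "\<And>x. x \<in> T \<Longrightarrow> (f has_vector_derivative f' x) (at x within T)" "C_on k T f'"
    using C_on_SucE[OF Suc.prems(2)] by blast
  obtain g' where g: "\<And>x. x \<in> {a..b} \<Longrightarrow> (g has_vector_derivative g' x) (at x within {a..b})" "C_on k {a..b} g'"
    using C_on_SucE[OF Suc.prems(1)] by blast
  have "((\<lambda>x. f (g x)) has_vector_derivative g' x *\<^sub>R f' (g x)) (at x within {a..b})" if "x \<in> {a..b}" for x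
  proof -
    have "(f has_vector_derivative f' (g x)) (at (g x) within g ` {a..b})"
      using f(1) assms(4) that by (blast intro: has_vector_derivative_within_subset)
    from vector_diff_chain_within[OF g(1)[OF that] this] show ?thesis by (simp add: o_def)
  qed
  moreover have "C_on k {a..b} g" using C_on_mono[OF Suc.prems(1), of k] by simp
  ultimately show ?case
    using C_on_SucI[OF assms(1), of "\<lambda>x. f (g x)" "\<lambda>x. g' x *\<^sub>R f' (g x)" k]
      C_on_scaleR[OF assms(1) g(2) Suc.IH[OF _ f(2)]] by blast
qed

text \<open>The exponent is generalised in the induction because each derivative lowers it by
  one.\<close>

lemma C_on_powr:
  fixes f :: "real \<Rightarrow> real"
  assumes "a < b" "C_on k {a..b} f" "\<And>x. x \<in> {a..b} \<Longrightarrow> f x > 0"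
  shows "C_on k {a..b} (\<lambda>x. f x powr c)"
  using assms(2)
proof (induction k arbitrary: c)
  case 0
  then show ?case using assms(3) by (auto intro!: continuous_on_powr continuous_on_const) force
next
  case (Suc k)
  obtain f' where f: "\<And>x. x \<in> {a..b} \<Longrightarrow> (f has_vector_derivative f' x) (at x within {a..b})" "C_on k {a..b} f'"
    using C_on_SucE[OF Suc.prems(1)] by blast
  have "((\<lambda>x. f x powr c) has_vector_derivative (c * f x powr (c - 1)) * f' x) (at x within {a..b})"
    if "x \<in> {a..b}" for x
    using f(1)[OF that] assms(3)[OF that]
    unfolding has_real_derivative_iff_has_vector_derivative[symmetric]
    by (auto intro!: derivative_eq_intros simp: powr_diff field_simps)
  moreover have "C_on k {a..b} (\<lambda>x. (c * f x powr (c - 1)) * f' x)"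
    using Suc.prems by (intro C_on_mult C_on_const Suc.IH assms(1) f(2)) (auto intro: C_on_mono)
  ultimately show ?case by (intro C_on_SucI[OF assms(1)])
qed

section \<open>Restriction to subintervals\<close>

lemma C_on_subset:
  assumes "a < b" "{a..b} \<subseteq> T" "C_on k T f"
  shows "C_on k {a..b} f"
  using C_on_compose[OF assms(1) C_on_ident[OF assms(1)] assms(3)] assms(2) by simp

text \<open>A derivative within the larger set is also one within the subinterval, where derivatives
  are unique.\<close>

lemma nth_deriv_on_subset:
  assumes "a < b" "{a..b} \<subseteq> T" "C_on k T f" "n \<le> k" "x \<in> {a..b}"
  shows "nth_deriv_on n {a..b} f x = nth_deriv_on n T f x"
  using assms(4,5)
proof (induction n arbitrary: x)
  case (Suc n)
  have "(nth_deriv_on n T f has_vector_derivative nth_deriv_on (Suc n) T f x) (at x within {a..b})"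
    using C_on_nth_deriv[OF assms(3), of n x] Suc.prems assms(2,4)
    by (intro has_vector_derivative_within_subset[OF _ assms(2)]) (auto simp: subset_iff)
  then have "vector_derivative (nth_deriv_on n T f) (at x within {a..b}) = nth_deriv_on (Suc n) T f x"
    using Suc.prems assms(1) by (intro vector_derivative_within_Icc) auto
  moreover have "vector_derivative (nth_deriv_on n T f) (at x within {a..b}) = nth_deriv_on (Suc n) {a..b} f x"
    unfolding nth_deriv_on_Suc' using Suc by (intro vector_derivative_within_cong) auto
  ultimately show ?case by simp
qed auto

lemma nth_deriv_on_zero:
  assumes "a < b" "x \<in> {a..b}"
  shows "nth_deriv_on n {a..b} (\<lambda>x. 0 :: 'a::real_normed_vector) x = 0"
  using assms(2)
proof (induction n arbitrary: x)
  case (Suc n)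
  then have "nth_deriv_on (Suc n) {a..b} (\<lambda>x. 0 :: 'a) x = vector_derivative (\<lambda>x. 0) (at x within {a..b})"
    unfolding nth_deriv_on_Suc' by (intro vector_derivative_within_cong) auto
  also have "\<dots> = 0"
    using Suc.prems assms(1) by (intro vector_derivative_within_Icc) auto
  finally show ?case .
qed auto

text \<open>The derivatives at \<open>b\<close> from the left agree with those from the right,
  because \<open>f\<close> is smooth across \<open>b\<close>, and the latter are zero. This removes
  the boundary terms at the far end of the integration by parts.\<close>

lemma nth_deriv_on_vanishing_extension:
  assumes "a < b" "b < c" "C_on k {a..c} f" "\<And>x. x \<in> {b..c} \<Longrightarrow> f x = 0" "n \<le> k"
  shows "nth_deriv_on n {a..b} f b = 0"
proof -
  have "nth_deriv_on n {a..b} f b = nth_deriv_on n {a..c} f b"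
    by (rule nth_deriv_on_subset) (use assms(1,2,3,5) in auto)
  also have "\<dots> = nth_deriv_on n {b..c} f b"
    by (rule nth_deriv_on_subset[symmetric]) (use assms(1,2,3,5) in auto)
  also have "\<dots> = nth_deriv_on n {b..c} (\<lambda>x. 0) b"
    by (rule nth_deriv_on_cong) (use assms(2,4) in auto)
  finally show ?thesis using nth_deriv_on_zero[of b c b n] assms(2) by simp
qed

text \<open>Derivatives at the left end see only a right neighbourhood of it. Since the cutoff is 1
  near the end point, the expansion coefficients can be written with the amplitude alone.\<close>

lemma nth_deriv_on_left_germ:
  assumes "a < b" "b \<le> c" "C_on k {a..c} f" "C_on k {a..c} g" "\<And>x. x \<in> {a..b} \<Longrightarrow> f x = g x" "n \<le> k"
  shows "nth_deriv_on n {a..c} f a = nth_deriv_on n {a..c} g a"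
proof -
  have "nth_deriv_on n {a..c} f a = nth_deriv_on n {a..b} f a"
    by (rule nth_deriv_on_subset[where k = k, symmetric]) (use assms(1-4,6) in auto)
  also have "\<dots> = nth_deriv_on n {a..b} g a"
    by (rule nth_deriv_on_cong) (use assms(1,5) in simp_all)
  also have "\<dots> = nth_deriv_on n {a..c} g a"
    by (rule nth_deriv_on_subset[where k = k]) (use assms(1-4,6) in auto)
  finally show ?thesis .
qed

section \<open>Regularity of inverse functions\<close>

lemma has_real_derivative_inverse_within:
  fixes f g :: "real \<Rightarrow> real"
  assumes "(f has_real_derivative D) (at (g x) within g ` S)" "D \<noteq> 0" "x \<in> S"
    and "continuous (at x within S) g" "\<And>y. y \<in> S \<Longrightarrow> f (g y) = y"
  shows "(g has_real_derivative inverse D) (at x within S)"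
proof -
  have inj: "g y \<noteq> g x" if "y \<in> S" "y \<noteq> x" for y
    using assms(3,5) that by metis
  \<comment> \<open>Injectivity keeps \<open>g y\<close> off \<open>g x\<close>, so the difference
    quotient of \<open>f\<close> may be evaluated along \<open>g\<close>; its reciprocal is the
    difference quotient of \<open>g\<close>.\<close>
  have "filterlim g (at (g x) within g ` S) (at x within S)"
    unfolding filterlim_at
    using assms(4) inj by (auto simp: continuous_within eventually_at intro!: exI[of _ 1])
  then have "((\<lambda>y. (f (g y) - f (g x)) / (g y - g x)) \<longlongrightarrow> D) (at x within S)"
    using assms(1) unfolding has_field_derivative_iff by (rule filterlim_compose[rotated])
  then have "((\<lambda>y. inverse ((f (g y) - f (g x)) / (g y - g x))) \<longlongrightarrow> inverse D) (at x within S)"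
    using assms(2) by (rule tendsto_inverse)
  moreover have "\<forall>\<^sub>F y in at x within S. inverse ((f (g y) - f (g x)) / (g y - g x)) = (g y - g x) / (y - x)"
    using assms(3,5) by (auto simp: eventually_at_filter)
  ultimately show ?thesis
    unfolding has_field_derivative_iff using tendsto_cong by fast
qed

text \<open>Bootstrap: the derivative of \<open>g\<close> is the reciprocal of \<open>f'\<close>
  composed with \<open>g\<close>, so if \<open>g\<close> is of class n with n at most k, its
  derivative is of class n as well.\<close>

lemma C_on_inverse_function:
  fixes f g :: "real \<Rightarrow> real"
  assumes "a < b" "c < d" "g ` {a..b} \<subseteq> {c..d}" "continuous_on {a..b} g" "\<And>y. y \<in> {a..b} \<Longrightarrow> f (g y) = y"
    and "\<And>x. x \<in> {c..d} \<Longrightarrow> (f has_real_derivative f' x) (at x within {c..d})"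
    and "\<And>x. x \<in> {c..d} \<Longrightarrow> f' x > 0" "C_on k {c..d} f'"
  shows "C_on (Suc k) {a..b} g"
    and "\<And>y. y \<in> {a..b} \<Longrightarrow> (g has_real_derivative inverse (f' (g y))) (at y within {a..b})"
proof -
  show D: "(g has_real_derivative inverse (f' (g y))) (at y within {a..b})" if "y \<in> {a..b}" for y
  proof (rule has_real_derivative_inverse_within)
    show "(f has_real_derivative f' (g y)) (at (g y) within g ` {a..b})"
      using assms(3,6) that by (blast intro: has_field_derivative_subset)
    have "g y \<in> {c..d}" using that assms(3) by blast
    then show "f' (g y) \<noteq> 0" using assms(7) by fastforce
  qed (use assms that in \<open>auto simp: continuous_on_eq_continuous_within\<close>)
  have "C_on (Suc n) {a..b} g" if "n \<le> k" "C_on n {a..b} g" for n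
  proof (rule C_on_SucI[OF assms(1)])
    \<comment> \<open>The reciprocal is written as a power so that \<open>C_on_powr\<close> covers
      it.\<close>
    show "(g has_vector_derivative f' (g y) powr (-1)) (at y within {a..b})" if "y \<in> {a..b}" for y
    proof -
      have "g y \<in> {c..d}" using that assms(3) by blast
      then show ?thesis
        using D[OF that] assms(7)[of "g y"] unfolding has_real_derivative_iff_has_vector_derivative
        by (simp add: powr_minus)
    qed
    have "C_on n {a..b} (\<lambda>y. f' (g y))"
      by (rule C_on_compose[OF assms(1) that(2) C_on_mono[OF assms(8) that(1)] assms(3)])
    then show "C_on n {a..b} (\<lambda>y. f' (g y) powr (-1))"
      by (rule C_on_powr[OF assms(1)]) (use assms(3) in \<open>auto intro!: assms(7)\<close>)
  qed
  then have "n \<le> Suc k \<Longrightarrow> C_on n {a..b} g" for n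
    by (induction n) (use assms(4) in auto)
  then show "C_on (Suc k) {a..b} g" by blast
qed

section \<open>Integrals depending on a parameter\<close>

text \<open>In this form the derivative can be tested along sequences and passed through dominated
  convergence.\<close>

lemma has_vector_derivative_iff_quotient:
  "(f has_vector_derivative D) (at x within S) \<longleftrightarrow>
     ((\<lambda>y. (f y - f x) /\<^sub>R (y - x)) \<longlongrightarrow> D) (at x within S)"
proof -
  have "(f has_vector_derivative D) (at x within S) \<longleftrightarrow>
      ((\<lambda>y. norm (f y - f x - (y - x) *\<^sub>R D) / norm (y - x)) \<longlongrightarrow> 0) (at x within S)"
    unfolding has_vector_derivative_def has_derivative_iff_norm
    by (simp add: bounded_linear_scaleR_left)
  also have "\<dots> \<longleftrightarrow> ((\<lambda>y. norm ((f y - f x) /\<^sub>R (y - x) - D)) \<longlongrightarrow> 0) (at x within S)"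
  proof (rule tendsto_cong)
    have "norm (f y - f x - (y - x) *\<^sub>R D) / norm (y - x) = norm ((f y - f x) /\<^sub>R (y - x) - D)"
      if "y \<noteq> x" for y
    proof -
      have "(f y - f x) /\<^sub>R (y - x) - D = (f y - f x - (y - x) *\<^sub>R D) /\<^sub>R (y - x)"
        using that by (simp add: scaleR_diff_right)
      then show ?thesis by (simp add: divide_inverse mult.commute)
    qed
    then show "\<forall>\<^sub>F y in at x within S.
        norm (f y - f x - (y - x) *\<^sub>R D) / norm (y - x) = norm ((f y - f x) /\<^sub>R (y - x) - D)"
      by (auto simp: eventually_at_filter)
  qed
  also have "\<dots> \<longleftrightarrow> ((\<lambda>y. (f y - f x) /\<^sub>R (y - x)) \<longlongrightarrow> D) (at x within S)"
    by (simp add: tendsto_norm_zero_iff Lim_null[symmetric])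
  finally show ?thesis .
qed

text \<open>The mean value inequality dominates the difference quotients of the integrand by
  \<open>g\<close>, so dominated convergence applies along every sequence tending to
  \<open>x\<close>. Their measurability follows from \<open>int\<close>, that of the limit is
  \<open>meas\<close>.\<close>

lemma has_vector_derivative_set_lebesgue_integral:
  fixes f f' :: "real \<Rightarrow> 'a \<Rightarrow> 'b::{banach, second_countable_topology}"
  assumes x: "a < x" "x < b"
    and int: "\<And>s. a < s \<Longrightarrow> s < b \<Longrightarrow> set_integrable M A (f s)"
    and deriv: "\<And>s t. a < s \<Longrightarrow> s < b \<Longrightarrow> t \<in> A \<Longrightarrow> ((\<lambda>s. f s t) has_vector_derivative f' s t) (at s)"
    and bound: "\<And>s t. a < s \<Longrightarrow> s < b \<Longrightarrow> t \<in> A \<Longrightarrow> norm (f' s t) \<le> g t"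
    and g: "set_integrable M A g"
    and meas: "set_borel_measurable M A (f' x)"
  shows "((\<lambda>s. LINT t:A|M. f s t) has_vector_derivative (LINT t:A|M. f' x t)) (at x)"
proof -
  have "((\<lambda>y. ((LINT t:A|M. f y t) - (LINT t:A|M. f x t)) /\<^sub>R (y - x)) \<longlongrightarrow> (LINT t:A|M. f' x t))
      (at x within {a<..<b})"
    unfolding tendsto_at_iff_sequentially
  proof (intro allI impI)
    fix X :: "nat \<Rightarrow> real" assume X: "\<forall>i. X i \<in> {a<..<b} - {x}" "X \<longlonglongrightarrow> x"
    let ?q = "\<lambda>i t. indicator A t *\<^sub>R ((f (X i) t - f x t) /\<^sub>R (X i - x))"
    have qint: "set_integrable M A (\<lambda>t. (f (X i) t - f x t) /\<^sub>R (X i - x))" for i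
      using X x by (intro set_integrable_scaleR_right set_integral_diff int) auto
    have "(\<lambda>i. LINT t|M. ?q i t) \<longlonglongrightarrow> (LINT t|M. indicator A t *\<^sub>R f' x t)"
    proof (rule integral_dominated_convergence[where w = "\<lambda>t. indicator A t *\<^sub>R g t"])
      show "(\<lambda>t. indicator A t *\<^sub>R f' x t) \<in> borel_measurable M"
        using meas by (simp add: set_borel_measurable_def)
      show "?q i \<in> borel_measurable M" for i
        using qint[of i] by (auto simp: set_integrable_def)
      show "integrable M (\<lambda>t. indicator A t *\<^sub>R g t)"
        using g by (simp add: set_integrable_def)
      show "AE t in M. (\<lambda>i. ?q i t) \<longlonglongrightarrow> indicator A t *\<^sub>R f' x t"
      proof (intro AE_I2)
        fix t
        show "(\<lambda>i. ?q i t) \<longlonglongrightarrow> indicator A t *\<^sub>R f' x t"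
        proof (cases "t \<in> A")
          case True
          have "((\<lambda>y. (f y t - f x t) /\<^sub>R (y - x)) \<longlongrightarrow> f' x t) (at x within {a<..<b})"
            using has_vector_derivative_at_within[OF deriv[OF x True]]
            unfolding has_vector_derivative_iff_quotient .
          with X have "((\<lambda>y. (f y t - f x t) /\<^sub>R (y - x)) \<circ> X) \<longlonglongrightarrow> f' x t"
            unfolding tendsto_at_iff_sequentially by simp
          with True show ?thesis by (simp add: o_def)
        qed auto
      qed
      show "AE t in M. norm (?q i t) \<le> indicator A t *\<^sub>R g t" for i
      proof (intro AE_I2)
        fix t
        show "norm (?q i t) \<le> indicator A t *\<^sub>R g t"
        proof (cases "t \<in> A")
          case True
          have g0: "0 \<le> g t" using bound[OF x True] norm_ge_zero order_trans by blast
          have Xi: "a < X i" "X i < b" "X i \<noteq> x" using X by auto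
          have "norm (f (X i) t - f x t) \<le> g t * norm (X i - x)"
          proof (rule differentiable_bound)
            show "convex {a<..<b}" by simp
            fix s assume s: "s \<in> {a<..<b}"
            show "((\<lambda>s. f s t) has_derivative (\<lambda>h. h *\<^sub>R f' s t)) (at s within {a<..<b})"
              using deriv[of s t] s True has_vector_derivative_at_within
              by (auto simp: has_vector_derivative_def)
            show "onorm (\<lambda>h. h *\<^sub>R f' s t) \<le> g t"
              by (rule onorm_bound) (use g0 bound[of s t] s True in \<open>auto simp: mult.commute mult_left_mono\<close>)
          qed (use Xi x in auto)
          then show ?thesis using True Xi
            by (simp add: divide_simps mult.commute flip: divide_inverse_commute)
        qed auto
      qed
    qed
    moreover have "(LINT t|M. ?q i t) = ((LINT t:A|M. f (X i) t) - (LINT t:A|M. f x t)) /\<^sub>R (X i - x)" for i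
    proof -
      have "(LINT t:A|M. (f (X i) t - f x t) /\<^sub>R (X i - x)) = (LINT t:A|M. f (X i) t - f x t) /\<^sub>R (X i - x)"
        by (rule set_integral_scaleR_right)
      also have "(LINT t:A|M. f (X i) t - f x t) = (LINT t:A|M. f (X i) t) - (LINT t:A|M. f x t)"
        using X x by (intro set_integral_diff int) auto
      finally show ?thesis unfolding set_lebesgue_integral_def .
    qed
    ultimately show "((\<lambda>y. ((LINT t:A|M. f y t) - (LINT t:A|M. f x t)) /\<^sub>R (y - x)) \<circ> X)
        \<longlonglongrightarrow> (LINT t:A|M. f' x t)"
      by (simp add: o_def set_lebesgue_integral_def)
  qed
  then have "((\<lambda>s. LINT t:A|M. f s t) has_vector_derivative (LINT t:A|M. f' x t)) (at x within {a<..<b})"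
    by (simp add: has_vector_derivative_iff_quotient)
  then show ?thesis
    using x by (simp add: at_within_open[of x "{a<..<b}"])
qed

lemma set_borel_measurable_continuous_on:
  fixes f :: "real \<Rightarrow> 'b::real_normed_vector"
  assumes "A \<in> sets borel" "continuous_on A f"
  shows "set_borel_measurable lborel A f"
  using set_measurable_continuous_on[OF assms] by (simp add: set_borel_measurable_def)

lemma continuous_on_set_lebesgue_integral:
  fixes f :: "real \<Rightarrow> 'a \<Rightarrow> 'b::{banach, second_countable_topology}"
  assumes cont: "\<And>t. t \<in> A \<Longrightarrow> continuous_on S (\<lambda>s. f s t)"
    and bound: "\<And>s t. s \<in> S \<Longrightarrow> t \<in> A \<Longrightarrow> norm (f s t) \<le> g t"
    and g: "set_integrable M A g"
    and meas: "\<And>s. s \<in> S \<Longrightarrow> set_borel_measurable M A (f s)"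
  shows "continuous_on S (\<lambda>s. LINT t:A|M. f s t)"
  unfolding continuous_on_sequentially
proof (intro allI ballI impI)
  fix X :: "nat \<Rightarrow> real" and s assume s: "s \<in> S" and X: "(\<forall>n. X n \<in> S) \<and> X \<longlonglongrightarrow> s"
  show "((\<lambda>s. LINT t:A|M. f s t) \<circ> X) \<longlonglongrightarrow> (LINT t:A|M. f s t)"
    unfolding o_def set_lebesgue_integral_def
  proof (rule integral_dominated_convergence[where w = "\<lambda>t. indicator A t *\<^sub>R g t"])
    show "(\<lambda>t. indicator A t *\<^sub>R f s t) \<in> borel_measurable M"
      "(\<lambda>t. indicator A t *\<^sub>R f (X i) t) \<in> borel_measurable M" for i
      using meas s X by (auto simp: set_borel_measurable_def)
    show "integrable M (\<lambda>t. indicator A t *\<^sub>R g t)"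
      using g by (simp add: set_integrable_def)
    show "AE t in M. (\<lambda>i. indicator A t *\<^sub>R f (X i) t) \<longlonglongrightarrow> indicator A t *\<^sub>R f s t"
    proof (intro AE_I2)
      fix t
      show "(\<lambda>i. indicator A t *\<^sub>R f (X i) t) \<longlonglongrightarrow> indicator A t *\<^sub>R f s t"
        using cont[of t] s X by (cases "t \<in> A") (auto simp: continuous_on_sequentially o_def)
    qed
    show "AE t in M. norm (indicator A t *\<^sub>R f (X i) t) \<le> indicator A t *\<^sub>R g t" for i
      using bound X by (intro AE_I2) (auto simp: indicator_def)
  qed
qed

text \<open>The substitution u = \<omega> t^r leads to Euler's integral for Gamma. As the integrand
  is nonnegative, the substitution rule yields integrability and value together.\<close>

lemma powr_exp_integral:
  fixes b r \<omega> :: real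
  assumes b: "b > -1" and r: "r > 0" and \<omega>: "\<omega> > 0"
  shows "set_integrable lborel {0<..} (\<lambda>t. t powr b * exp (- \<omega> * t powr r))"
    and "(LBINT t:{0<..}. t powr b * exp (- \<omega> * t powr r)) =
      1 / r * Gamma ((b + 1) / r) * \<omega> powr (- ((b + 1) / r))"
proof -
  define x where "x = (b + 1) / r"
  have x: "x > 0" using b r by (simp add: x_def)
  have "(\<lambda>t. t powr (x - 1) / exp t) integrable_on {0..}"
    using Gamma_integral_real[OF x] by (auto simp: integrable_on_def)
  then have "(\<lambda>t. t powr (x - 1) / exp t) absolutely_integrable_on {0..}"
    by (rule nonnegative_absolutely_integrable_1) auto
  then have abs: "(\<lambda>t. t powr (x - 1) / exp t) absolutely_integrable_on {0<..}"
    by (rule set_integrable_subset) auto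
  \<comment> \<open>The gauge integral gives absolute integrability for the completed measure; Borel
    measurability brings it down to \<open>lborel\<close>.\<close>
  have meas: "set_borel_measurable lborel {0<..} (\<lambda>t::real. t powr (x - 1) / exp t)"
    by (intro set_borel_measurable_continuous_on) (auto intro!: continuous_intros)
  have G: "set_integrable lborel {0<..} (\<lambda>t. t powr (x - 1) / exp t)"
    using abs meas by (auto simp: set_integrable_def set_borel_measurable_def integrable_completion)
  have GI: "(LBINT t:{0<..}. t powr (x - 1) / exp t) = Gamma x"
  proof -
    have "((\<lambda>t. t powr (x - 1) / exp t) has_integral Gamma x) {0<..}"
      using Gamma_integral_real[OF x]
      by (subst has_integral_spike_set_eq[of _ "{0..}"]) (auto intro: negligible_subset[OF negligible_sing[of 0]])
    then show ?thesis
      using set_borel_integral_eq_integral(2)[OF G] by (simp add: integral_unique)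
  qed
  define f where "f = (\<lambda>t. t powr b * exp (- \<omega> * t powr r))"
  \<comment> \<open>The inverse of the substitution u = \<omega> t^r.\<close>
  define g where "g = (\<lambda>u::real. (u / \<omega>) powr (1 / r))"
  define g' where "g' = (\<lambda>u::real. 1 / r * (u / \<omega>) powr (1 / r - 1) / \<omega>)"
  define C where "C = 1 / r * \<omega> powr (- x)"
  have eq: "f (g u) * g' u = C * (u powr (x - 1) / exp u)" if "u > 0" for u
  proof -
    have p: "(u / \<omega>) powr (b / r) * (u / \<omega>) powr (1 / r - 1) / \<omega> = \<omega> powr (- x) * u powr (x - 1)"
    proof -
      have "(u / \<omega>) powr (b / r) * (u / \<omega>) powr (1 / r - 1) = (u / \<omega>) powr (x - 1)"
        by (simp add: powr_add[symmetric] x_def add_divide_distrib add_diff_eq)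
      then show ?thesis using that \<omega>
        by (simp add: powr_divide powr_diff powr_minus divide_simps)
    qed
    have e: "exp (- \<omega> * (g u) powr r) = inverse (exp u)"
      using that \<omega> r by (simp add: g_def powr_powr exp_minus)
    have "f (g u) * g' u = ((u / \<omega>) powr (b / r) * (u / \<omega>) powr (1 / r - 1) / \<omega>) * (1 / r) * inverse (exp u)"
      unfolding f_def e unfolding g_def g'_def by (simp add: powr_powr ac_simps)
    then show ?thesis unfolding p C_def by (simp add: divide_inverse)
  qed
  have eint: "einterval 0 \<infinity> = {0<..}" by (auto simp: einterval_def)
  have lim0: "((ereal \<circ> g \<circ> real_of_ereal) \<longlongrightarrow> 0) (at_right 0)"
  proof -
    have "(g \<longlongrightarrow> 0) (at_right 0)" unfolding g_def using r \<omega> by real_asymp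
    then have "((\<lambda>x. ereal (g x)) \<longlongrightarrow> 0) (at_right 0)" by (simp add: zero_ereal_def)
    then show ?thesis unfolding zero_ereal_def ereal_tendsto_simps1 by (simp add: o_def)
  qed
  have limi: "((ereal \<circ> g \<circ> real_of_ereal) \<longlongrightarrow> \<infinity>) (at_left \<infinity>)"
  proof -
    have "filterlim g at_top at_top" unfolding g_def using r \<omega> by real_asymp
    then have "((ereal \<circ> g) \<longlongrightarrow> \<infinity>) at_top"
      by (simp add: o_def tendsto_PInfty_eq_at_top)
    then show ?thesis unfolding ereal_tendsto_simps1 by simp
  qed
  have int: "set_integrable lborel (einterval 0 \<infinity>) (\<lambda>u. f (g u) * g' u)"
  proof -
    have "set_integrable lborel {0<..} (\<lambda>u. C * (u powr (x - 1) / exp u))"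
      using G by (rule set_integrable_mult_right)
    then show ?thesis unfolding eint by (rule set_integrable_cong[THEN iffD1, rotated -1]) (auto simp: eq)
  qed
  have 1: "DERIV g u :> g' u" if "0 < ereal u" for u
    unfolding g_def g'_def using that \<omega> r
    by (auto intro!: derivative_eq_intros simp: field_simps)
  have 2: "isCont f (g u)" if "0 < ereal u" for u
  proof -
    have "g u > 0" using that \<omega> by (simp add: g_def)
    then show ?thesis unfolding f_def by (intro continuous_intros) auto
  qed
  have 3: "isCont g' u" if "0 < ereal u" for u
    unfolding g'_def using that \<omega> r by (intro continuous_intros) auto
  note S = interval_integral_substitution_nonneg[of 0 \<infinity> g g' f 0 \<infinity>, OF _ 1 2 3 _ _ lim0 limi int]
  have S1: "set_integrable lborel (einterval 0 \<infinity>) f"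
    by (rule S(1)) (use r \<omega> in \<open>auto simp: f_def g'_def\<close>)
  have S2: "(LBINT x=0..\<infinity>. f x) = (LBINT u=0..\<infinity>. f (g u) * g' u)"
    by (rule S(2)) (use r \<omega> in \<open>auto simp: f_def g'_def\<close>)
  show "set_integrable lborel {0<..} (\<lambda>t. t powr b * exp (- \<omega> * t powr r))"
    using S1 unfolding eint f_def .
  have "(LBINT t:{0<..}. f t) = (LBINT u:{0<..}. f (g u) * g' u)"
    using S2 by (simp add: interval_lebesgue_integral_def eint)
  also have "\<dots> = (LBINT u:{0<..}. C * (u powr (x - 1) / exp u))"
    by (rule set_lebesgue_integral_cong) (auto simp: eq)
  also have "\<dots> = C * (LBINT u:{0<..}. u powr (x - 1) / exp u)"
    by (rule set_integral_mult_right)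
  also have "\<dots> = C * Gamma x" unfolding GI ..
  finally show "(LBINT t:{0<..}. t powr b * exp (- \<omega> * t powr r)) =
      1 / r * Gamma ((b + 1) / r) * \<omega> powr (- ((b + 1) / r))"
    by (simp add: f_def C_def x_def)
qed

text \<open>A bounded factor times a power integrable at 0; it serves the singularity s^(\<mu> - 1)
  of the integrand and the weights s^a in the remainder bounds.\<close>

lemma set_integrable_powr_continuous:
  fixes h :: "real \<Rightarrow> 'b::{banach, second_countable_topology}"
  assumes "a > -1" "continuous_on {0..B} h"
  shows "set_integrable lborel {0<..<B} (\<lambda>s. s powr a *\<^sub>R h s)"
proof -
  have "bounded (h ` {0..B})"
    by (intro compact_imp_bounded compact_continuous_image assms(2)) simp
  then obtain C where C: "\<And>s. s \<in> {0..B} \<Longrightarrow> norm (h s) \<le> C"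
    unfolding bounded_iff by blast
  have "set_integrable lborel {0<..<B} (\<lambda>s. s powr a)"
  proof (cases "B > 0")
    case True
    have "(\<lambda>s. s powr a) absolutely_integrable_on {0..B}"
      using assms(1) True by (intro nonnegative_absolutely_integrable_1 integrable_on_powr_from_0) auto
    then have "(\<lambda>s. s powr a) absolutely_integrable_on {0<..<B}"
      by (rule set_integrable_subset) auto
    moreover have "set_borel_measurable lborel {0<..<B} (\<lambda>s. s powr a)"
      by (intro set_borel_measurable_continuous_on) (auto intro!: continuous_intros)
    ultimately show ?thesis
      by (auto simp: set_integrable_def set_borel_measurable_def integrable_completion)
  qed (simp add: set_integrable_def)
  then have "set_integrable lborel {0<..<B} (\<lambda>s. C * s powr a)"
    by (rule set_integrable_mult_right)
  then show ?thesis
  proof (rule set_integrable_bound)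
    have "continuous_on {0<..<B} h" by (rule continuous_on_subset[OF assms(2)]) auto
    then show "set_borel_measurable lborel {0<..<B} (\<lambda>s. s powr a *\<^sub>R h s)"
      by (intro set_borel_measurable_continuous_on) (auto intro!: continuous_intros)
    have "norm (s powr a *\<^sub>R h s) \<le> norm (C * s powr a)" if "s \<in> {0<..<B}" for s
    proof -
      have "norm (h s) \<le> \<bar>C\<bar>" using C[of s] that by auto
      then show ?thesis by (simp add: abs_mult mult.commute[of _ "norm (h s)"] mult_right_mono)
    qed
    then show "AE s in lborel. s \<in> {0<..<B} \<longrightarrow> norm (s powr a *\<^sub>R h s) \<le> norm (C * s powr a)"
      by simp
  qed
qed

section \<open>Integrals along a ray\<close>

text \<open>Inside the principal range the logarithm of a polar form is explicit, hence so is every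
  real power. The angle of the result may leave that range, which \<open>rcis\<close>
  tolerates.\<close>

lemma rcis_powr:
  assumes "R > 0" "\<theta> \<in> {-pi<..pi}"
  shows "rcis R \<theta> powr of_real a = rcis (R powr a) (a * \<theta>)"
proof -
  have "rcis R \<theta> \<noteq> 0" using assms by simp
  moreover have "Ln (rcis R \<theta>) = of_real (ln R) + \<i> * of_real \<theta>"
    using Ln_rcis[OF assms] by (simp add: complex_eq_iff)
  ultimately have "rcis R \<theta> powr of_real a = exp (of_real (a * ln R) + \<i> * of_real (a * \<theta>))"
    by (simp add: powr_def algebra_simps)
  also have "\<dots> = of_real (exp (a * ln R)) * cis (a * \<theta>)"
    by (simp only: exp_add cis_conv_exp exp_of_real)
  also have "\<dots> = rcis (R powr a) (a * \<theta>)"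
    using assms(1) by (simp add: rcis_def powr_def)
  finally show ?thesis .
qed

text \<open>Here \<open>\<sigma>\<close> is the sign \<open>(-1) ^ (m + 1)\<close>; it selects the ray along which \<open>exp (\<i> \<sigma> \<omega> z powr r)\<close> decays.\<close>

locale ray =
  fixes r \<omega> \<sigma> :: real
  assumes r: "r \<ge> 1" and \<omega>: "\<omega> > 0" and \<sigma>: "\<sigma> = 1 \<or> \<sigma> = -1"
begin

definition \<alpha> :: real where "\<alpha> = pi / (2 * r)"

definition d :: complex where "d = cis (\<sigma> * \<alpha>)"

definition Z :: "real \<Rightarrow> real \<Rightarrow> complex" where "Z s t = of_real s + of_real t * d"

definition E :: "real \<Rightarrow> complex \<Rightarrow> complex" where
  "E c z = z powr of_real c * exp (\<i> * of_real (\<sigma> * \<omega>) * z powr of_real r)"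

text \<open>The derivative of \<open>E c\<close>. The exponent shifts by -1 and by r - 1, so
  differentiation stays within the family \<open>E\<close>, and c = 1 - r makes \<open>E 0\<close>
  appear, the integrand for \<mu> = 1.\<close>

definition E' :: "real \<Rightarrow> complex \<Rightarrow> complex" where
  "E' c z = of_real c * E (c - 1) z + \<i> * of_real (\<sigma> * \<omega> * r) * E (c + r - 1) z"

definition I :: "nat \<Rightarrow> real \<Rightarrow> real \<Rightarrow> complex" where
  "I n c s = (LBINT t:{0<..}. of_real t ^ n * E c (Z s t))"

section \<open>Geometry of the ray\<close>

lemma \<alpha>_bounds: "0 < \<alpha>" "\<alpha> \<le> pi / 2"
  using r by (auto simp: \<alpha>_def field_simps)

lemma Re_d: "Re d = cos \<alpha>" "Re d \<ge> 0" and Im_d: "\<sigma> * Im d = sin \<alpha>" "sin \<alpha> > 0"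
proof -
  show "Re d = cos \<alpha>" using \<sigma> by (auto simp: d_def)
  show "Re d \<ge> 0" unfolding \<open>Re d = cos \<alpha>\<close> using \<alpha>_bounds by (intro cos_ge_zero) auto
  show "\<sigma> * Im d = sin \<alpha>" using \<sigma> by (auto simp: d_def)
  show "sin \<alpha> > 0" using \<alpha>_bounds by (intro sin_gt_zero) auto
qed

lemma norm_d [simp]: "norm d = 1" and d_nz [simp]: "d \<noteq> 0"
  by (auto simp: d_def)

lemma Z_notin:
  assumes "0 \<le> s" "0 \<le> t" "s \<noteq> 0 \<or> t \<noteq> 0"
  shows "Z s t \<notin> \<real>\<^sub>\<le>\<^sub>0"
proof (cases "t = 0")
  case True then show ?thesis using assms by (simp add: Z_def)
next
  case False
  then have "Im (Z s t) \<noteq> 0" using Im_d by (auto simp: Z_def)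
  then show ?thesis by (auto simp: complex_nonpos_Reals_iff)
qed

text \<open>The bound by t comes from multiplying by \<open>cnj d\<close>: the t-part becomes real,
  and the s-part has nonnegative real part since r >= 1 keeps the angle \<alpha> at most pi /
  2.\<close>

lemma norm_Z:
  assumes "0 \<le> s" "0 \<le> t"
  shows "s \<le> norm (Z s t)" "t \<le> norm (Z s t)" "norm (Z s t) \<le> s + t"
proof -
  have "s \<le> Re (Z s t)" using Re_d assms by (simp add: Z_def)
  also have "\<dots> \<le> norm (Z s t)" by (rule complex_Re_le_cmod)
  finally show "s \<le> norm (Z s t)" .
  have "t \<le> Re (Z s t * cnj d)"
  proof -
    have "d * cnj d = 1" by (simp add: complex_norm_square[symmetric])
    then have "Z s t * cnj d = of_real s * cnj d + of_real t"
      by (simp add: Z_def algebra_simps)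
    then show ?thesis using Re_d assms by simp
  qed
  also have "\<dots> \<le> norm (Z s t * cnj d)" by (rule complex_Re_le_cmod)
  finally show "t \<le> norm (Z s t)" by (simp add: norm_mult)
  show "norm (Z s t) \<le> s + t"
    unfolding Z_def by (rule norm_triangle_le) (use assms in \<open>simp add: norm_mult\<close>)
qed

text \<open>The angle lies in [0, \<alpha>] because sin \<theta> and sin (\<alpha> - \<theta>) are
  nonnegative: multiplied by R they are t sin \<alpha> and s sin \<alpha>, the distances of the
  point from the lines spanned by 1 and by d.\<close>

lemma Z_polar:
  assumes "0 \<le> s" "0 \<le> t" "s \<noteq> 0 \<or> t \<noteq> 0"
  obtains R \<theta> where "R > 0" "0 \<le> \<theta>" "\<theta> \<le> \<alpha>" "Z s t = rcis R (\<sigma> * \<theta>)" "\<sigma> * \<theta> \<in> {-pi<..pi}"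
proof -
  define R where "R = norm (Z s t)"
  define \<theta> where "\<theta> = \<sigma> * Arg (Z s t)"
  have A: "Arg (Z s t) = \<sigma> * \<theta>" using \<sigma> by (auto simp: \<theta>_def)
  have Z: "Z s t = rcis R (\<sigma> * \<theta>)"
    unfolding R_def A[symmetric] by (simp add: rcis_cmod_Arg)
  have R: "R > 0" using Z_notin[OF assms] by (auto simp: R_def)
  have b: "-pi < Arg (Z s t)" "Arg (Z s t) \<le> pi" "Arg (Z s t) \<noteq> pi"
    using Arg_bounded Z_notin[OF assms] by (auto simp: Arg_eq_pi_iff complex_nonpos_Reals_iff complex_is_Real_iff)
  then have \<theta>: "-pi < \<theta>" "\<theta> < pi" using \<sigma> by (auto simp: \<theta>_def)
  have sin: "\<sigma> * sin (\<sigma> * x) = sin x" "cos (\<sigma> * x) = cos x" for x using \<sigma> by auto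
  have "R * sin \<theta> = \<sigma> * Im (Z s t)" unfolding Z by (simp add: sin mult.left_commute)
  also have "\<dots> = t * sin \<alpha>" using Im_d by (simp add: Z_def mult.left_commute)
  also have "\<dots> \<ge> 0" using assms Im_d by simp
  finally have s1: "sin \<theta> \<ge> 0" using R by (simp add: zero_le_mult_iff)
  have 1: "0 \<le> \<theta>"
  proof (rule ccontr)
    assume "\<not> 0 \<le> \<theta>"
    then have "sin (- \<theta>) > 0" using \<theta> by (intro sin_gt_zero) auto
    with s1 show False by simp
  qed
  have "R * sin (\<alpha> - \<theta>) = s * sin \<alpha>"
  proof -
    have "R * cos \<theta> = Re (Z s t)" unfolding Z by (simp add: sin)
    also have "\<dots> = s + t * cos \<alpha>" using Re_d by (simp add: Z_def)
    finally have "R * cos \<theta> = s + t * cos \<alpha>" .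
    moreover have "R * sin \<theta> = t * sin \<alpha>"
      using \<open>R * sin \<theta> = \<sigma> * Im (Z s t)\<close> \<open>\<sigma> * Im (Z s t) = t * sin \<alpha>\<close> by simp
    moreover have "R * sin (\<alpha> - \<theta>) = sin \<alpha> * (R * cos \<theta>) - cos \<alpha> * (R * sin \<theta>)"
      by (simp add: sin_diff algebra_simps)
    ultimately have "R * sin (\<alpha> - \<theta>) = sin \<alpha> * (s + t * cos \<alpha>) - cos \<alpha> * (t * sin \<alpha>)"
      by (simp only:)
    then show ?thesis by (simp add: algebra_simps)
  qed
  also have "\<dots> \<ge> 0" using assms Im_d by simp
  finally have s2: "sin (\<alpha> - \<theta>) \<ge> 0" using R by (simp add: zero_le_mult_iff)
  have 2: "\<theta> \<le> \<alpha>"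
  proof (rule ccontr)
    assume "\<not> \<theta> \<le> \<alpha>"
    then have "sin (\<theta> - \<alpha>) > 0" using \<theta> \<alpha>_bounds by (intro sin_gt_zero) auto
    with s2 show False using sin_minus[of "\<alpha> - \<theta>"] by simp
  qed
  show ?thesis using that[OF R 1 2 Z] b A by simp
qed

section \<open>The integrand on the ray\<close>

lemma DERIV_E:
  assumes "z \<notin> \<real>\<^sub>\<le>\<^sub>0"
  shows "(E c has_field_derivative E' c z) (at z)"
proof -
  have p: "z powr (of_real c) * z powr (of_real r - 1) = z powr of_real (c + r - 1)"
    by (simp add: powr_add[symmetric] add_diff_eq)
  have "(E c has_field_derivative
      of_real c * z powr (of_real c - 1) * exp (\<i> * of_real (\<sigma> * \<omega>) * z powr of_real r) +
      exp (\<i> * of_real (\<sigma> * \<omega>) * z powr of_real r) *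
        (\<i> * of_real (\<sigma> * \<omega>) * (of_real r * z powr (of_real r - 1))) * z powr of_real c) (at z)"
    unfolding E_def using assms
    by (auto intro!: derivative_eq_intros)
  then show ?thesis
  proof (rule DERIV_cong)
    show "of_real c * z powr (of_real c - 1) * exp (\<i> * of_real (\<sigma> * \<omega>) * z powr of_real r) +
      exp (\<i> * of_real (\<sigma> * \<omega>) * z powr of_real r) *
        (\<i> * of_real (\<sigma> * \<omega>) * (of_real r * z powr (of_real r - 1))) * z powr of_real c = E' c z"
      unfolding E'_def E_def p[symmetric] by (simp add: algebra_simps)
  qed
qed

lemma E_deriv_s:
  assumes "0 \<le> s" "0 \<le> t" "s \<noteq> 0 \<or> t \<noteq> 0"
  shows "((\<lambda>s. E c (Z s t)) has_vector_derivative E' c (Z s t)) (at s)"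
proof -
  have "((\<lambda>w. E c (w + of_real t * d)) has_field_derivative E' c (Z s t)) (at (of_real s))"
    by (rule DERIV_chain2[where g = "\<lambda>w. w + of_real t * d" and Db = 1, simplified])
       (use DERIV_E[OF Z_notin[OF assms]] in \<open>auto simp: Z_def intro!: derivative_eq_intros\<close>)
  then show ?thesis unfolding Z_def by (rule has_vector_derivative_real_field)
qed

lemma E_deriv_t:
  assumes "0 \<le> s" "0 \<le> t" "s \<noteq> 0 \<or> t \<noteq> 0"
  shows "((\<lambda>t. E c (Z s t)) has_vector_derivative d * E' c (Z s t)) (at t)"
proof -
  have "((\<lambda>w. E c (of_real s + w * d)) has_field_derivative E' c (Z s t) * d) (at (of_real t))"
    by (rule DERIV_chain2[where g = "\<lambda>w. of_real s + w * d"])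
       (use DERIV_E[OF Z_notin[OF assms]] in \<open>auto simp: Z_def intro!: derivative_eq_intros\<close>)
  then show ?thesis unfolding Z_def mult.commute[of d] by (rule has_vector_derivative_real_field)
qed

text \<open>Moving \<open>z\<close> to the right decreases \<open>Re (\<i> \<sigma> z powr r)\<close>, which on the ray from \<open>0\<close> equals \<open>- t powr r\<close>.\<close>

lemma norm_exp_le:
  assumes "0 \<le> s" "0 < t"
  shows "norm (exp (\<i> * of_real (\<sigma> * \<omega>) * Z s t powr of_real r)) \<le> exp (- \<omega> * t powr r)"
proof -
  define f where "f s = Re (\<i> * of_real \<sigma> * Z s t powr of_real r)" for s
  have "f s \<le> f 0"
  proof (rule DERIV_nonpos_imp_nonincreasing[OF assms(1)])
    fix x assume x: "0 \<le> x" "x \<le> s"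
    have "((\<lambda>w. (w + of_real t * d) powr of_real r) has_field_derivative
        of_real r * Z x t powr (of_real r - 1)) (at (of_real x))"
      by (rule DERIV_chain2[where g = "\<lambda>w. w + of_real t * d" and Db = 1, simplified])
         (use has_field_derivative_powr[OF Z_notin[of x t]] x assms in \<open>auto simp: Z_def intro!: derivative_eq_intros\<close>)
    then have "((\<lambda>x. Z x t powr of_real r) has_vector_derivative of_real r * Z x t powr (of_real r - 1)) (at x)"
      unfolding Z_def by (rule has_vector_derivative_real_field)
    then have D0: "((\<lambda>x. Im (Z x t powr of_real r)) has_real_derivative Im (of_real r * Z x t powr (of_real r - 1))) (at x)"
      by (simp only: has_vector_derivative_complex_iff)
    have D: "(f has_real_derivative - \<sigma> * Im (of_real r * Z x t powr (of_real r - 1))) (at x)"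
    proof -
      have "f = (\<lambda>x. - \<sigma> * Im (Z x t powr of_real r))" by (simp add: f_def fun_eq_iff)
      then show ?thesis using DERIV_cmult[OF D0, of "- \<sigma>"] by simp
    qed
    obtain R \<theta> where R: "R > 0" "0 \<le> \<theta>" "\<theta> \<le> \<alpha>" "Z x t = rcis R (\<sigma> * \<theta>)" "\<sigma> * \<theta> \<in> {-pi<..pi}"
      using Z_polar[of x t] x assms by auto
    have "Z x t powr (of_real r - 1) = rcis (R powr (r - 1)) ((r - 1) * (\<sigma> * \<theta>))"
      using rcis_powr[OF R(1,5), of "r - 1"] by (simp add: R(4))
    then have "\<sigma> * Im (of_real r * Z x t powr (of_real r - 1)) = r * R powr (r - 1) * sin ((r - 1) * \<theta>)"
      using \<sigma> by auto
    \<comment> \<open>Since \<theta> is at most \<alpha> and r \<alpha> = pi / 2, the angle (r - 1)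
      \<theta> stays where the sine is nonnegative.\<close>
    moreover have "sin ((r - 1) * \<theta>) \<ge> 0"
    proof (rule sin_ge_zero)
      show "0 \<le> (r - 1) * \<theta>" using r R by simp
      have "(r - 1) * \<theta> \<le> r * \<alpha>" using r R by (intro mult_mono) auto
      also have "\<dots> \<le> pi" using r by (simp add: \<alpha>_def)
      finally show "(r - 1) * \<theta> \<le> pi" .
    qed
    ultimately have "\<sigma> * Im (of_real r * Z x t powr (of_real r - 1)) \<ge> 0"
      using r by (simp only:) simp
    then have "- \<sigma> * Im (of_real r * Z x t powr (of_real r - 1)) \<le> 0"
      by (simp only: mult_minus_left neg_le_0_iff_le)
    with D show "\<exists>y. (f has_real_derivative y) (at x) \<and> y \<le> 0" by blast
  qed
  moreover have "f 0 = - (t powr r)"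
  proof -
    have "\<sigma> * \<alpha> \<in> {-pi<..pi}" using \<sigma> \<alpha>_bounds pi_gt_zero by auto
    moreover have "Z 0 t = rcis t (\<sigma> * \<alpha>)" by (simp add: Z_def d_def rcis_def)
    ultimately have "Z 0 t powr of_real r = rcis (t powr r) (r * (\<sigma> * \<alpha>))"
      using rcis_powr[of t "\<sigma> * \<alpha>" r] assms by simp
    also have "r * (\<sigma> * \<alpha>) = \<sigma> * (pi / 2)" using r by (simp add: \<alpha>_def)
    finally show ?thesis using \<sigma> by (auto simp: f_def)
  qed
  ultimately have "\<omega> * f s \<le> - \<omega> * t powr r"
    using mult_left_mono[of "f s" "- (t powr r)" \<omega>] \<omega> by simp
  moreover have "Re (\<i> * of_real (\<sigma> * \<omega>) * Z s t powr of_real r) = \<omega> * f s"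
    by (simp add: f_def)
  ultimately show ?thesis unfolding norm_exp_eq_Re by simp
qed

lemma norm_E_le:
  assumes "0 \<le> s" "0 < t"
  shows "norm (E c (Z s t)) \<le> norm (Z s t) powr c * exp (- \<omega> * t powr r)"
  unfolding E_def norm_mult
  using norm_exp_le[OF assms] by (simp add: norm_powr_real_powr' mult_left_mono)

text \<open>For nonpositive exponents a lower bound for the modulus is enough. With x = s it yields
  the remainder bounds, with x = t a majorant that is uniform in s down to 0.\<close>

lemma norm_E_le_powr:
  assumes "0 \<le> s" "0 < t" "0 < x" "x \<le> norm (Z s t)" "c \<le> 0"
  shows "norm (E c (Z s t)) \<le> x powr c * exp (- \<omega> * t powr r)"
  by (rule order_trans[OF norm_E_le])
     (use assms in \<open>auto intro!: mult_right_mono powr_mono2'\<close>)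

lemma continuous_E:
  assumes "0 \<le> s"
  shows "continuous_on {0<..} (\<lambda>t. E c (Z s t))"
  using assms
  by (intro continuous_at_imp_continuous_on ballI has_vector_derivative_continuous[OF E_deriv_t]) auto

lemma integrand_measurable:
  assumes "0 \<le> s"
  shows "set_borel_measurable lborel {0<..} (\<lambda>t. of_real t ^ n * E c (Z s t))"
  by (intro set_borel_measurable_continuous_on continuous_intros continuous_E assms) auto

section \<open>Majorants for the ray integrals\<close>

definition weight :: "nat \<Rightarrow> real \<Rightarrow> real" where "weight n t = t ^ n * exp (- \<omega> * t powr r)"

lemma weight_integral:
  assumes "real n + b > -1"
  shows "set_integrable lborel {0<..} (\<lambda>t. t powr b * weight n t)"
    and "(LBINT t:{0<..}. t powr b * weight n t) =
      1 / r * Gamma ((real n + b + 1) / r) * \<omega> powr (- ((real n + b + 1) / r))"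
proof -
  have r0: "r > 0" using r by simp
  have eq: "t powr (real n + b) * exp (- \<omega> * t powr r) = t powr b * weight n t" if "t \<in> {0<..}" for t
    using that by (simp add: weight_def powr_add powr_realpow ac_simps)
  show "set_integrable lborel {0<..} (\<lambda>t. t powr b * weight n t)"
    using powr_exp_integral(1)[OF assms r0 \<omega>]
    by (rule set_integrable_cong[THEN iffD1, rotated -1]) (simp_all only: eq)
  have "(LBINT t:{0<..}. t powr b * weight n t) = (LBINT t:{0<..}. t powr (real n + b) * exp (- \<omega> * t powr r))"
    by (rule set_lebesgue_integral_cong) (simp, intro allI impI, erule eq[symmetric])
  then show "(LBINT t:{0<..}. t powr b * weight n t) =
      1 / r * Gamma ((real n + b + 1) / r) * \<omega> powr (- ((real n + b + 1) / r))"
    using powr_exp_integral(2)[OF assms r0 \<omega>] by simp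
qed

lemma weight_nonneg: "t > 0 \<Longrightarrow> weight n t \<ge> 0" by (simp add: weight_def)

text \<open>A majorant for s in [a, b], a > 0, and any real c: a^c serves c <= 0, while for c > 0
  the modulus is at most s + t, hence at most the larger of 2 b and 2 t. The factor
  \<open>t powr 0\<close> gives the first summand the shape required by
  \<open>weight_integral\<close>.\<close>

definition dom :: "nat \<Rightarrow> real \<Rightarrow> real \<Rightarrow> real \<Rightarrow> real \<Rightarrow> real" where
  "dom n c a b t = (a powr c + (2 * b) powr \<bar>c\<bar>) * (t powr 0 * weight n t) + 2 powr \<bar>c\<bar> * (t powr \<bar>c\<bar> * weight n t)"

lemma dom_integrable: "set_integrable lborel {0<..} (dom n c a b)"
  unfolding dom_def by (intro set_integral_add set_integrable_mult_right weight_integral) auto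

lemma dom_bound:
  assumes "0 < a" "a \<le> s" "s \<le> b" "0 < t"
  shows "norm (of_real t ^ n * E c (Z s t)) \<le> dom n c a b t"
proof -
  have s: "0 \<le> s" using assms by simp
  note Z = norm_Z[OF s, of t]
  have "norm (Z s t) powr c \<le> a powr c + (2 * b) powr \<bar>c\<bar> + (2 * t) powr \<bar>c\<bar>"
  proof (cases "c \<le> 0")
    case True
    have "norm (Z s t) powr c \<le> a powr c" using Z assms True by (intro powr_mono2') auto
    then show ?thesis by (simp add: add_increasing2)
  next
    case False
    have "norm (Z s t) \<le> max (2 * b) (2 * t)" using Z assms by auto
    then have "norm (Z s t) powr c \<le> (max (2 * b) (2 * t)) powr c" using False by (intro powr_mono2) auto
    also have "\<dots> \<le> (2 * b) powr c + (2 * t) powr c" by (simp add: max_def)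
    finally have "norm (Z s t) powr c \<le> (2 * b) powr c + (2 * t) powr c" .
    moreover have "\<bar>c\<bar> = c" "0 \<le> a powr c" using False by auto
    ultimately show ?thesis by linarith
  qed
  then have "norm (Z s t) powr c * weight n t \<le> (a powr c + (2 * b) powr \<bar>c\<bar> + (2 * t) powr \<bar>c\<bar>) * weight n t"
    using weight_nonneg assms by (intro mult_right_mono) auto
  also have "\<dots> = dom n c a b t"
    using assms by (simp add: dom_def powr_mult algebra_simps)
  finally have "norm (Z s t) powr c * weight n t \<le> dom n c a b t" .
  moreover have "norm (of_real t ^ n * E c (Z s t)) \<le> t ^ n * (norm (Z s t) powr c * exp (- \<omega> * t powr r))"
    using norm_E_le[OF s assms(4), of c] assms by (simp add: norm_mult norm_power mult_left_mono)
  ultimately show ?thesis by (simp add: weight_def ac_simps)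
qed

lemma integrable_integrand:
  assumes "0 < s"
  shows "set_integrable lborel {0<..} (\<lambda>t. of_real t ^ n * E c (Z s t))"
proof (rule set_integrable_bound[OF dom_integrable[of n c s s]])
  show "AE t in lborel. t \<in> {0<..} \<longrightarrow> norm (of_real t ^ n * E c (Z s t)) \<le> norm (dom n c s s t)"
  proof (intro AE_I2 impI)
    fix t :: real assume "t \<in> {0<..}"
    then show "norm (of_real t ^ n * E c (Z s t)) \<le> norm (dom n c s s t)"
      using dom_bound[of s s s t n c] assms by (simp add: abs_if)
  qed
qed (use assms in \<open>auto intro: integrand_measurable\<close>)

section \<open>Differentiation in s and integration by parts in t\<close>

lemma I_E':
  assumes "0 < s"
  shows "set_integrable lborel {0<..} (\<lambda>t. of_real t ^ n * E' c (Z s t))"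
    and "(LBINT t:{0<..}. of_real t ^ n * E' c (Z s t)) =
      of_real c * I n (c - 1) s + \<i> * of_real (\<sigma> * \<omega> * r) * I n (c + r - 1) s"
proof -
  have eq: "(\<lambda>t. of_real t ^ n * E' c (Z s t)) =
      (\<lambda>t. of_real c * (of_real t ^ n * E (c - 1) (Z s t)) +
        \<i> * of_real (\<sigma> * \<omega> * r) * (of_real t ^ n * E (c + r - 1) (Z s t)))"
    by (simp add: E'_def algebra_simps fun_eq_iff)

  show "set_integrable lborel {0<..} (\<lambda>t. of_real t ^ n * E' c (Z s t))"
    unfolding eq by (intro set_integral_add set_integrable_mult_right integrable_integrand assms)
  show "(LBINT t:{0<..}. of_real t ^ n * E' c (Z s t)) =
      of_real c * I n (c - 1) s + \<i> * of_real (\<sigma> * \<omega> * r) * I n (c + r - 1) s"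
    unfolding eq I_def
    by (subst set_integral_add(2)) (intro set_integrable_mult_right integrable_integrand assms,
        intro set_integrable_mult_right integrable_integrand assms, simp only: set_integral_mult_right)
qed

lemma I_deriv_E':
  assumes "0 < s"
  shows "(I n c has_vector_derivative (LBINT t:{0<..}. of_real t ^ n * E' c (Z s t))) (at s)"
  unfolding I_def
\<comment> \<open>Between s / 2 and 2 s the distance to the singularity at 0 is bounded below, so
  one majorant serves the whole neighbourhood; its two summands match the two terms of
  \<open>E'\<close>.\<close>
proof (rule has_vector_derivative_set_lebesgue_integral[where a = "s / 2" and b = "2 * s" and
      g = "\<lambda>t. \<bar>c\<bar> * dom n (c - 1) (s / 2) (2 * s) t + \<omega> * r * dom n (c + r - 1) (s / 2) (2 * s) t"])
  fix x assume x: "s / 2 < x" "x < 2 * s"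
  then have x0: "0 < x" using assms by simp
  show "set_integrable lborel {0<..} (\<lambda>t. of_real t ^ n * E c (Z x t))"
    by (rule integrable_integrand[OF x0])
  fix t :: real assume "t \<in> {0<..}"
  then have t: "0 < t" by simp
  show "((\<lambda>s. of_real t ^ n * E c (Z s t)) has_vector_derivative of_real t ^ n * E' c (Z x t)) (at x)"
    using E_deriv_s[of x t c] x0 t by (intro has_vector_derivative_mult_right) auto
  have "norm (of_real t ^ n * E' c (Z x t)) \<le>
      norm (of_real c * (of_real t ^ n * E (c - 1) (Z x t))) +
      norm (\<i> * of_real (\<sigma> * \<omega> * r) * (of_real t ^ n * E (c + r - 1) (Z x t)))"
    unfolding E'_def by (rule order_trans[OF _ norm_triangle_ineq]) (simp add: algebra_simps)
  also have "\<dots> = \<bar>c\<bar> * norm (of_real t ^ n * E (c - 1) (Z x t)) +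
      \<omega> * r * norm (of_real t ^ n * E (c + r - 1) (Z x t))"
    using \<sigma> \<omega> r by (auto simp: norm_mult)
  also have "\<dots> \<le> \<bar>c\<bar> * dom n (c - 1) (s / 2) (2 * s) t + \<omega> * r * dom n (c + r - 1) (s / 2) (2 * s) t"
    using x assms t \<omega> r by (intro add_mono mult_left_mono dom_bound) auto
  finally show "norm (of_real t ^ n * E' c (Z x t)) \<le> \<dots>" .
next
  show "set_borel_measurable lborel {0<..} (\<lambda>t. of_real t ^ n * E' c (Z s t))"
    using I_E'(1)[OF assms] by (auto simp: set_integrable_def set_borel_measurable_def)
qed (use assms in \<open>auto intro!: set_integral_add set_integrable_mult_right dom_integrable\<close>)

lemma dom_tendsto: "(dom n c a b \<longlongrightarrow> 0) at_top"
proof -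
  have "((\<lambda>t. (a powr c + (2 * b) powr \<bar>c\<bar>) * (t ^ n * exp (- \<omega> * t)) +
      2 powr \<bar>c\<bar> * (t powr \<bar>c\<bar> * (t ^ n * exp (- \<omega> * t)))) \<longlongrightarrow> 0) at_top"
  proof -
    have 1: "((\<lambda>t. t powr e * (t ^ n * exp (- \<omega> * t))) \<longlongrightarrow> 0) at_top" for e
      using \<omega> by real_asymp
    have 2: "((\<lambda>t. (t ^ n * exp (- \<omega> * t))) \<longlongrightarrow> 0) at_top"
      using \<omega> by real_asymp
    show ?thesis by (intro tendsto_add_zero tendsto_mult_right_zero 1 2)
  qed
  then show ?thesis
  proof (rule Lim_null_comparison[rotated])
    show "\<forall>\<^sub>F t in at_top. norm (dom n c a b t) \<le> (a powr c + (2 * b) powr \<bar>c\<bar>) * (t ^ n * exp (- \<omega> * t)) +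
      2 powr \<bar>c\<bar> * (t powr \<bar>c\<bar> * (t ^ n * exp (- \<omega> * t)))"
      using eventually_ge_at_top[of 1]
    proof eventually_elim
      case (elim t)
      \<comment> \<open>Since r >= 1, the plain exponential exp (- \<omega> t) is a majorant for t
        >= 1.\<close>
      have "t powr 1 \<le> t powr r" using elim r by (intro powr_mono) auto
      then have w: "weight n t \<le> t ^ n * exp (- \<omega> * t)"
        using elim \<omega> by (auto simp: weight_def intro!: mult_left_mono)
      have "dom n c a b t \<ge> 0" using elim weight_nonneg[of t n] by (auto simp: dom_def intro!: add_nonneg_nonneg mult_nonneg_nonneg)
      then show ?case unfolding dom_def real_norm_def using w elim
        by (auto simp: intro!: add_mono mult_left_mono)
    qed
  qed
qed

text \<open>The fundamental theorem for t^n E c (Z s t) on the half line: nothing survives at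
  infinity, and at t = 0 only n = 0 leaves a term. The truncated \<open>n - 1\<close> at n = 0 is
  harmless, as its factor is zero. With c = \<mu> - 1 the identity yields the derivative of
  \<open>I\<close>, with c = 1 - r the additional decay in \<omega>.\<close>

lemma I_parts:
  assumes s: "0 < s"
  shows "of_nat n * I (n - 1) c s + d * (LBINT t:{0<..}. of_real t ^ n * E' c (Z s t)) =
    - (if n = 0 then E c (of_real s) else 0)"
proof -
  define F where "F t = of_real t ^ n * E c (Z s t)" for t
  define f where "f t = of_nat n * (of_real t ^ (n - 1) * E c (Z s t)) + d * (of_real t ^ n * E' c (Z s t))" for t
  have eint: "einterval 0 \<infinity> = {0<..}" by (auto simp: einterval_def)
  have DF: "(F has_vector_derivative f t) (at t)" if "0 \<le> t" for t
  proof -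
    have "((\<lambda>t. complex_of_real t ^ n) has_vector_derivative of_nat n * of_real t ^ (n - 1)) (at t)"
      by (rule has_vector_derivative_real_field[where f = "\<lambda>z. z ^ n"]) (auto intro!: derivative_eq_intros)
    from has_vector_derivative_mult[OF this E_deriv_t[of s t c]] show ?thesis
      using s that unfolding F_def f_def by (simp add: algebra_simps)
  qed
  have int: "set_integrable lborel {0<..} f"
    unfolding f_def by (intro set_integral_add set_integrable_mult_right integrable_integrand I_E' s)
  have "(LBINT t=0..\<infinity>. f t) = 0 - (if n = 0 then E c (of_real s) else 0)"
  proof (rule interval_integral_FTC_integrable)
    show "(F has_vector_derivative f t) (at t)" if "0 < ereal t" for t
      using that by (intro DF) auto
    show "isCont f t" if "0 < ereal t" for t
    proof -
      have "isCont (\<lambda>t. E c (Z s t)) t" for c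
        using E_deriv_t[of s t c] that s by (intro has_vector_derivative_continuous) auto
      then show ?thesis unfolding f_def E'_def by (intro continuous_intros)
    qed
    show "set_integrable lborel (einterval 0 \<infinity>) f" unfolding eint by (rule int)
    have "isCont F 0" using DF[of 0] by (intro has_vector_derivative_continuous) auto
    then have "(F \<longlongrightarrow> F 0) (at_right 0)"
      by (simp add: continuous_within filterlim_at_split)
    moreover have "F 0 = (if n = 0 then E c (of_real s) else 0)" by (auto simp: F_def Z_def)
    ultimately show "((F \<circ> real_of_ereal) \<longlongrightarrow> (if n = 0 then E c (of_real s) else 0)) (at_right 0)"
      unfolding zero_ereal_def ereal_tendsto_simps1 by simp
    have "(F \<longlongrightarrow> 0) at_top"
    proof (rule Lim_null_comparison[OF _ dom_tendsto[of n c s s]])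
      show "\<forall>\<^sub>F t in at_top. norm (F t) \<le> dom n c s s t"
        using eventually_gt_at_top[of 0] unfolding F_def
        by eventually_elim (use s in \<open>auto intro!: dom_bound\<close>)
    qed
    then show "((F \<circ> real_of_ereal) \<longlongrightarrow> 0) (at_left \<infinity>)"
      unfolding ereal_tendsto_simps1 by simp
  qed auto
  moreover have "(LBINT t=0..\<infinity>. f t) = (LBINT t:{0<..}. f t)"
    by (simp add: interval_lebesgue_integral_def eint)
  moreover have "(LBINT t:{0<..}. f t) = of_nat n * I (n - 1) c s + d * (LBINT t:{0<..}. of_real t ^ n * E' c (Z s t))"
    unfolding f_def I_def
    by (subst set_integral_add(2)) (intro set_integrable_mult_right integrable_integrand s,
        intro set_integrable_mult_right I_E' s, simp only: set_integral_mult_right)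
  ultimately show ?thesis by simp
qed

text \<open>The integral of \<open>E'\<close> is eliminated between differentiation in s and
  integration by parts in t. Each derivative lowers n by one, and n = 0 returns the integrand at the
  foot of the ray.\<close>

lemma I_deriv:
  assumes "0 < s"
  shows "(I n c has_vector_derivative
    - (of_nat n * I (n - 1) c s + (if n = 0 then E c (of_real s) else 0)) / d) (at s)"
proof -
  have "(LBINT t:{0<..}. of_real t ^ n * E' c (Z s t)) =
      - (of_nat n * I (n - 1) c s + (if n = 0 then E c (of_real s) else 0)) / d"
    using I_parts[OF assms, of n c] by (simp add: field_simps add_eq_0_iff)
  with I_deriv_E'[OF assms, of n c] show ?thesis by simp
qed

lemma norm_I_le:
  assumes "0 < s" "c \<le> 0"
  shows "norm (I n c s) \<le> s powr c * (1 / r * Gamma ((real n + 1) / r) * \<omega> powr (- ((real n + 1) / r)))"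
proof -
  have w: "(LBINT t:{0<..}. weight n t) = 1 / r * Gamma ((real n + 1) / r) * \<omega> powr (- ((real n + 1) / r))"
    "set_integrable lborel {0<..} (weight n)"
  proof -
    have "(LBINT t:{0<..}. weight n t) = (LBINT t:{0<..}. t powr 0 * weight n t)"
      by (rule set_lebesgue_integral_cong) auto
    then show "(LBINT t:{0<..}. weight n t) = 1 / r * Gamma ((real n + 1) / r) * \<omega> powr (- ((real n + 1) / r))"
      using weight_integral(2)[of n 0] by simp
    show "set_integrable lborel {0<..} (weight n)"
      using weight_integral(1)[of n 0] by (rule set_integrable_cong[THEN iffD1, rotated -1]) auto
  qed
  have "norm (I n c s) \<le> (LBINT t:{0<..}. norm (of_real t ^ n * E c (Z s t)))"
    unfolding I_def by (rule set_integral_norm_bound) (rule integrable_integrand[OF assms(1)])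
  also have "\<dots> \<le> (LBINT t:{0<..}. s powr c * weight n t)"
  proof (rule set_integral_mono)
    show "set_integrable lborel {0<..} (\<lambda>t. norm (of_real t ^ n * E c (Z s t)))"
      by (rule set_integrable_norm) (rule integrable_integrand[OF assms(1)])
    show "set_integrable lborel {0<..} (\<lambda>t. s powr c * weight n t)"
      by (rule set_integrable_mult_right) (rule w)
    fix t :: real assume t: "t \<in> {0<..}"
    have "norm (E c (Z s t)) \<le> s powr c * exp (- \<omega> * t powr r)"
      by (rule norm_E_le_powr) (use norm_Z assms t in auto)
    then show "norm (of_real t ^ n * E c (Z s t)) \<le> s powr c * weight n t"
      using t by (simp add: norm_mult norm_power weight_def mult_left_mono mult.left_commute)
  qed
  also have "\<dots> = s powr c * (1 / r * Gamma ((real n + 1) / r) * \<omega> powr (- ((real n + 1) / r)))"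
    using w(1) by simp
  finally show ?thesis .
qed

text \<open>The modulus of Z is at least t, so t^c times the weight is a majorant uniform down to s
  = 0, integrable because c > -1. This provides the boundary values at 0 in the integration by
  parts.\<close>

lemma I_continuous:
  assumes "-1 < c" "c \<le> 0"
  shows "continuous_on {0..} (I n c)"
  unfolding I_def
proof (rule continuous_on_set_lebesgue_integral)
  fix t :: real assume t: "t \<in> {0<..}"
  show "continuous_on {0..} (\<lambda>s. of_real t ^ n * E c (Z s t))"
    using E_deriv_s[of _ t c] t
    by (intro continuous_intros continuous_at_imp_continuous_on ballI)
       (auto intro: has_vector_derivative_continuous)
  fix s :: real assume s: "s \<in> {0..}"
  have "norm (E c (Z s t)) \<le> t powr c * exp (- \<omega> * t powr r)"
    by (rule norm_E_le_powr) (use norm_Z assms s t in auto)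
  then show "norm (of_real t ^ n * E c (Z s t)) \<le> t powr c * weight n t"
    using t by (simp add: norm_mult norm_power weight_def mult_left_mono mult.left_commute)
qed (use assms in \<open>auto intro!: weight_integral integrand_measurable\<close>)

text \<open>On the ray from 0 one has z = t d and d^r = i \<sigma>, so the exponent is exactly -
  \<omega> t^r and a real Gamma integral remains.\<close>

lemma I_at_0:
  assumes "-1 < c"
  shows "I n c 0 = d powr of_real c *
    of_real (1 / r * Gamma ((real n + c + 1) / r) * \<omega> powr (- ((real n + c + 1) / r)))"
proof -
  have "of_real t ^ n * E c (Z 0 t) = d powr of_real c * of_real (t powr c * weight n t)" if "t > 0" for t
  proof -
    have 1: "\<sigma> * \<alpha> \<in> {-pi<..pi}" using \<sigma> \<alpha>_bounds pi_gt_zero by auto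
    have 2: "Z 0 t powr of_real a = of_real (t powr a) * cis (a * (\<sigma> * \<alpha>))" for a
      using rcis_powr[OF that 1, of a] by (simp add: Z_def d_def rcis_def)
    have 3: "d powr of_real a = cis (a * (\<sigma> * \<alpha>))" for a
      using rcis_powr[OF zero_less_one 1, of a] by (simp add: d_def rcis_def)
    have 4: "\<i> * of_real (\<sigma> * \<omega>) * Z 0 t powr of_real r = of_real (- \<omega> * t powr r)"
    proof -
      have "r * (\<sigma> * \<alpha>) = \<sigma> * (pi / 2)" using r by (simp add: \<alpha>_def)
      then show ?thesis unfolding 2 \<open>r * (\<sigma> * \<alpha>) = \<sigma> * (pi / 2)\<close> using \<sigma> by (auto simp: complex_eq_iff)
    qed
    show ?thesis unfolding E_def 2[of c] 3[of c] 4 exp_of_real weight_def by simp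
  qed
  then have "I n c 0 = (LBINT t:{0<..}. d powr of_real c * of_real (t powr c * weight n t))"
    unfolding I_def by (intro set_lebesgue_integral_cong) auto
  also have "\<dots> = d powr of_real c * of_real (LBINT t:{0<..}. t powr c * weight n t)"
    by (simp only: set_integral_mult_right set_integral_complex_of_real)
  finally show ?thesis using weight_integral(2)[of n c] assms by simp
qed

end

section \<open>The primitives and their bounds\<close>

lemma L_coefficients_pos:
  assumes "r > 1" "N \<ge> 1"
  shows "L_a r N > 0" "L_b r N > 0" "L_c r N > 0"
  using assms by (auto simp: L_a_def L_b_def L_c_def intro!: mult_pos_pos divide_pos_pos Gamma_real_pos)

text \<open>Existence is the intermediate value theorem. For uniqueness the equation is divided by
  K^r: b K^(1-r) + c K^(-r) is strictly decreasing and must equal a.\<close>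

lemma L_K_unique:
  assumes r: "r > 1" and a: "(a::real) > 0" and b: "b > 0" and c: "c > 0"
  shows "\<exists>!K. K > 0 \<and> a * K powr r - b * K - c = 0"
proof -
  define f where "f K = a * K powr r - b * K - c" for K
  \<comment> \<open>Chosen so that B >= 1 and a B^(r-1) >= b + c, whence a B^r >= b B + c B >= b B +
    c.\<close>
  define B where "B = max 1 (((b + c) / a) powr (1 / (r - 1)))"
  have B: "B \<ge> 1" by (simp add: B_def)
  have "(((b + c) / a) powr (1 / (r - 1))) powr (r - 1) \<le> B powr (r - 1)"
    using r by (intro powr_mono2) (auto simp: B_def)
  then have "(b + c) / a \<le> B powr (r - 1)" using r a b c by (simp add: powr_powr)
  then have "(b + c) * B \<le> a * B powr (r - 1) * B"
    using a B by (intro mult_right_mono) (auto simp: field_simps)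
  also have "a * B powr (r - 1) * B = a * B powr r" using B by (simp add: powr_diff)
  finally have "b * B + c * B \<le> a * B powr r" by (simp add: algebra_simps)
  moreover have "c * 1 \<le> c * B" using B c by (intro mult_left_mono) auto
  ultimately have "f B \<ge> 0" by (simp add: f_def)
  moreover have "f 0 \<le> 0" using c by (simp add: f_def)
  moreover have "continuous_on {0..B} f"
    unfolding f_def using r by (intro continuous_intros continuous_on_powr') auto
  ultimately obtain K where K: "0 \<le> K" "K \<le> B" "f K = 0"
    using IVT'[of f 0 0 B] B by auto
  moreover have "K \<noteq> 0" using K(3) c by (auto simp: f_def)
  ultimately have ex: "K > 0 \<and> f K = 0" by simp
  define g where "g K = b * K powr (1 - r) + c * K powr (- r)" for K
  have g: "g K = a" if "K > 0" "f K = 0" for K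
  proof -
    have "a * K powr r = b * K + c" using that by (simp add: f_def)
    then have "a = (b * K + c) / K powr r" using that by (simp add: field_simps)
    then show ?thesis using that by (simp add: g_def powr_diff powr_minus field_simps)
  qed
  have g_less: "g y < g x" if "0 < x" "x < y" for x y
    unfolding g_def using that r b c by (intro add_strict_mono mult_strict_left_mono powr_less_mono2_neg) auto
  have uniq: "x = y" if "x > 0 \<and> f x = 0" "y > 0 \<and> f y = 0" for x y
    using g_less[of x y] g_less[of y x] g[of x] g[of y] that by (cases x y rule: linorder_cases) auto
  show ?thesis
  proof (rule ex1I)
    show "K > 0 \<and> a * K powr r - b * K - c = 0" using ex by (simp add: f_def)
    show "x = K" if "x > 0 \<and> a * x powr r - b * x - c = 0" for x
      using uniq[of x K] that ex by (simp add: f_def)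
  qed
qed

lemma L_K:
  assumes "r > 1" "N \<ge> 1"
  shows "L_K r N > 0" "L_a r N * L_K r N powr r = L_b r N * L_K r N + L_c r N"
  using theI'[OF L_K_unique[OF assms(1) L_coefficients_pos[OF assms]]] unfolding L_K_def[symmetric]
  by auto

text \<open>Up to K the constant bound suffices, as (K / x)^\<gamma> >= 1. Beyond K the other bound
  times x^\<gamma> is nonincreasing, and its value at K is a K^\<gamma> by the equation for
  K.\<close>

lemma L_const_interpolation:
  assumes "r \<ge> 2" "N \<ge> 1" "0 < \<gamma>" "\<gamma> < 1" "x > 0"
  shows "min (L_a r N) (L_b r N * x powr (1 - r) + L_c r N * x powr (- r)) \<le> L_const \<gamma> r N * x powr (- \<gamma>)"
proof -
  have r: "r > 1" using assms by simp
  note K = L_K[OF r assms(2)] and pos = L_coefficients_pos[OF r assms(2)]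
  define K where "K = L_K r N"
  have K0: "K > 0" using K by (simp add: K_def)
  show ?thesis
  proof (cases "x \<le> K")
    case True
    have "1 \<le> K powr \<gamma> * x powr (- \<gamma>)"
      using powr_mono2[of \<gamma> x K] assms True by (simp add: powr_minus field_simps)
    then have "L_a r N * 1 \<le> L_a r N * (K powr \<gamma> * x powr (- \<gamma>))"
      using pos by (intro mult_left_mono) auto
    then show ?thesis by (simp add: L_const_def K_def mult.assoc min.coboundedI1)
  next
    case False
    have "x powr \<gamma> * (L_b r N * x powr (1 - r) + L_c r N * x powr (- r)) =
        L_b r N * x powr (\<gamma> + 1 - r) + L_c r N * x powr (\<gamma> - r)"
      using assms by (simp add: powr_add powr_diff powr_minus algebra_simps divide_inverse)
    \<comment> \<open>Here r >= 2 and \<gamma> < 1 make the exponent \<gamma> + 1 - r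
      nonpositive.\<close>
    also have "\<dots> \<le> L_b r N * K powr (\<gamma> + 1 - r) + L_c r N * K powr (\<gamma> - r)"
      using assms pos K0 False by (intro add_mono mult_left_mono powr_mono2') auto
    also have "\<dots> = K powr \<gamma> * ((L_b r N * K + L_c r N) / K powr r)"
      using K0 by (simp add: powr_add powr_diff field_simps)
    also have "\<dots> = L_const \<gamma> r N"
      unfolding K_def K(2)[symmetric] using K(1) by (simp add: L_const_def)
    finally have "x powr (- \<gamma>) * (x powr \<gamma> * (L_b r N * x powr (1 - r) + L_c r N * x powr (- r))) \<le>
        x powr (- \<gamma>) * L_const \<gamma> r N" by (intro mult_left_mono) auto
    moreover have "x powr (- \<gamma>) * x powr \<gamma> = 1" using assms by (simp add: powr_minus)
    ultimately have "L_b r N * x powr (1 - r) + L_c r N * x powr (- r) \<le> L_const \<gamma> r N * x powr (- \<gamma>)"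
      by (simp only: mult.assoc[symmetric] mult_1_left) (simp only: mult.commute)
    then show ?thesis by (simp add: min.coboundedI2)
  qed
qed

section \<open>The functions \<phi> as iterated primitives\<close>

context ray
begin

text \<open>\<open>P \<mu> n\<close> is the function \<open>\<phi>\<close> with index \<open>n + 1\<close> of the context.\<close>

definition P :: "real \<Rightarrow> nat \<Rightarrow> real \<Rightarrow> complex" where
  "P \<mu> n s = (-1) ^ Suc n / fact n * d ^ Suc n * I n (\<mu> - 1) s"

text \<open>Along the ray z - s = t d, so (z - s)^n contributes d^n and the velocity one more factor
  d.\<close>

lemma phi_prim_eq:
  assumes "\<sigma> = (-1) ^ (m + 1)"
  shows "phi_prim m (Suc n) s \<omega> r \<mu> = P \<mu> n s"
proof -
  have dir: "Lambda_dir m r = d" unfolding Lambda_dir_def d_def \<alpha>_def assms[symmetric] ..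
  have \<sigma>': "(-1) ^ (m + 1) * \<i> * of_real \<omega> = \<i> * of_real (\<sigma> * \<omega>)" using assms by simp
  have "einterval 0 \<infinity> = {0<..}" by (auto simp: einterval_def)
  then have "(LBINT t=0..\<infinity>. (Lambda m r s t - of_real s) ^ n * Lambda m r s t powr of_real (\<mu> - 1) *
       exp ((-1) ^ (m + 1) * \<i> * of_real \<omega> * Lambda m r s t powr of_real r) * Lambda_dir m r) =
     (LBINT t:{0<..}. d ^ Suc n * (of_real t ^ n * E (\<mu> - 1) (Z s t)))"
    unfolding interval_lebesgue_integral_def Lambda_def dir \<sigma>' E_def Z_def
    by (simp add: power_mult_distrib mult_ac)
  also have "\<dots> = d ^ Suc n * I n (\<mu> - 1) s"
    unfolding I_def by (rule set_integral_mult_right)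
  finally show ?thesis unfolding phi_prim_def Lambda_integral_def P_def by simp
qed

lemma E_of_real:
  assumes "s \<ge> 0"
  shows "E c (of_real s) = of_real (s powr c) * exp (\<i> * of_real (\<sigma> * \<omega> * s powr r))"
  using assms by (simp add: E_def powr_of_real mult.assoc)

lemma norm_E_of_real: "s \<ge> 0 \<Longrightarrow> norm (E c (of_real s)) = s powr c"
  by (simp add: E_of_real norm_mult norm_exp_eq_Re)

text \<open>The prefactor of \<open>P\<close> is what absorbs the factors - n / d and - 1 / d
  produced by \<open>I_deriv\<close>.\<close>

lemma P_deriv:
  assumes "0 < s"
  shows "(P \<mu> n has_vector_derivative (case n of 0 \<Rightarrow> E (\<mu> - 1) (of_real s) | Suc k \<Rightarrow> P \<mu> k s)) (at s)"
proof -
  have "(P \<mu> n has_vector_derivative (-1) ^ Suc n / fact n * d ^ Suc n *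
     (- (of_nat n * I (n - 1) (\<mu> - 1) s + (if n = 0 then E (\<mu> - 1) (of_real s) else 0)) / d)) (at s)"
    unfolding P_def by (intro has_vector_derivative_mult_right I_deriv assms)
  also have "(-1) ^ Suc n / fact n * d ^ Suc n *
     (- (of_nat n * I (n - 1) (\<mu> - 1) s + (if n = 0 then E (\<mu> - 1) (of_real s) else 0)) / d) =
     (case n of 0 \<Rightarrow> E (\<mu> - 1) (of_real s) | Suc k \<Rightarrow> P \<mu> k s)"
    by (cases n) (simp_all add: P_def field_simps del: of_nat_Suc)
  finally show ?thesis .
qed

lemma P_continuous: "0 < \<mu> \<Longrightarrow> \<mu> \<le> 1 \<Longrightarrow> continuous_on {0..} (P \<mu> n)"
  unfolding P_def by (intro continuous_intros I_continuous) auto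

text \<open>The angles (n + 1) \<alpha> and (\<mu> - 1) \<alpha> add up to (pi / 2) (n + \<mu>) / r,
  up to the sign \<sigma> the angle in \<open>Theta\<close>. The factor \<sigma> on the right undoes
  the sign (-1)^(m+1) contained in \<open>Theta\<close>.\<close>

lemma P_at_0:
  assumes "0 < \<mu>" and m: "\<sigma> = (-1) ^ (m + 1)"
  shows "(-1) ^ Suc n * P \<mu> n 0 =
    of_real \<sigma> * Theta m (n + 1) r \<mu> * of_real (\<omega> powr (- ((real n + \<mu>) / r)))"
proof -
  have 1: "\<sigma> * \<alpha> \<in> {-pi<..pi}" using \<sigma> \<alpha>_bounds pi_gt_zero by auto
  have "d powr of_real (\<mu> - 1) = cis ((\<mu> - 1) * (\<sigma> * \<alpha>))"
    using rcis_powr[OF zero_less_one 1, of "\<mu> - 1"] by (simp add: d_def rcis_def)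
  then have "d ^ Suc n * d powr of_real (\<mu> - 1) = cis (real (Suc n) * (\<sigma> * \<alpha>) + (\<mu> - 1) * (\<sigma> * \<alpha>))"
    by (simp only: d_def Complex.DeMoivre cis_mult)
  moreover have "real (Suc n) * (\<sigma> * \<alpha>) + (\<mu> - 1) * (\<sigma> * \<alpha>) = \<sigma> * (pi / 2) * ((real n + \<mu>) / r)"
    using r by (simp add: \<alpha>_def field_simps)
  ultimately have "d ^ Suc n * d powr of_real (\<mu> - 1) = cis (\<sigma> * (pi / 2) * ((real n + \<mu>) / r))"
    by (simp only:)
  moreover have "(-1) ^ Suc n * P \<mu> n 0 = (d ^ Suc n * d powr of_real (\<mu> - 1)) *
     of_real (1 / (fact n * r) * Gamma ((real n + \<mu>) / r) * \<omega> powr (- ((real n + \<mu>) / r)))"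
    using I_at_0[of "\<mu> - 1" n] assms(1)
    by (simp add: P_def power_mult_distrib[symmetric] field_simps del: power_Suc)
  moreover have "of_real \<sigma> * Theta m (n + 1) r \<mu> =
      of_real (1 / (fact n * r) * Gamma ((real n + \<mu>) / r)) * cis (\<sigma> * (pi / 2) * ((real n + \<mu>) / r))"
    unfolding Theta_def m[symmetric] using \<sigma> by auto
  ultimately show ?thesis by (simp only: of_real_mult) (simp only: mult_ac)
qed

lemma norm_P_le:
  assumes "0 < s" "\<mu> \<le> 1"
  shows "norm (P \<mu> n s) \<le> 1 / fact n * (1 / r) * Gamma ((real n + 1) / r) * s powr (\<mu> - 1) *
    \<omega> powr (- ((real n + 1) / r))"
proof -
  have "norm (P \<mu> n s) = 1 / fact n * norm (I n (\<mu> - 1) s)"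
    by (simp add: P_def norm_mult norm_divide norm_power)
  also have "\<dots> \<le> 1 / fact n *
      (s powr (\<mu> - 1) * (1 / r * Gamma ((real n + 1) / r) * \<omega> powr (- ((real n + 1) / r))))"
    using assms by (intro mult_left_mono norm_I_le) auto
  finally show ?thesis by (simp add: ac_simps)
qed

text \<open>For c = 1 - r the second term of \<open>E'\<close> is i \<sigma> \<omega> r E 0, so
  \<open>I_parts\<close> expresses \<omega> r I n 0 through the exponents 1 - r and - r. Division by
  \<omega> gains decay at the price of a singularity at s = 0; the terms with exponent 1 - r give b,
  those with - r give c.\<close>

lemma norm_P_le_decay:
  assumes "0 < s"
  shows "norm (P 1 n s) \<le> L_b r (Suc n) * s powr (1 - r) * \<omega> powr (- (1 + real n / r)) +
    L_c r (Suc n) * s powr (- r) * \<omega> powr (- (1 + real (Suc n) / r))"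
proof -
  have rw: "r > 0" "\<omega> * r > 0" using r \<omega> by auto
  \<comment> \<open>The boundary term at t = 0, present only for n = 0, where the integral with
    t^(n-1) has coefficient zero. It accounts for the separate case N = 1 in
    \<open>L_b\<close>.\<close>
  define A where "A = (if n = 0 then E (1 - r) (of_real s) else 0)"
  have "of_nat n * I (n - 1) (1 - r) s +
      d * (of_real (1 - r) * I n (- r) s + \<i> * of_real (\<sigma> * \<omega> * r) * I n 0 s) = - A"
    using I_parts[OF assms, of n "1 - r"] unfolding I_E'(2)[OF assms] by (simp add: A_def)
  then have "d * (\<i> * of_real (\<sigma> * \<omega> * r)) * I n 0 s =
      - (A + of_nat n * I (n - 1) (1 - r) s + d * of_real (1 - r) * I n (- r) s)"
    by (simp add: algebra_simps add_eq_0_iff)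
  then have "norm (d * (\<i> * of_real (\<sigma> * \<omega> * r)) * I n 0 s) =
      norm (A + of_nat n * I (n - 1) (1 - r) s + d * of_real (1 - r) * I n (- r) s)"
    by (simp only: norm_minus_cancel)
  moreover have "norm (d * (\<i> * of_real (\<sigma> * \<omega> * r)) * I n 0 s) = \<omega> * r * norm (I n 0 s)"
    using \<sigma> rw \<omega> by (auto simp: norm_mult)
  moreover have "norm (A + of_nat n * I (n - 1) (1 - r) s + d * of_real (1 - r) * I n (- r) s) \<le>
      norm A + real n * norm (I (n - 1) (1 - r) s) + (r - 1) * norm (I n (- r) s)"
  proof -
    have "norm (of_nat n * I (n - 1) (1 - r) s) = real n * norm (I (n - 1) (1 - r) s)"
      "norm (d * of_real (1 - r) * I n (- r) s) = (r - 1) * norm (I n (- r) s)"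
      using r by (simp_all only: norm_mult norm_d norm_of_real norm_of_nat) simp_all
    then show ?thesis
      using norm_triangle_ineq[of "A + of_nat n * I (n - 1) (1 - r) s" "d * of_real (1 - r) * I n (- r) s"]
        norm_triangle_ineq[of A "of_nat n * I (n - 1) (1 - r) s"] by linarith
  qed
  moreover have "norm A + real n * norm (I (n - 1) (1 - r) s) \<le>
      fact n * r * L_b r (Suc n) * s powr (1 - r) * \<omega> powr (- (real n / r))"
  proof (cases n)
    case 0
    then show ?thesis using norm_E_of_real[of s "1 - r"] assms r \<omega> by (simp add: A_def L_b_def)
  next
    case (Suc k)
    have "norm (I k (1 - r) s) \<le> s powr (1 - r) * (1 / r * Gamma ((real k + 1) / r) * \<omega> powr (- ((real k + 1) / r)))"
      using assms r by (intro norm_I_le) auto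
    then have "real n * norm (I k (1 - r) s) \<le>
        real n * (s powr (1 - r) * (1 / r * Gamma ((real k + 1) / r) * \<omega> powr (- ((real k + 1) / r))))"
      by (intro mult_left_mono) auto
    also have "\<dots> = fact n * r * L_b r (Suc n) * s powr (1 - r) * \<omega> powr (- (real n / r))"
      using rw by (simp add: Suc L_b_def power2_eq_square field_simps)
    finally show ?thesis by (simp add: Suc A_def)
  qed
  moreover have "(r - 1) * norm (I n (- r) s) \<le>
      fact n * r * L_c r (Suc n) * s powr (- r) * \<omega> powr (- (real (Suc n) / r))"
  proof -
    have "(r - 1) * norm (I n (- r) s) \<le>
       (r - 1) * (s powr (- r) * (1 / r * Gamma ((real n + 1) / r) * \<omega> powr (- ((real n + 1) / r))))"
      using assms r by (intro mult_left_mono norm_I_le) auto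
    also have "\<dots> = fact n * r * L_c r (Suc n) * s powr (- r) * \<omega> powr (- (real (Suc n) / r))"
      using rw by (simp add: L_c_def power2_eq_square field_simps)
    finally show ?thesis .
  qed
  ultimately have "\<omega> * r * norm (I n 0 s) \<le> fact n * r * L_b r (Suc n) * s powr (1 - r) * \<omega> powr (- (real n / r)) +
      fact n * r * L_c r (Suc n) * s powr (- r) * \<omega> powr (- (real (Suc n) / r))"
    by linarith
  also have "\<dots> = (\<omega> * r * fact n) * (L_b r (Suc n) * s powr (1 - r) * (\<omega> powr (- (real n / r)) / \<omega>) +
      L_c r (Suc n) * s powr (- r) * (\<omega> powr (- (real (Suc n) / r)) / \<omega>))"
    using \<omega> by (simp add: algebra_simps)
  finally have "\<omega> * r * fact n * (norm (I n 0 s) / fact n) \<le> (\<omega> * r * fact n) *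
      (L_b r (Suc n) * s powr (1 - r) * (\<omega> powr (- (real n / r)) / \<omega>) +
      L_c r (Suc n) * s powr (- r) * (\<omega> powr (- (real (Suc n) / r)) / \<omega>))"
    by simp
  then have "norm (I n 0 s) / fact n \<le> L_b r (Suc n) * s powr (1 - r) * (\<omega> powr (- (real n / r)) / \<omega>) +
      L_c r (Suc n) * s powr (- r) * (\<omega> powr (- (real (Suc n) / r)) / \<omega>)"
    by (subst (asm) mult_le_cancel_left_pos) (use rw in auto)
  moreover have "norm (P 1 n s) = norm (I n 0 s) / fact n"
    by (simp add: P_def norm_mult norm_divide norm_power)
  moreover have "\<omega> powr (- (1 + x)) = \<omega> powr (- x) / \<omega>" for x
    using \<omega> by (simp add: powr_diff powr_minus_divide)
  ultimately show ?thesis by simp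
qed

text \<open>Both bounds are homogeneous: with N = n + 1 and w = \<omega>^(-N/r) they are w times a
  and w times b x^(1-r) + c x^(-r), where x = s \<omega>^(1/r). The factor x^(-\<gamma>) of the
  interpolated bound then splits into s^(-\<gamma>) and the gain \<omega>^(-\<gamma>/r).\<close>

lemma norm_P_le_interpolated:
  assumes "0 < s" "r \<ge> 2" "0 < \<gamma>" "\<gamma> < 1"
  shows "norm (P 1 n s) \<le> L_const \<gamma> r (Suc n) * s powr (- \<gamma>) * \<omega> powr (- ((\<gamma> + real (Suc n)) / r))"
proof -
  define x where "x = s * \<omega> powr (1 / r)"
  define w where "w = \<omega> powr (- (real (Suc n) / r))"
  have x: "x > 0" using assms \<omega> by (simp add: x_def)
  have w: "w > 0" using \<omega> by (simp add: w_def)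
  have xp: "x powr e = s powr e * \<omega> powr (e / r)" for e
    using assms \<omega> by (simp add: x_def powr_mult powr_powr)
  have r0: "r > 0" using r by simp
  have "norm (P 1 n s) \<le> L_a r (Suc n) * w"
    using norm_P_le[OF assms(1), of 1 n] assms(1) by (simp add: L_a_def w_def add.commute)
  moreover have "norm (P 1 n s) \<le> (L_b r (Suc n) * x powr (1 - r) + L_c r (Suc n) * x powr (- r)) * w"
  proof -
    have "\<omega> powr (- (1 + real n / r)) = \<omega> powr ((1 - r) / r) * w"
      "\<omega> powr (- (1 + real (Suc n) / r)) = \<omega> powr (- r / r) * w"
      unfolding w_def powr_add[symmetric] using r0 by (auto simp: field_simps intro!: arg_cong[of _ _ "\<lambda>e. \<omega> powr e"])
    then show ?thesis using norm_P_le_decay[OF assms(1), of n] unfolding xp by (simp add: algebra_simps)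
  qed
  ultimately have "norm (P 1 n s) \<le> min (L_a r (Suc n)) (L_b r (Suc n) * x powr (1 - r) + L_c r (Suc n) * x powr (- r)) * w"
    by (simp add: min_def)
  also have "\<dots> \<le> (L_const \<gamma> r (Suc n) * x powr (- \<gamma>)) * w"
    using assms x w by (intro mult_right_mono L_const_interpolation) auto
  also have "\<dots> = L_const \<gamma> r (Suc n) * s powr (- \<gamma>) * \<omega> powr (- ((\<gamma> + real (Suc n)) / r))"
  proof -
    have "\<omega> powr (- \<gamma> / r) * w = \<omega> powr (- ((\<gamma> + real (Suc n)) / r))"
      unfolding w_def powr_add[symmetric] by (simp add: add_divide_distrib)
    then show ?thesis unfolding xp by (simp add: mult.assoc)
  qed
  finally show ?thesis .
qed

text \<open>All integrations by parts are done at once: the alternating sum \<open>H\<close> has the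
  original integrand minus the remainder integrand as derivative, so one application of the
  fundamental theorem suffices. \<open>H\<close> is continuous up to 0 although its derivative may
  blow up there; integrability of the derivative is enough.\<close>

lemma integration_by_parts:
  fixes F :: "real \<Rightarrow> complex" and S :: real
  assumes S: "0 < S" and \<mu>: "0 < \<mu>" "\<mu> \<le> 1" and F: "C_on (Suc M) {0..S} F"
    and vanish: "\<And>n. n \<le> M \<Longrightarrow> nth_deriv_on n {0..S} F S = 0"
  shows "(LBINT s:{0<..<S}. E (\<mu> - 1) (of_real s) * F s) =
    (\<Sum>n\<le>M. (-1) ^ Suc n * P \<mu> n 0 * nth_deriv_on n {0..S} F 0) +
    (-1) ^ Suc M * (LBINT s:{0<..<S}. P \<mu> M s * nth_deriv_on (Suc M) {0..S} F s)"
proof -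
  define D where "D n = nth_deriv_on n {0..S} F" for n
  define Q where "Q n s = (case n of 0 \<Rightarrow> E (\<mu> - 1) (of_real s) | Suc k \<Rightarrow> P \<mu> k s)" for n s
  define H where "H s = (\<Sum>n\<le>M. (-1) ^ n * (P \<mu> n s * D n s))" for s
  define h where "h s = E (\<mu> - 1) (of_real s) * F s - (-1) ^ Suc M * (P \<mu> M s * D (Suc M) s)" for s
  have D0: "D 0 = F" by (simp add: D_def)
  have Dc: "continuous_on {0..S} (D n)" if "n \<le> Suc M" for n
    using F that by (auto simp: D_def C_on_def)
  have Pc: "continuous_on {0..S} (P \<mu> n)" for n
    by (rule continuous_on_subset[OF P_continuous[OF \<mu>]]) auto
  \<comment> \<open>\<open>Q n\<close> is the derivative of \<open>P \<mu> n\<close>, that is,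
    \<open>P \<mu> (n - 1)\<close> or \<open>E\<close>; neighbouring terms cancel.\<close>
  have telescope: "(\<Sum>n\<le>k. (-1) ^ n * (P \<mu> n s * D (Suc n) s + Q n s * D n s)) =
      E (\<mu> - 1) (of_real s) * F s - (-1) ^ Suc k * (P \<mu> k s * D (Suc k) s)" for k s
    by (induction k) (auto simp: Q_def D0 algebra_simps)
  have H: "(H has_vector_derivative h s) (at s)" if "0 < s" "s < S" for s
  proof -
    have "(D n has_vector_derivative D (Suc n) s) (at s)" if "n \<le> M" for n
      using C_on_nth_deriv[OF F, of n s] that \<open>0 < s\<close> \<open>s < S\<close> at_within_Icc_at[of 0 s S]
      unfolding D_def by simp
    then have "(H has_vector_derivative (\<Sum>n\<le>M. (-1) ^ n * (P \<mu> n s * D (Suc n) s + Q n s * D n s))) (at s)"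
      unfolding H_def
      by (intro has_vector_derivative_sum has_vector_derivative_mult_right has_vector_derivative_mult)
         (use P_deriv[OF that(1)] in \<open>auto simp: Q_def\<close>)
    then show ?thesis unfolding telescope h_def .
  qed
  have Ei: "set_integrable lborel {0<..<S} (\<lambda>s. E (\<mu> - 1) (of_real s) * F s)"
  proof -
    have "continuous_on {0..S} (\<lambda>s. exp (\<i> * of_real (\<sigma> * \<omega> * s powr r)) * F s)"
      using Dc[of 0] r by (intro continuous_intros continuous_on_powr') (auto simp: D0)
    then have "set_integrable lborel {0<..<S}
        (\<lambda>s. s powr (\<mu> - 1) *\<^sub>R (exp (\<i> * of_real (\<sigma> * \<omega> * s powr r)) * F s))"
      using \<mu> by (intro set_integrable_powr_continuous) auto
    then show ?thesis
      by (rule set_integrable_cong[THEN iffD1, rotated -1])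
         (simp_all add: E_of_real scaleR_conv_of_real mult.assoc)
  qed
  have Pi: "set_integrable lborel {0<..<S} (\<lambda>s. P \<mu> M s * D (Suc M) s)"
    by (rule set_integrable_subset[OF borel_integrable_atLeastAtMost'[of 0 S]])
       (auto intro!: continuous_intros Pc Dc)
  have hi: "set_integrable lborel {0<..<S} h"
    unfolding h_def by (intro set_integral_diff set_integrable_mult_right Ei Pi)
  have Hc: "continuous_on {0..S} H"
    unfolding H_def by (intro continuous_intros Pc Dc) auto
  have "(LBINT s=0..S. h s) = H S - H 0"
  proof (rule interval_integral_FTC_integrable)
    show "0 < ereal S" using S by simp
    fix s assume "0 < ereal s" "ereal s < ereal S"
    then have s: "0 < s" "s < S" by auto
    show "(H has_vector_derivative h s) (at s)" by (rule H[OF s])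
    have "isCont (D n) s" if "n \<le> Suc M" for n
      using Dc[OF that] s by (intro continuous_on_interior[of "{0..S}"]) auto
    moreover have "isCont (P \<mu> M) s"
      using Pc s by (intro continuous_on_interior[of "{0..S}"]) auto
    moreover have "isCont (\<lambda>s. E (\<mu> - 1) (of_real s)) s"
    proof -
      have "isCont (E (\<mu> - 1)) (of_real s)"
        using DERIV_E[of "of_real s"] s by (intro DERIV_isCont) auto
      then show ?thesis by (rule isCont_o2[rotated]) auto
    qed
    ultimately show "isCont h s" unfolding h_def D0[symmetric] by (intro continuous_intros) auto
  next
    have "(H \<longlongrightarrow> H 0) (at_right 0)"
      using Hc S by (intro continuous_on_Icc_at_rightD)
    then show "((H \<circ> real_of_ereal) \<longlongrightarrow> H 0) (at_right 0)"
      unfolding zero_ereal_def ereal_tendsto_simps1 .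
    have "(H \<longlongrightarrow> H S) (at_left S)"
      using Hc S by (intro continuous_on_Icc_at_leftD)
    then show "((H \<circ> real_of_ereal) \<longlongrightarrow> H S) (at_left (ereal S))"
      unfolding ereal_tendsto_simps1 .
  next
    show "set_integrable lborel (einterval 0 (ereal S)) h" using hi by (simp add: zero_ereal_def)
  qed
  moreover have "H S = 0" using vanish by (simp add: H_def D_def)
  moreover have "(LBINT s=0..S. h s) = (LBINT s:{0<..<S}. h s)"
    using S by (simp add: interval_lebesgue_integral_def zero_ereal_def)
  moreover have "(LBINT s:{0<..<S}. h s) = (LBINT s:{0<..<S}. E (\<mu> - 1) (of_real s) * F s) -
      (-1) ^ Suc M * (LBINT s:{0<..<S}. P \<mu> M s * D (Suc M) s)"
    unfolding h_def
    by (subst set_integral_diff(2)[OF Ei set_integrable_mult_right[OF Pi]]) (simp only: set_integral_mult_right)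
  moreover have "- H 0 = (\<Sum>n\<le>M. (-1) ^ Suc n * P \<mu> n 0 * D n 0)"
    by (simp add: H_def sum_negf[symmetric] mult.assoc)
  ultimately show ?thesis by (simp add: D_def eq_diff_eq)
qed

end

section \<open>The phase as a power near an end point\<close>

lemma continuous_on_rpow:
  assumes "q \<ge> 0" "continuous_on S f" "\<And>x. x \<in> S \<Longrightarrow> f x \<ge> 0"
  shows "continuous_on S (\<lambda>x. rpow (f x) q)"
proof (cases "q = 0")
  case False
  then show ?thesis unfolding rpow_def using assms
    by (simp, intro continuous_on_powr') auto
qed (simp add: rpow_def)

lemma rpow_eq_powr: "x > 0 \<Longrightarrow> rpow x q = x powr q"
  by (simp add: rpow_def)

text \<open>For y > 0 this is y^(-q-1) times the integral of \<tau>^q g(\<tau>) over [0, y].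
  Rescaling to the unit interval makes it visibly regular at y = 0.\<close>

definition mean :: "real \<Rightarrow> (real \<Rightarrow> real) \<Rightarrow> real \<Rightarrow> real" where
  "mean q g y = integral {0..1} (\<lambda>x. rpow x q * g (y * x))"

lemma mult_unit_interval:
  fixes x y :: real
  shows "x \<in> {0..1} \<Longrightarrow> y \<in> {0..D} \<Longrightarrow> y * x \<in> {0..D}"
  using mult_left_le[of x y] by auto

lemma continuous_on_mean_integrand:
  assumes "q \<ge> 0" "continuous_on {0..D} g" "y \<in> {0..D}"
  shows "continuous_on {0..1} (\<lambda>x. rpow x q * g (y * x))"
  using assms mult_unit_interval[OF _ assms(3)]
  by (intro continuous_on_mult continuous_on_rpow continuous_on_compose2[OF assms(2)])
     (auto intro!: continuous_intros)

lemma mean_has_integral: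
  assumes "q \<ge> 0" "continuous_on {0..D} g" "y \<in> {0..D}"
  shows "((\<lambda>x. rpow x q * g (y * x)) has_integral mean q g y) {0..1}"
  unfolding mean_def
  using integrable_continuous_real[OF continuous_on_mean_integrand[OF assms]] by (rule integrable_integral)

lemma continuous_on_mean_integrand2:
  assumes "q \<ge> 0" "continuous_on {0..D} g"
  shows "continuous_on ({0..D} \<times> cbox 0 1) (\<lambda>(y, x). rpow x q * g (y * x))"
proof -
  have "continuous_on ({0..D} \<times> {0..1}) (\<lambda>z. rpow (snd z) q * g (fst z * snd z))"
    by (intro continuous_on_mult continuous_on_rpow continuous_on_compose2[OF assms(2)])
       (use assms mult_unit_interval in \<open>auto intro!: continuous_intros\<close>)
  then show ?thesis by (simp add: case_prod_unfold)
qed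

text \<open>Differentiation under the integral sign; the inner derivative x raises the weight
  exponent by one, which is why q is generalised in \<open>C_on_mean\<close>.\<close>

lemma mean_deriv:
  assumes "q \<ge> 0" "\<And>y. y \<in> {0..D} \<Longrightarrow> (g has_real_derivative g' y) (at y within {0..D})"
    and "continuous_on {0..D} g'" "y \<in> {0..D}"
  shows "(mean q g has_real_derivative mean (q + 1) g' y) (at y within {0..D})"
proof -
  have "((\<lambda>y. integral (cbox 0 1) (\<lambda>x. rpow x q * g (y * x))) has_real_derivative
      integral (cbox 0 1) (\<lambda>x. rpow x (q + 1) * g' (y * x))) (at y within {0..D})"
  proof (rule leibniz_rule_field_derivative[where fx = "\<lambda>y x. rpow x (q + 1) * g' (y * x)" and f = "\<lambda>y x. rpow x q * g (y * x)"])
    fix y x :: real assume yx: "y \<in> {0..D}" "x \<in> cbox 0 1"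
    have "((\<lambda>y. g (y * x)) has_real_derivative g' (y * x) * x) (at y within {0..D})"
    proof (rule DERIV_image_chain[of g _ "\<lambda>y. y * x", unfolded o_def])
      show "((\<lambda>y. y * x) has_real_derivative x) (at y within {0..D})"
        by (auto intro!: derivative_eq_intros)
      show "(g has_real_derivative g' (y * x)) (at (y * x) within (\<lambda>y. y * x) ` {0..D})"
        using yx mult_unit_interval by (intro DERIV_subset[OF assms(2)]) auto
    qed
    from DERIV_cmult[OF this, of "rpow x q"]
    show "((\<lambda>y. rpow x q * g (y * x)) has_real_derivative rpow x (q + 1) * g' (y * x)) (at y within {0..D})"
      using yx assms(1) by (auto simp: rpow_def powr_add mult_ac)
  next
    fix y assume "y \<in> {0..D}"
    moreover have "continuous_on {0..D} g"
      using assms(2) by (rule DERIV_continuous_on)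
    ultimately show "(\<lambda>x. rpow x q * g (y * x)) integrable_on cbox 0 1"
      using mean_has_integral[of q D g y] assms(1) by auto
  qed (use assms continuous_on_mean_integrand2[of "q + 1" D g'] in auto)
  then show ?thesis unfolding mean_def by simp
qed

lemma C_on_mean:
  assumes "0 < D" "q \<ge> 0" "C_on k {0..D} g"
  shows "C_on k {0..D} (mean q g)"
  using assms(2,3)
proof (induction k arbitrary: q g)
  case 0
  then show ?case
    using integral_continuous_on_param[OF continuous_on_mean_integrand2[of q D g]] by (simp add: mean_def)
next
  case (Suc k)
  obtain g' where g': "\<And>y. y \<in> {0..D} \<Longrightarrow> (g has_vector_derivative g' y) (at y within {0..D})" "C_on k {0..D} g'"
    using C_on_SucE[OF Suc.prems(2)] by blast
  show ?case
  proof (rule C_on_SucI[OF assms(1)])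
    show "C_on k {0..D} (mean (q + 1) g')" using Suc g' by auto
    show "(mean q g has_vector_derivative mean (q + 1) g' y) (at y within {0..D})" if "y \<in> {0..D}" for y
      using mean_deriv[OF Suc.prems(1) _ C_on_imp_continuous[OF g'(2)] that] g'(1)
      by (simp add: has_real_derivative_iff_has_vector_derivative)
  qed
qed

text \<open>The derivative in x of x^r g(y x) is integrated over [0, 1]. As \<open>mean r g'\<close>
  is the derivative of \<open>mean (r - 1) g\<close>, the identity lets that derivative be traded
  for \<open>g\<close> and so saves one order of differentiability.\<close>

lemma mean_parts:
  assumes "r \<ge> 1" "\<And>y. y \<in> {0..D} \<Longrightarrow> (g has_real_derivative g' y) (at y within {0..D})"
    and "continuous_on {0..D} g'" "y \<in> {0..D}"
  shows "r * mean (r - 1) g y + y * mean r g' y = g y"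
proof -
  have g: "continuous_on {0..D} g" using assms(2) by (rule DERIV_continuous_on)
  have "((\<lambda>x. r * (rpow x (r - 1) * g (y * x)) + y * (rpow x r * g' (y * x))) has_integral
      rpow 1 r * g (y * 1) - rpow 0 r * g (y * 0)) {0..1}"
  proof (rule fundamental_theorem_of_calculus_interior)
    show "continuous_on {0..1} (\<lambda>x. rpow x r * g (y * x))"
      by (rule continuous_on_mean_integrand[OF _ g assms(4)]) (use assms in auto)
    fix x :: real assume x: "x \<in> {0<..<1}"
    have "((\<lambda>x. x powr r * g (y * x)) has_real_derivative
        r * (rpow x (r - 1) * g (y * x)) + y * (rpow x r * g' (y * x))) (at x)"
    \<comment> \<open>For y = 0 the factor g(y x) is constant in x; for y > 0 the point y x is
      interior, so the derivative of \<open>g\<close> there is two-sided.\<close>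
    proof (cases "y = 0")
      case True
      then show ?thesis using x assms(1)
        by (auto intro!: derivative_eq_intros simp: rpow_eq_powr)
    next
      case False
      then have "y > 0" using assms(4) by simp
      moreover have "y * x < y" using x \<open>y > 0\<close> by simp
      ultimately have "0 < y * x" "y * x < D" using x assms(4) by (simp, simp only: atLeastAtMost_iff) linarith
      then have "(g has_real_derivative g' (y * x)) (at (y * x))"
        using assms(2)[of "y * x"] at_within_Icc_at[of 0 "y * x" D] by simp
      then have "((\<lambda>x. g (y * x)) has_real_derivative g' (y * x) * y) (at x)"
        by (rule DERIV_chain2) (auto intro!: derivative_eq_intros)
      then show ?thesis using x assms(1)
        by (auto intro!: derivative_eq_intros simp: rpow_eq_powr algebra_simps)
    qed
    moreover have "r \<noteq> 0" using assms by simp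
    ultimately show "((\<lambda>x. rpow x r * g (y * x)) has_vector_derivative
        r * (rpow x (r - 1) * g (y * x)) + y * (rpow x r * g' (y * x))) (at x)"
      unfolding has_real_derivative_iff_has_vector_derivative[symmetric] by (simp add: rpow_def)
  qed simp
  moreover have "((\<lambda>x. r * (rpow x (r - 1) * g (y * x)) + y * (rpow x r * g' (y * x))) has_integral
      r * mean (r - 1) g y + y * mean r g' y) {0..1}"
    using assms g by (intro has_integral_add has_integral_mult_right mean_has_integral) auto
  ultimately have "r * mean (r - 1) g y + y * mean r g' y = rpow 1 r * g (y * 1) - rpow 0 r * g (y * 0)"
    by (rule has_integral_unique[rotated])
  then show ?thesis using assms(1) by (simp add: rpow_def)
qed

text \<open>Comparison with the minimum of \<open>g\<close>, attained by compactness; the mean of a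
  constant is evaluated by \<open>mean_parts\<close> with derivative zero.\<close>

lemma mean_pos:
  assumes "r \<ge> 1" "continuous_on {0..D} g" "\<And>y. y \<in> {0..D} \<Longrightarrow> g y > 0" "y \<in> {0..D}"
  shows "mean (r - 1) g y > 0"
proof -
  have "{0..D} \<noteq> {}" using assms(4) by auto
  then obtain a where a: "a \<in> {0..D}" "\<And>y. y \<in> {0..D} \<Longrightarrow> g a \<le> g y"
    using continuous_attains_inf[OF _ _ assms(2)] by auto
  have "r * mean (r - 1) (\<lambda>_. g a) y + y * mean r (\<lambda>_. 0) y = g a"
    by (rule mean_parts[of r D]) (use assms in auto)
  moreover have "mean r (\<lambda>_. 0) y = 0" by (simp add: mean_def)
  ultimately have "r * mean (r - 1) (\<lambda>_. g a) y > 0" using assms(3)[OF a(1)] by simp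
  then have "mean (r - 1) (\<lambda>_. g a) y > 0" using assms(1) by (simp add: zero_less_mult_iff)
  also have "mean (r - 1) (\<lambda>_. g a) y \<le> mean (r - 1) g y"
  proof (rule has_integral_le)
    show "((\<lambda>x. rpow x (r - 1) * g a) has_integral mean (r - 1) (\<lambda>_. g a) y) {0..1}"
      using assms by (intro mean_has_integral[of _ D]) auto
    show "((\<lambda>x. rpow x (r - 1) * g (y * x)) has_integral mean (r - 1) g y) {0..1}"
      using assms by (intro mean_has_integral[of _ D]) auto
    show "rpow x (r - 1) * g a \<le> rpow x (r - 1) * g (y * x)" if "x \<in> {0..1}" for x
      using a(2)[OF mult_unit_interval[OF that assms(4)]] by (intro mult_left_mono) (auto simp: rpow_def)
  qed
  finally show ?thesis .
qed

text \<open>The derivative of h(y x) in x is integrated over [0, 1]. This splits off the zero of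
  \<open>h\<close> at the end point as an exact power and leaves a factor as smooth as
  \<open>g\<close>.\<close>

lemma powr_mean:
  assumes r: "r \<ge> 1" and g: "continuous_on {0..D} g" and y: "y \<in> {0..D}" and h0: "h 0 = 0"
    and h: "\<And>y. y \<in> {0..D} \<Longrightarrow> (h has_real_derivative rpow y (r - 1) * g y) (at y within {0..D})"
  shows "h y = y powr r * mean (r - 1) g y"
proof (cases "y = 0")
  case False
  then have y0: "y > 0" using y by simp
  have hc: "continuous_on {0..D} h" using h by (rule DERIV_continuous_on)
  have "((\<lambda>x. y powr r * (rpow x (r - 1) * g (y * x))) has_integral h (y * 1) - h (y * 0)) {0..1}"
  proof (rule fundamental_theorem_of_calculus_interior)
    show "continuous_on {0..1} (\<lambda>x. h (y * x))"
      using mult_unit_interval[OF _ y] by (intro continuous_on_compose2[OF hc] continuous_intros) auto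
    fix x :: real assume x: "x \<in> {0<..<1}"
    have "y * x < y" using x y0 by simp
    then have yx: "0 < y * x" "y * x < D" using x y y0 by (simp, simp only: atLeastAtMost_iff) linarith
    then have "(h has_real_derivative rpow (y * x) (r - 1) * g (y * x)) (at (y * x))"
      using h[of "y * x"] at_within_Icc_at[of 0 "y * x" D] by simp
    then have "((\<lambda>x. h (y * x)) has_real_derivative (rpow (y * x) (r - 1) * g (y * x)) * y) (at x)"
      by (rule DERIV_chain2) (auto intro!: derivative_eq_intros)
    moreover have "(rpow (y * x) (r - 1) * g (y * x)) * y = y powr r * (rpow x (r - 1) * g (y * x))"
      using x y0 by (simp add: rpow_eq_powr powr_mult powr_diff)
    ultimately show "((\<lambda>x. h (y * x)) has_vector_derivative y powr r * (rpow x (r - 1) * g (y * x))) (at x)"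
      unfolding has_real_derivative_iff_has_vector_derivative[symmetric] by simp
  qed simp
  moreover have "((\<lambda>x. y powr r * (rpow x (r - 1) * g (y * x))) has_integral y powr r * mean (r - 1) g y) {0..1}"
    using r g y by (intro has_integral_mult_right mean_has_integral) auto
  ultimately have "y powr r * mean (r - 1) g y = h (y * 1) - h (y * 0)"
    by (rule has_integral_unique[rotated])
  then show ?thesis using h0 by simp
qed (use h0 in simp)

text \<open>
  The variable \<open>y\<close> is the distance to the end point, \<open>h\<close> the increment of the phase up to sign, and \<open>v\<close>
  the cutoff. The interval extends beyond the support \<open>{0..B}\<close> of \<open>v\<close>, so that the derivatives of the
  cut-off amplitude vanish at its right end.
\<close>

locale endpoint =
  fixes r \<mu> D B e :: real and N :: nat and g h v :: "real \<Rightarrow> real" and u :: "real \<Rightarrow> complex"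
  assumes r: "r \<ge> 1" and \<mu>: "0 < \<mu>" "\<mu> \<le> 1" and N: "N \<ge> 1"
    and B: "0 < B" "B < D" and e: "0 < e" "e \<le> B"
    and g: "C_on N {0..D} g" and g_pos: "\<And>y. y \<in> {0..D} \<Longrightarrow> g y > 0"
    and h0: "h 0 = 0"
    and h: "\<And>y. y \<in> {0..D} \<Longrightarrow> (h has_real_derivative rpow y (r - 1) * g y) (at y within {0..D})"
    and u: "C_on N {0..D} u"
    and v: "C_on N {0..D} v" "\<And>y. y \<in> {0..e} \<Longrightarrow> v y = 1" "\<And>y. y \<in> {B..D} \<Longrightarrow> v y = 0"
begin

section \<open>The coordinate, its inverse and the amplitude\<close>

definition J :: "real \<Rightarrow> real" where "J = mean (r - 1) g"

definition \<Phi> :: "real \<Rightarrow> real" where "\<Phi> y = h y powr (1 / r)"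

definition \<Phi>' :: "real \<Rightarrow> real" where "\<Phi>' y = 1 / r * g y * J y powr (1 / r - 1)"

text \<open>\<open>T\<close> ends the extended range of the coordinate; \<open>S\<close>, where the
  cutoff has reached zero, becomes s_m.\<close>

definition T :: real where "T = \<Phi> D"

definition S :: real where "S = \<Phi> B"

definition Y :: "real \<Rightarrow> real" where "Y = inv_into {0..D} \<Phi>"

definition Y' :: "real \<Rightarrow> real" where "Y' s = inverse (\<Phi>' (Y s))"

text \<open>The amplitude k in a form that is regular up to s = 0: since s = Y J(Y)^(1/r), the
  powers Y^(\<mu> - 1) and s^(1 - \<mu>) combine to J(Y)^((1 - \<mu>)/r) with J positive.\<close>

definition \<kappa> :: "real \<Rightarrow> complex" where
  "\<kappa> s = (J (Y s) powr ((1 - \<mu>) / r) * Y' s) *\<^sub>R u (Y s)"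

lemma D: "D > 0" using B by simp

lemma r0: "r > 0" using r by simp

lemma J_pos: "y \<in> {0..D} \<Longrightarrow> J y > 0"
  unfolding J_def using mean_pos[OF r C_on_imp_continuous[OF g] g_pos] by blast

lemma C_on_J: "C_on N {0..D} J"
  unfolding J_def using D r g by (intro C_on_mean) auto

lemma \<Phi>_eq: "y \<in> {0..D} \<Longrightarrow> \<Phi> y = y * J y powr (1 / r)"
  using powr_mean[OF r C_on_imp_continuous[OF g] _ h0 h, of y] r0
  by (simp add: \<Phi>_def J_def powr_mult powr_powr)

lemma \<Phi>_powr: "y \<in> {0..D} \<Longrightarrow> \<Phi> y powr r = h y"
proof -
  assume y: "y \<in> {0..D}"
  then have "h y = y powr r * J y" using powr_mean[OF r C_on_imp_continuous[OF g] _ h0 h, of y] by (simp add: J_def)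
  then have "h y \<ge> 0" using J_pos[OF y] by simp
  then show ?thesis using r0 by (simp add: \<Phi>_def powr_powr)
qed

text \<open>The product rule for y J^(1/r) brings in the derivative of J, for which only one order
  less is known; \<open>mean_parts\<close> trades it for \<open>g\<close>. Hence
  \<open>\<Phi>'\<close> is of class N and the inverse \<open>Y\<close> of class N + 1.\<close>

lemma \<Phi>_deriv:
  assumes y: "y \<in> {0..D}"
  shows "(\<Phi> has_real_derivative \<Phi>' y) (at y within {0..D})"
proof -
  obtain g' where g': "\<And>y. y \<in> {0..D} \<Longrightarrow> (g has_real_derivative g' y) (at y within {0..D})" "continuous_on {0..D} g'"
    using C_on_SucE[of 0 "{0..D}" g] C_on_mono[OF g, of 1] N
    by (auto simp: has_real_derivative_iff_has_vector_derivative)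
  have J': "(J has_real_derivative mean r g' y) (at y within {0..D})"
    using mean_deriv[OF _ g' y, of "r - 1"] r by (simp add: J_def)
  have "((\<lambda>y. y * J y powr (1 / r)) has_real_derivative
      J y powr (1 / r) + y * (1 / r * J y powr (1 / r - 1) * mean r g' y)) (at y within {0..D})"
    using J' J_pos[OF y] by (auto intro!: derivative_eq_intros)
  also have "J y powr (1 / r) + y * (1 / r * J y powr (1 / r - 1) * mean r g' y) =
      1 / r * (r * J y + y * mean r g' y) * J y powr (1 / r - 1)"
  proof -
    define a where "a = J y powr (1 / r - 1)"
    have "J y powr (1 / r) = J y * a" using J_pos[OF y] by (simp add: a_def powr_diff)
    then show ?thesis unfolding a_def[symmetric] using r0 by (simp add: field_simps)
  qed
  also have "r * J y + y * mean r g' y = g y"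
    unfolding J_def using mean_parts[OF r g' y] by simp
  finally show ?thesis
    unfolding \<Phi>'_def
    by (rule has_field_derivative_transform_within[OF _ zero_less_one y]) (simp add: \<Phi>_eq)
qed

lemma \<Phi>'_pos: "y \<in> {0..D} \<Longrightarrow> \<Phi>' y > 0"
  using g_pos J_pos[of y] r0 by (simp add: \<Phi>'_def)

lemma C_on_\<Phi>': "C_on N {0..D} \<Phi>'"
  unfolding \<Phi>'_def using D g C_on_J J_pos by (intro C_on_mult C_on_const C_on_powr) auto

lemma \<Phi>_continuous: "continuous_on {0..D} \<Phi>"
  using \<Phi>_deriv by (rule DERIV_continuous_on)

lemma \<Phi>_strict_mono:
  assumes "0 \<le> x" "x < y" "y \<le> D"
  shows "\<Phi> x < \<Phi> y"
proof (rule DERIV_pos_imp_increasing_open[OF assms(2)])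
  show "continuous_on {x..y} \<Phi>"
    using assms by (intro continuous_on_subset[OF \<Phi>_continuous]) auto
  fix z assume "x < z" "z < y"
  then have "0 < z" "z < D" using assms by auto
  then show "\<exists>w. (\<Phi> has_real_derivative w) (at z) \<and> w > 0"
    using \<Phi>_deriv[of z] \<Phi>'_pos[of z] at_within_Icc_at[of 0 z D] by auto
qed

lemma \<Phi>_0 [simp]: "\<Phi> 0 = 0" by (simp add: \<Phi>_def h0)

lemma S_T: "0 < S" "S < T"
  using \<Phi>_strict_mono[of 0 B] \<Phi>_strict_mono[of B D] B by (auto simp: S_def T_def)

lemma \<Phi>_inj: "inj_on \<Phi> {0..D}"
  by (rule linorder_inj_onI) (use \<Phi>_strict_mono in \<open>fastforce+\<close>)

lemma \<Phi>_image: "b \<in> {0..D} \<Longrightarrow> \<Phi> ` {0..b} = {0..\<Phi> b}"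
proof
  assume b: "b \<in> {0..D}"
  show "\<Phi> ` {0..b} \<subseteq> {0..\<Phi> b}"
  proof
    fix s assume "s \<in> \<Phi> ` {0..b}"
    then obtain y where "s = \<Phi> y" "0 \<le> y" "y \<le> b" by auto
    then show "s \<in> {0..\<Phi> b}"
      using \<Phi>_strict_mono[of 0 y] \<Phi>_strict_mono[of y b] b by (cases "y = 0"; cases "y = b") auto
  qed
  show "{0..\<Phi> b} \<subseteq> \<Phi> ` {0..b}"
  proof
    fix s assume "s \<in> {0..\<Phi> b}"
    moreover have "continuous_on {0..b} \<Phi>" using b by (intro continuous_on_subset[OF \<Phi>_continuous]) auto
    ultimately have "\<exists>x\<ge>0. x \<le> b \<and> \<Phi> x = s" using b by (intro IVT') auto
    then show "s \<in> \<Phi> ` {0..b}" by auto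
  qed
qed

lemma \<Phi>_Y: "s \<in> {0..T} \<Longrightarrow> \<Phi> (Y s) = s" and Y_in: "s \<in> {0..T} \<Longrightarrow> Y s \<in> {0..D}"
  using \<Phi>_image[of D] D f_inv_into_f[of s \<Phi> "{0..D}"] inv_into_into[of s \<Phi> "{0..D}"]
  unfolding Y_def T_def by simp_all

lemma Y_\<Phi>: "y \<in> {0..D} \<Longrightarrow> Y (\<Phi> y) = y"
  unfolding Y_def by (rule inv_into_f_f[OF \<Phi>_inj])

lemma Y_le:
  assumes "s \<in> {0..\<Phi> b}" "b \<in> {0..D}"
  shows "Y s \<in> {0..b}"
proof -
  have "s \<in> \<Phi> ` {0..b}" using \<Phi>_image[OF assms(2)] assms(1) by simp
  then obtain y where "s = \<Phi> y" "y \<in> {0..b}" by blast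
  then show ?thesis using Y_\<Phi>[of y] assms(2) by simp
qed

lemma Y_ge:
  assumes "s \<in> {\<Phi> b..T}" "b \<in> {0..D}"
  shows "Y s \<in> {b..D}"
proof -
  have "\<Phi> b \<in> \<Phi> ` {0..b}" using assms(2) by (intro imageI) simp
  then have "\<Phi> b \<ge> 0" using \<Phi>_image[OF assms(2)] by simp
  then have s: "s \<in> {0..T}" using assms(1) by simp
  have "\<not> Y s < b"
    using \<Phi>_strict_mono[of "Y s" b] Y_in[OF s] \<Phi>_Y[OF s] assms by auto
  then show ?thesis using Y_in[OF s] by simp
qed

lemma Y_0 [simp]: "Y 0 = 0" using Y_\<Phi>[of 0] D by simp

lemma Y_pos: "0 < s \<Longrightarrow> s \<le> T \<Longrightarrow> 0 < Y s"
  using \<Phi>_Y[of s] Y_in[of s] by (cases "Y s = 0") auto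

lemma Y_image: "Y ` {0..T} \<subseteq> {0..D}" using Y_in by auto

lemma Y_continuous: "continuous_on {0..T} Y"
  using continuous_on_inv[OF \<Phi>_continuous, of Y] Y_\<Phi> \<Phi>_image[of D] D by (simp add: T_def)

lemma Y_deriv: "s \<in> {0..T} \<Longrightarrow> (Y has_real_derivative Y' s) (at s within {0..T})"
  and C_on_Y: "C_on (Suc N) {0..T} Y"
  unfolding Y'_def
  using C_on_inverse_function[OF less_trans[OF S_T] D Y_image Y_continuous \<Phi>_Y \<Phi>_deriv \<Phi>'_pos C_on_\<Phi>']
  by blast+

lemma C_on_compose_Y: "C_on N {0..D} f \<Longrightarrow> C_on N {0..T} (\<lambda>s. f (Y s))"
  using S_T C_on_mono[OF C_on_Y, of N] Y_image by (intro C_on_compose[of 0 T N Y "{0..D}" f]) auto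

lemma C_on_Y': "C_on N {0..T} Y'"
proof -
  have "C_on N {0..T} (\<lambda>s. \<Phi>' (Y s) powr (-1))"
    using S_T C_on_compose_Y[OF C_on_\<Phi>'] \<Phi>'_pos Y_in by (intro C_on_powr) auto
  moreover have "\<Phi>' (Y s) powr (-1) = Y' s" if "s \<in> {0..T}" for s
    using \<Phi>'_pos[OF Y_in[OF that]] by (simp add: Y'_def powr_minus)
  ultimately show ?thesis using C_on_cong[of "{0..T}" "\<lambda>s. \<Phi>' (Y s) powr (-1)" Y' N] by simp
qed

lemma C_on_\<kappa>: "C_on N {0..T} \<kappa>"
proof -
  have T: "0 < T" using S_T by simp
  have "C_on N {0..T} (\<lambda>s. J (Y s) powr ((1 - \<mu>) / r))"
    by (rule C_on_powr[OF T C_on_compose_Y[OF C_on_J] J_pos[OF Y_in]])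
  then show ?thesis
    unfolding \<kappa>_def by (intro C_on_scaleR[OF T] C_on_mult[OF T] C_on_Y' C_on_compose_Y[OF u])
qed

lemma C_on_cutoff: "C_on N {0..T} (\<lambda>s. v (Y s) *\<^sub>R \<kappa> s)"
  by (rule C_on_scaleR[OF less_trans[OF S_T] C_on_compose_Y[OF v(1)] C_on_\<kappa>])

lemma S_subset: "{0..S} \<subseteq> {0..T}" using S_T by auto

lemma C_on_cutoff_S: "C_on N {0..S} (\<lambda>s. v (Y s) *\<^sub>R \<kappa> s)"
  using C_on_subset[OF S_T(1) S_subset C_on_cutoff] .

lemma nth_deriv_cutoff_S: "n \<le> N \<Longrightarrow> nth_deriv_on n {0..S} (\<lambda>s. v (Y s) *\<^sub>R \<kappa> s) S = 0"
proof (rule nth_deriv_on_vanishing_extension[OF S_T C_on_cutoff])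
  fix s assume "s \<in> {S..T}"
  then have "Y s \<in> {B..D}" using Y_ge[of s B] B by (simp add: S_def)
  then show "v (Y s) *\<^sub>R \<kappa> s = 0" using v(3) by simp
qed

lemma nth_deriv_cutoff_0:
  assumes "n \<le> N"
  shows "nth_deriv_on n {0..S} (\<lambda>s. v (Y s) *\<^sub>R \<kappa> s) 0 = nth_deriv_on n {0..S} \<kappa> 0"
proof (rule nth_deriv_on_left_germ[OF _ _ C_on_cutoff_S _ _ assms])
  have eD: "e \<in> {0..D}" using e B by auto
  show "0 < \<Phi> e" using \<Phi>_strict_mono[of 0 e] e B by simp
  show "\<Phi> e \<le> S" using \<Phi>_image[of B] e B by (auto simp: S_def)
  show "C_on N {0..S} \<kappa>" by (rule C_on_subset[OF S_T(1) S_subset C_on_\<kappa>])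
  show "v (Y s) *\<^sub>R \<kappa> s = \<kappa> s" if "s \<in> {0..\<Phi> e}" for s
    using v(2)[OF Y_le[OF that eD]] by simp
qed

lemma powr_Y:
  assumes "0 < s" "s \<le> T"
  shows "Y s powr (\<mu> - 1) * s powr (1 - \<mu>) = J (Y s) powr ((1 - \<mu>) / r)"
proof -
  have Y: "Y s \<in> {0..D}" "Y s > 0" using assms Y_in Y_pos by auto
  have "s = Y s * J (Y s) powr (1 / r)" using \<Phi>_Y[of s] \<Phi>_eq[OF Y(1)] assms by simp
  then have "s powr (1 - \<mu>) = (Y s * J (Y s) powr (1 / r)) powr (1 - \<mu>)" by simp
  also have "\<dots> = Y s powr (1 - \<mu>) * J (Y s) powr ((1 - \<mu>) / r)"
    using Y J_pos[OF Y(1)] by (simp add: powr_mult powr_powr)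
  finally show ?thesis using Y by (simp add: powr_diff)
qed

text \<open>The Jacobian \<open>\<Phi>'\<close> cancels the factor \<open>Y'\<close> in
  \<open>\<kappa>\<close>, and h = \<Phi>^r turns the phase into a pure power. Integrability of both
  sides is secured beforehand, because the substitution rule for complex integrands asks for
  it.\<close>

lemma substitution:
  fixes l :: real
  shows "set_integrable lborel {0<..<B} (\<lambda>y. y powr (\<mu> - 1) *\<^sub>R (v y *\<^sub>R u y * exp (\<i> * of_real (l * h y))))"
    and "(LBINT y:{0<..<B}. y powr (\<mu> - 1) *\<^sub>R (v y *\<^sub>R u y * exp (\<i> * of_real (l * h y)))) =
      (LBINT s:{0<..<S}. s powr (\<mu> - 1) *\<^sub>R (v (Y s) *\<^sub>R \<kappa> s * exp (\<i> * of_real (l * s powr r))))"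
proof -
  have sub: "{0..B} \<subseteq> {0..D}" using B by auto
  have hc: "continuous_on {0..D} h" using h by (rule DERIV_continuous_on)
  have "continuous_on {0..B} (\<lambda>y. v y *\<^sub>R u y * exp (\<i> * of_real (l * h y)))"
    using C_on_imp_continuous[OF v(1)] C_on_imp_continuous[OF u] hc sub
    by (intro continuous_intros) (auto intro: continuous_on_subset)
  then show int: "set_integrable lborel {0<..<B} (\<lambda>y. y powr (\<mu> - 1) *\<^sub>R (v y *\<^sub>R u y * exp (\<i> * of_real (l * h y))))"
    using \<mu> by (intro set_integrable_powr_continuous) auto
  define f where "f s = s powr (\<mu> - 1) *\<^sub>R (v (Y s) *\<^sub>R \<kappa> s * exp (\<i> * of_real (l * s powr r)))" for s
  have "continuous_on {0..S} (\<lambda>s. v (Y s) *\<^sub>R \<kappa> s * exp (\<i> * of_real (l * s powr r)))"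
  proof (rule continuous_on_mult[OF C_on_imp_continuous[OF C_on_cutoff_S]])
    have "continuous_on {0..S} (\<lambda>s. s powr r)"
      using r0 by (intro continuous_on_powr' continuous_intros) auto
    then show "continuous_on {0..S} (\<lambda>s. exp (\<i> * of_real (l * s powr r)))"
      by (intro continuous_on_exp continuous_on_mult_left continuous_on_of_real)
  qed
  note fc = this
  then have intf: "set_integrable lborel {0<..<S} f"
    unfolding f_def using \<mu> by (intro set_integrable_powr_continuous) auto
  have eq: "\<Phi>' y *\<^sub>R f (\<Phi> y) = y powr (\<mu> - 1) *\<^sub>R (v y *\<^sub>R u y * exp (\<i> * of_real (l * h y)))"
    if "0 < y" "y < B" for y
  proof -
    have y: "y \<in> {0..D}" using that B by auto
    have \<Phi>: "0 < \<Phi> y" "\<Phi> y \<le> T" using \<Phi>_strict_mono[of 0 y] \<Phi>_strict_mono[of y D] that B by (auto simp: T_def)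
    have "\<Phi> y powr (\<mu> - 1) * (\<Phi>' y * (J y powr ((1 - \<mu>) / r) * inverse (\<Phi>' y))) = y powr (\<mu> - 1)"
    proof -
      have "\<Phi> y powr (\<mu> - 1) * \<Phi> y powr (1 - \<mu>) = 1"
        using \<Phi>(1) by (simp flip: powr_add)
      moreover have "\<Phi> y powr (\<mu> - 1) * (\<Phi>' y * (J y powr ((1 - \<mu>) / r) * inverse (\<Phi>' y))) =
          \<Phi> y powr (\<mu> - 1) * J y powr ((1 - \<mu>) / r)"
        using \<Phi>'_pos[OF y] by simp
      moreover have "\<dots> = (\<Phi> y powr (\<mu> - 1) * \<Phi> y powr (1 - \<mu>)) * y powr (\<mu> - 1)"
        using powr_Y[OF \<Phi>] unfolding Y_\<Phi>[OF y] by (metis mult.assoc mult.commute)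
      ultimately show ?thesis by simp
    qed
    moreover have "\<Phi>' y *\<^sub>R f (\<Phi> y) = (\<Phi> y powr (\<mu> - 1) * (\<Phi>' y * (J y powr ((1 - \<mu>) / r) * inverse (\<Phi>' y)))) *\<^sub>R
        (v y *\<^sub>R u y * exp (\<i> * of_real (l * h y)))"
      unfolding f_def \<kappa>_def Y'_def Y_\<Phi>[OF y] \<Phi>_powr[OF y] by (simp add: scaleR_conv_of_real)
    ultimately show ?thesis by (simp only:)
  qed
  have "(LBINT s=0..S. f s) = (LBINT y=0..B. \<Phi>' y *\<^sub>R f (\<Phi> y))"
  proof (rule interval_integral_substitution_integrable)
    show "0 < ereal B" using B by simp
    have "(\<Phi> \<longlongrightarrow> \<Phi> 0) (at_right 0)"
      using \<Phi>_continuous D by (intro continuous_on_Icc_at_rightD)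
    from tendsto_ereal[OF this] show "((ereal \<circ> \<Phi> \<circ> real_of_ereal) \<longlongrightarrow> 0) (at_right 0)"
      unfolding zero_ereal_def ereal_tendsto_simps1 unfolding \<Phi>_0 o_def .
    have "continuous_on {0..B} \<Phi>" by (rule continuous_on_subset[OF \<Phi>_continuous sub])
    then have "(\<Phi> \<longlongrightarrow> S) (at_left B)"
      unfolding S_def using B by (intro continuous_on_Icc_at_leftD)
    then show "((ereal \<circ> \<Phi> \<circ> real_of_ereal) \<longlongrightarrow> ereal S) (at_left (ereal B))"
      unfolding ereal_tendsto_simps1 by (simp add: o_def)
    show "set_integrable lborel (einterval 0 (ereal S)) f" using intf by (simp add: zero_ereal_def)
    have "set_integrable lborel {0<..<B} (\<lambda>y. \<Phi>' y *\<^sub>R f (\<Phi> y))"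
      using int by (rule set_integrable_cong[THEN iffD1, rotated -1]) (simp_all add: eq)
    then show "set_integrable lborel (einterval 0 (ereal B)) (\<lambda>y. \<Phi>' y *\<^sub>R f (\<Phi> y))" by (simp add: zero_ereal_def)
  next
    fix y assume "0 \<le> ereal y" "ereal y \<le> ereal B"
    then show "0 \<le> \<Phi>' y" using \<Phi>'_pos[of y] B by auto
  next
    fix y assume "0 < ereal y" "ereal y < ereal B"
    then have y: "0 < y" "y < B" "y < D" using B by auto
    show "(\<Phi> has_real_derivative \<Phi>' y) (at y)"
      using \<Phi>_deriv[of y] at_within_Icc_at[of 0 y D] y by simp
    show "isCont \<Phi>' y"
      using C_on_imp_continuous[OF C_on_\<Phi>'] y by (intro continuous_on_interior[of "{0..D}"]) auto
    have \<Phi>: "0 < \<Phi> y" "\<Phi> y < S" using \<Phi>_strict_mono[of 0 y] \<Phi>_strict_mono[of y B] y B by (auto simp: S_def)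
    have "continuous_on {0<..<S} f" unfolding f_def
      by (intro continuous_on_scaleR continuous_on_subset[OF fc]) (auto intro!: continuous_intros)
    then show "isCont f (\<Phi> y)" using \<Phi> by (simp add: continuous_on_eq_continuous_at)
  qed
  then have "(LBINT s:{0<..<S}. f s) = (LBINT y:{0<..<B}. \<Phi>' y *\<^sub>R f (\<Phi> y))"
    using B S_T by (simp add: interval_lebesgue_integral_def zero_ereal_def)
  also have "\<dots> = (LBINT y:{0<..<B}. y powr (\<mu> - 1) *\<^sub>R (v y *\<^sub>R u y * exp (\<i> * of_real (l * h y))))"
    by (rule set_lebesgue_integral_cong) (simp_all add: eq)
  finally show "(LBINT y:{0<..<B}. y powr (\<mu> - 1) *\<^sub>R (v y *\<^sub>R u y * exp (\<i> * of_real (l * h y)))) =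
      (LBINT s:{0<..<S}. s powr (\<mu> - 1) *\<^sub>R (v (Y s) *\<^sub>R \<kappa> s * exp (\<i> * of_real (l * s powr r))))"
    by (simp add: f_def)
qed

end

section \<open>The asymptotic expansion\<close>

locale oscillatory_end =
  fixes p \<rho> \<mu> :: "nat \<Rightarrow> real" and \<eta> :: real and N :: nat
    and \<psi> \<psi>t \<nu> :: "real \<Rightarrow> real" and U ut :: "real \<Rightarrow> complex" and m :: nat
  assumes p: "p 1 < p 2"
    and N: "N \<ge> 1"
    and \<rho>: "\<forall>m\<in>{1, 2}. \<rho> m \<ge> 1"
    and \<mu>: "\<forall>m\<in>{1, 2}. 0 < \<mu> m \<and> \<mu> m \<le> 1"
    and \<psi>t: "C_on N {p 1..p 2} \<psi>t" and \<psi>t_pos: "\<forall>x\<in>{p 1..p 2}. \<psi>t x > 0"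
    and \<psi>: "\<forall>x\<in>{p 1..p 2}. (\<psi> has_real_derivative
           rpow (x - p 1) (\<rho> 1 - 1) * rpow (p 2 - x) (\<rho> 2 - 1) * \<psi>t x) (at x within {p 1..p 2})"
    and ut: "C_on N {p 1..p 2} ut"
    and U: "\<forall>x\<in>{p 1<..<p 2}.
           U x = of_real ((x - p 1) powr (\<mu> 1 - 1) * (p 2 - x) powr (\<mu> 2 - 1)) * ut x"
    and \<eta>: "0 < \<eta>" "\<eta> < (p 2 - p 1) / 2"
    and \<nu>: "C_on N {p 1..p 2} \<nu>"
    and \<nu>_1: "\<forall>x\<in>{p 1..p 1 + \<eta>}. \<nu> x = 1"
    and \<nu>_0: "\<forall>x\<in>{p 2 - \<eta>..p 2}. \<nu> x = 0"
    and m: "m \<in> {1, 2}"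
begin

section \<open>Coordinates centred at an end point\<close>

definition \<epsilon> :: real where "\<epsilon> = (-1) ^ (m + 1)"

text \<open>The point at distance y inward from the end point \<open>p m\<close>; the sign
  \<open>\<epsilon>\<close> lets one argument treat both ends.\<close>

definition x :: "real \<Rightarrow> real" where "x y = p m + \<epsilon> * y"

definition len :: real where "len = p 2 - p 1"

definition w :: "real \<Rightarrow> real" where "w t = (if m = 1 then \<nu> t else 1 - \<nu> t)"

text \<open>The factor contributed by the other end point, whose index is \<open>3 - m\<close>. The
  only obstruction to its smoothness is at y = \<open>len\<close>, so it is smooth on an interval
  that stops short of it.\<close>

definition gap :: "real \<Rightarrow> real \<Rightarrow> real" where "gap a y = (len - y) powr (a - 1)"

lemma \<epsilon>: "\<epsilon> = 1 \<or> \<epsilon> = -1" and \<epsilon>_sq [simp]: "\<epsilon> * \<epsilon> = 1"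
  using m by (auto simp: \<epsilon>_def)

lemma m_cases: "(m = 1 \<and> \<epsilon> = 1) \<or> (m = 2 \<and> \<epsilon> = -1)"
  using m by (auto simp: \<epsilon>_def)

lemma x_dist:
  "x y - p 1 = (if m = 1 then y else len - y)" "p 2 - x y = (if m = 1 then len - y else y)"
  using m_cases by (auto simp: x_def len_def)

lemma x_in: "y \<in> {0..len} \<Longrightarrow> x y \<in> {p 1..p 2}"
  using x_dist[of y] by (auto split: if_splits)

lemma x_in_open: "y \<in> {0<..<len} \<Longrightarrow> x y \<in> {p 1<..<p 2}"
  using x_dist[of y] by (auto split: if_splits)

lemma lens: "0 < len - \<eta>" "len - \<eta> < len - \<eta> / 2" "0 < len - \<eta> / 2" "\<eta> \<le> len - \<eta>" "len - \<eta> / 2 < len"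
  using \<eta> by (auto simp: len_def)

lemma C_on_x:
  fixes f :: "real \<Rightarrow> 'a::real_normed_vector"
  assumes "C_on k {p 1..p 2} f"
  shows "C_on k {0..len - \<eta> / 2} (\<lambda>y. f (x y))"
proof (rule C_on_compose[OF lens(3) _ assms])
  show "C_on k {0..len - \<eta> / 2} x"
    unfolding x_def by (intro C_on_add C_on_mult C_on_const C_on_ident lens)
  show "x ` {0..len - \<eta> / 2} \<subseteq> {p 1..p 2}"
    using x_in lens by auto
qed

lemma C_on_gap: "C_on k {0..len - \<eta> / 2} (gap a)"
  unfolding gap_def
  by (intro C_on_powr C_on_diff C_on_const C_on_ident lens) (use lens in auto)

text \<open>The cutoff vanishes from \<open>len - \<eta>\<close> on; half of the remaining length
  \<eta> extends the interval, the other half keeps it away from the far end point. The sign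
  \<open>\<epsilon>\<close> in the amplitude is that of the derivative of the inverse of \<phi>_m,
  as \<open>Y\<close> itself always increases.\<close>

sublocale endpoint "\<rho> m" "\<mu> m" "len - \<eta> / 2" "len - \<eta>" \<eta> N
  "\<lambda>y. gap (\<rho> (3 - m)) y * \<psi>t (x y)" "\<lambda>y. \<epsilon> * (\<psi> (x y) - \<psi> (p m))" "\<lambda>y. w (x y)"
  "\<lambda>y. (\<epsilon> * gap (\<mu> (3 - m)) y) *\<^sub>R ut (x y)"
proof unfold_locales
  show "1 \<le> \<rho> m" "0 < \<mu> m" "\<mu> m \<le> 1" using \<rho> \<mu> m by auto
  show "C_on N {0..len - \<eta> / 2} (\<lambda>y. gap (\<rho> (3 - m)) y * \<psi>t (x y))"
    by (intro C_on_mult C_on_gap C_on_x \<psi>t lens)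
  show "C_on N {0..len - \<eta> / 2} (\<lambda>y. (\<epsilon> * gap (\<mu> (3 - m)) y) *\<^sub>R ut (x y))"
    by (intro C_on_mult C_on_scaleR C_on_const C_on_gap C_on_x ut lens)
  show "C_on N {0..len - \<eta> / 2} (\<lambda>y. w (x y))"
  proof (rule C_on_x)
    show "C_on N {p 1..p 2} w"
    proof -
      have "w = (if m = 1 then \<nu> else (\<lambda>t. 1 - \<nu> t))" by (simp add: w_def fun_eq_iff)
      then show ?thesis using \<nu> C_on_diff[OF p C_on_const[OF p, where c = 1] \<nu>] by simp
    qed
  qed
  show "\<epsilon> * (\<psi> (x 0) - \<psi> (p m)) = 0" by (simp add: x_def)
  fix y :: real
  show "0 < gap (\<rho> (3 - m)) y * \<psi>t (x y)" if "y \<in> {0..len - \<eta> / 2}"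
  proof -
    have "y \<in> {0..len}" using that lens by auto
    from \<psi>t_pos[rule_format, OF x_in[OF this]] show ?thesis
      using that lens by (auto simp: gap_def)
  qed
  show "w (x y) = 1" if "y \<in> {0..\<eta>}"
    using that \<nu>_0 \<nu>_1 m_cases by (auto simp: w_def x_def)
  show "w (x y) = 0" if "y \<in> {len - \<eta>..len - \<eta> / 2}"
    using that \<nu>_0 \<nu>_1 \<eta> m_cases by (auto simp: w_def x_def len_def)
  show "((\<lambda>y. \<epsilon> * (\<psi> (x y) - \<psi> (p m))) has_real_derivative
      rpow y (\<rho> m - 1) * (gap (\<rho> (3 - m)) y * \<psi>t (x y))) (at y within {0..len - \<eta> / 2})"
    if y: "y \<in> {0..len - \<eta> / 2}"
  proof -
    have y': "y \<in> {0..len}" "y < len" using y lens by auto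
    define D where "D = rpow y (\<rho> m - 1) * (gap (\<rho> (3 - m)) y * \<psi>t (x y))"
    have "rpow (x y - p 1) (\<rho> 1 - 1) * rpow (p 2 - x y) (\<rho> 2 - 1) * \<psi>t (x y) = D"
      unfolding x_dist using m_cases y' by (auto simp: D_def gap_def rpow_def)
    with \<psi> x_in[OF y'(1)] have "(\<psi> has_real_derivative D) (at (x y) within {p 1..p 2})" by metis
    then have "(\<psi> has_real_derivative D) (at (x y) within x ` {0..len - \<eta> / 2})"
      using x_in lens by (elim DERIV_subset) auto
    moreover have "(x has_real_derivative \<epsilon>) (at y within {0..len - \<eta> / 2})"
      unfolding x_def by (auto intro!: derivative_eq_intros)
    ultimately have "((\<lambda>y. \<psi> (x y)) has_real_derivative D * \<epsilon>) (at y within {0..len - \<eta> / 2})"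
      using DERIV_image_chain[of \<psi> D x y "{0..len - \<eta> / 2}" \<epsilon>] by (simp add: o_def)
    then have "((\<lambda>y. \<epsilon> * (\<psi> (x y) - \<psi> (p m))) has_real_derivative \<epsilon> * (D * \<epsilon>)) (at y within {0..len - \<eta> / 2})"
      by (auto intro!: derivative_eq_intros)
    then show ?thesis unfolding D_def[symmetric] by (simp add: mult.left_commute)
  qed
qed (use lens \<eta> N in auto)

section \<open>Identification with the functions of the statement\<close>

lemma phi_x: "phi p \<rho> \<psi> m (x y) = \<Phi> y"
  using m_cases by (auto simp: phi_def \<Phi>_def)

lemma I_int_eq: "I_int p \<eta> m = x ` {0..len - \<eta>}"
proof -
  have "x ` {0..len - \<eta>} = (if m = 1 then {p 1 .. p 2 - \<eta>} else {p 1 + \<eta> .. p 2})"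
    using m_cases lens
    by (auto simp: x_def len_def image_iff intro!: bexI[of _ "_ - p 1"] bexI[of _ "p 2 - _"])
  then show ?thesis by (simp add: I_int_def)
qed

lemma s_end_eq: "s_end p \<eta> \<rho> \<psi> m = S"
proof -
  have "s_end p \<eta> \<rho> \<psi> m = phi p \<rho> \<psi> m (x (len - \<eta>))"
    using m_cases by (auto simp: s_end_def x_def len_def add.commute)
  then show ?thesis by (simp add: phi_x S_def)
qed

lemma Y_in_S: "s \<in> {0..S} \<Longrightarrow> Y s \<in> {0..len - \<eta>}"
  using Y_le[of s "len - \<eta>"] B by (simp add: S_def)

text \<open>\<open>Y\<close> inverts on a longer interval than \<open>phi_inv\<close>, but for s up
  to \<open>S\<close> the preimage \<open>Y s\<close> already lies in the part that corresponds to
  \<open>I_int\<close>.\<close>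

lemma phi_inv_eq:
  assumes "s \<in> {0..S}"
  shows "phi_inv p \<eta> \<rho> \<psi> m s = x (Y s)"
  unfolding phi_inv_def
proof (rule inv_into_f_eq)
  have "inj_on \<Phi> {0..len - \<eta>}" by (rule inj_on_subset[OF \<Phi>_inj]) (use B in auto)
  then have "inj_on (phi p \<rho> \<psi> m \<circ> x) {0..len - \<eta>}" by (simp add: o_def phi_x)
  then show "inj_on (phi p \<rho> \<psi> m) (I_int p \<eta> m)"
    unfolding I_int_eq by (rule inj_on_imageI)
  show "x (Y s) \<in> I_int p \<eta> m" using Y_in_S[OF assms] by (auto simp: I_int_eq)
  show "phi p \<rho> \<psi> m (x (Y s)) = s" using \<Phi>_Y[of s] assms S_subset by (auto simp: phi_x)
qed

lemma phi_inv_deriv: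
  assumes "s \<in> {0..S}"
  shows "vector_derivative (phi_inv p \<eta> \<rho> \<psi> m) (at s within {0..S}) = \<epsilon> * Y' s"
proof (rule vector_derivative_within_Icc[OF S_T(1) assms])
  have "(Y has_real_derivative Y' s) (at s within {0..S})"
    using Y_deriv[of s] assms S_subset by (auto intro: DERIV_subset)
  then have "((\<lambda>s. x (Y s)) has_real_derivative \<epsilon> * Y' s) (at s within {0..S})"
    unfolding x_def by (auto intro!: derivative_eq_intros)
  then have "((\<lambda>s. x (Y s)) has_vector_derivative \<epsilon> * Y' s) (at s within {0..S})"
    by (simp add: has_real_derivative_iff_has_vector_derivative)
  then show "(phi_inv p \<eta> \<rho> \<psi> m has_vector_derivative \<epsilon> * Y' s) (at s within {0..S})"
    by (rule has_vector_derivative_transform[OF assms, rotated]) (simp add: phi_inv_eq)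
qed

lemma U_x:
  assumes "0 < y" "y < len"
  shows "U (x y) = of_real (y powr (\<mu> m - 1) * gap (\<mu> (3 - m)) y) * ut (x y)"
proof -
  have "x y \<in> {p 1<..<p 2}" using x_in_open assms by simp
  then have "U (x y) = of_real ((x y - p 1) powr (\<mu> 1 - 1) * (p 2 - x y) powr (\<mu> 2 - 1)) * ut (x y)"
    using U by blast
  then show ?thesis unfolding x_dist gap_def using m_cases by (auto simp: mult.commute)
qed

lemma k_pos_eq:
  assumes "0 < s" "s \<le> S"
  shows "k_pos p \<eta> \<rho> \<mu> \<psi> U m s = \<kappa> s"
proof -
  have s: "s \<in> {0..S}" "s \<le> T" using assms S_T by auto
  have Ys: "0 < Y s" "Y s < len" using Y_pos[OF assms(1) s(2)] Y_in_S[OF s(1)] \<eta> by auto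
  have "k_pos p \<eta> \<rho> \<mu> \<psi> U m s =
      of_real ((Y s powr (\<mu> m - 1) * s powr (1 - \<mu> m)) * (gap (\<mu> (3 - m)) (Y s) * (\<epsilon> * Y' s))) * ut (x (Y s))"
    unfolding k_pos_def s_end_eq phi_inv_eq[OF s(1)] phi_inv_deriv[OF s(1)] U_x[OF Ys] by simp
  then show ?thesis unfolding powr_Y[OF assms(1) s(2)] \<kappa>_def by (simp add: scaleR_conv_of_real)
qed

text \<open>The limit that defines \<open>k_fun\<close> at 0 exists because \<open>k_pos\<close>
  agrees with \<open>\<kappa>\<close> on (0, S] and \<open>\<kappa>\<close> is continuous at
  0.\<close>

lemma k_fun_eq:
  assumes "s \<in> {0..S}"
  shows "k_fun p \<eta> \<rho> \<mu> \<psi> U m s = \<kappa> s"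
proof (cases "s = 0")
  case True
  have "continuous_on {0..S} \<kappa>"
    using C_on_imp_continuous[OF C_on_\<kappa>] S_subset by (rule continuous_on_subset)
  then have "(\<kappa> \<longlongrightarrow> \<kappa> 0) (at_right 0)"
    using S_T by (intro continuous_on_Icc_at_rightD)
  moreover have "\<forall>\<^sub>F s in at_right 0. \<kappa> s = k_pos p \<eta> \<rho> \<mu> \<psi> U m s"
    using S_T by (auto simp: eventually_at_right_field k_pos_eq intro!: exI[of _ S])
  ultimately have "(k_pos p \<eta> \<rho> \<mu> \<psi> U m \<longlongrightarrow> \<kappa> 0) (at_right 0)"
    by (rule Lim_transform_eventually)
  then have "Lim (at_right 0) (k_pos p \<eta> \<rho> \<mu> \<psi> U m) = \<kappa> 0"
    by (intro tendsto_Lim) auto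
  then show ?thesis using True by (simp add: k_fun_def)
next
  case False
  then show ?thesis using assms by (simp add: k_fun_def k_pos_eq)
qed

lemma nu_fun_eq:
  assumes "s \<in> {0..S}"
  shows "nu_fun p \<eta> \<rho> \<psi> \<nu> m s = w (x (Y s))"
  using phi_inv_eq[OF assms] m_cases by (auto simp: nu_fun_def w_def)

section \<open>The contribution of one end point\<close>

definition F :: "real \<Rightarrow> complex" where "F s = w (x (Y s)) *\<^sub>R \<kappa> s"

lemma deriv_nu_k_eq:
  assumes "s \<in> {0..S}"
  shows "deriv_nu_k p \<eta> \<rho> \<mu> \<psi> U \<nu> m n s = nth_deriv_on n {0..S} F s"
  unfolding deriv_nu_k_def s_end_eq
  by (rule nth_deriv_on_cong) (use assms in \<open>auto simp: k_fun_eq nu_fun_eq F_def scaleR_conv_of_real\<close>)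

lemma A_term_eq:
  "A_term p \<eta> \<rho> \<mu> \<psi> U m N \<omega> = exp (\<i> * of_real (\<omega> * \<psi> (p m))) *
     (\<Sum>n<N. Theta m (n + 1) (\<rho> m) (\<mu> m) * nth_deriv_on n {0..S} F 0 *
        of_real (\<omega> powr (- ((real n + \<mu> m) / \<rho> m))))"
proof -
  have "nth_deriv_on n {0..S} (k_fun p \<eta> \<rho> \<mu> \<psi> U m) 0 = nth_deriv_on n {0..S} F 0" if "n < N" for n
  proof -
    have "nth_deriv_on n {0..S} (k_fun p \<eta> \<rho> \<mu> \<psi> U m) 0 = nth_deriv_on n {0..S} \<kappa> 0"
      by (rule nth_deriv_on_cong) (use S_T in \<open>auto simp: k_fun_eq\<close>)
    then show ?thesis using nth_deriv_cutoff_0[of n] that by (simp add: F_def[abs_def])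
  qed
  then show ?thesis unfolding A_term_def s_end_eq by simp
qed

text \<open>The sign (-1)^(N+1+m) splits into \<open>\<epsilon>\<close>, the orientation at the end
  point, and (-1)^N from N integrations by parts.\<close>

lemma R_term_eq:
  assumes "ray (\<rho> m) \<omega> \<epsilon>"
  shows "R_term p \<eta> \<rho> \<mu> \<psi> U \<nu> m N \<omega> = of_real \<epsilon> * (-1) ^ N * exp (\<i> * of_real (\<omega> * \<psi> (p m))) *
    (LBINT s:{0<..<S}. ray.P (\<rho> m) \<omega> \<epsilon> (\<mu> m) (N - 1) s * nth_deriv_on N {0..S} F s)"
proof -
  interpret R: ray "\<rho> m" \<omega> \<epsilon> by fact
  have "phi_prim m N s \<omega> (\<rho> m) (\<mu> m) = R.P (\<mu> m) (N - 1) s" for s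
    using R.phi_prim_eq[of m "N - 1" s] N by (simp add: \<epsilon>_def)
  then have "(LBINT s=0..s_end p \<eta> \<rho> \<psi> m.
        phi_prim m N s \<omega> (\<rho> m) (\<mu> m) * deriv_nu_k p \<eta> \<rho> \<mu> \<psi> U \<nu> m N s) =
      (LBINT s:{0<..<S}. R.P (\<mu> m) (N - 1) s * deriv_nu_k p \<eta> \<rho> \<mu> \<psi> U \<nu> m N s)"
    using S_T by (simp add: s_end_eq interval_lebesgue_integral_def zero_ereal_def)
  also have "\<dots> = (LBINT s:{0<..<S}. R.P (\<mu> m) (N - 1) s * nth_deriv_on N {0..S} F s)"
    by (rule set_lebesgue_integral_cong) (auto simp: deriv_nu_k_eq)
  finally show ?thesis unfolding R_term_def using m_cases by (auto simp: \<epsilon>_def)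
qed

lemma end_integral:
  assumes "\<omega> > 0"
  shows "set_integrable lborel {p 1<..<p 2} (\<lambda>t. of_real (w t) * (U t * exp (\<i> * of_real (\<omega> * \<psi> t))))"
    and "(LBINT t:{p 1<..<p 2}. of_real (w t) * (U t * exp (\<i> * of_real (\<omega> * \<psi> t)))) =
      A_term p \<eta> \<rho> \<mu> \<psi> U m N \<omega> + R_term p \<eta> \<rho> \<mu> \<psi> U \<nu> m N \<omega>"
proof -
  interpret R: ray "\<rho> m" \<omega> \<epsilon> using \<rho> m assms \<epsilon> by unfold_locales auto
  define f where "f t = of_real (w t) * (U t * exp (\<i> * of_real (\<omega> * \<psi> t)))" for t
  define c where "c = of_real \<epsilon> * exp (\<i> * of_real (\<omega> * \<psi> (p m)))"
  define q where "q y = y powr (\<mu> m - 1) *\<^sub>R (w (x y) *\<^sub>R ((\<epsilon> * gap (\<mu> (3 - m)) y) *\<^sub>R ut (x y)) *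
    exp (\<i> * of_real ((\<omega> * \<epsilon>) * (\<epsilon> * (\<psi> (x y) - \<psi> (p m))))))" for y
  note q = substitution[of "\<omega> * \<epsilon>", folded q_def]
  have ind: "indicator {p 1<..<p 2} (p m + \<epsilon> * y) *\<^sub>R f (p m + \<epsilon> * y) =
      c * (indicator {0<..<len - \<eta>} y *\<^sub>R q y)" for y
  proof -
    consider "y \<notin> {0<..<len}" | "0 < y" "y < len - \<eta>" | "len - \<eta> \<le> y" "y < len"
      by fastforce
    then show ?thesis
    proof cases
      case 1
      then have "x y \<notin> {p 1<..<p 2}" using x_dist[of y] by (auto split: if_splits)
      then show ?thesis using 1 lens \<eta> by (auto simp: x_def indicator_def)
    next
      case 2
      then have y: "0 < y" "y < len" using \<eta> by auto
      have "\<omega> * \<psi> (x y) = \<omega> * \<psi> (p m) + (\<omega> * \<epsilon>) * (\<epsilon> * (\<psi> (x y) - \<psi> (p m)))"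
      proof -
        have "(\<omega> * \<epsilon>) * (\<epsilon> * (\<psi> (x y) - \<psi> (p m))) = \<omega> * (\<epsilon> * \<epsilon>) * (\<psi> (x y) - \<psi> (p m))"
          by (simp only: mult_ac)
        then show ?thesis by (simp add: algebra_simps)
      qed
      then have e: "exp (\<i> * of_real (\<omega> * \<psi> (x y))) = exp (\<i> * of_real (\<omega> * \<psi> (p m))) *
          exp (\<i> * of_real ((\<omega> * \<epsilon>) * (\<epsilon> * (\<psi> (x y) - \<psi> (p m)))))" (is "_ = ?e1 * ?e2")
        by (simp only: of_real_add distrib_left exp_add)
      define e1 e2 where "e1 = ?e1" and "e2 = ?e2"
      \<comment> \<open>The affine change of variable in a Lebesgue integral sees only the absolute
        value of \<open>\<epsilon>\<close>, whereas the amplitude carries its sign; inserting the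
        square puts one sign into \<open>q\<close> and one into \<open>c\<close>.\<close>
      have "f (x y) = of_real (\<epsilon> * \<epsilon>) * f (x y)" by simp
      also have "\<dots> = c * q y"
        unfolding f_def U_x[OF y] e c_def q_def e1_def[symmetric] e2_def[symmetric]
        unfolding scaleR_conv_of_real of_real_mult by (simp only: mult_ac)
      finally show ?thesis using 2 x_in_open[of y] y by (simp add: x_def)
    next
      \<comment> \<open>Here the cutoff is zero, so the singularity at the other end point never
        enters.\<close>
      case 3
      have "y \<in> {0<..<len}" using 3 lens by auto
      then have "w (x y) = 0"
        using 3 \<nu>_0 \<nu>_1 \<eta> m_cases by (auto simp: w_def x_def len_def)
      then show ?thesis using 3 by (simp add: f_def x_def)
    qed
  qed
  have abs: "\<bar>\<epsilon>\<bar> = 1" "\<epsilon> \<noteq> 0" using \<epsilon> by auto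
  have "integrable lborel (\<lambda>y. c * (indicator {0<..<len - \<eta>} y *\<^sub>R q y))"
    using q(1) unfolding set_integrable_def by (rule integrable_mult_right)
  then have "integrable lborel (\<lambda>y. indicator {p 1<..<p 2} (p m + \<epsilon> * y) *\<^sub>R f (p m + \<epsilon> * y))"
    unfolding ind .
  then show "set_integrable lborel {p 1<..<p 2} f"
    unfolding set_integrable_def
    using lborel_integrable_real_affine_iff[OF abs(2), of "\<lambda>t. indicator {p 1<..<p 2} t *\<^sub>R f t" "p m"] by simp
  have "(LBINT t:{p 1<..<p 2}. f t) = (LBINT y. c * (indicator {0<..<len - \<eta>} y *\<^sub>R q y))"
    unfolding set_lebesgue_integral_def ind[symmetric]
    using lborel_integral_real_affine[OF abs(2), of "\<lambda>t. indicator {p 1<..<p 2} t *\<^sub>R f t" "p m"] abs(1) by simp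
  also have "\<dots> = c * (LBINT y:{0<..<len - \<eta>}. q y)"
    unfolding set_lebesgue_integral_def by (rule integral_mult_right_zero)
  also have "(LBINT y:{0<..<len - \<eta>}. q y) = (LBINT s:{0<..<S}. R.E (\<mu> m - 1) (of_real s) * F s)"
    unfolding q(2)
    by (rule set_lebesgue_integral_cong)
       (auto simp: R.E_of_real F_def scaleR_conv_of_real mult_ac)
  also obtain M where M: "N = Suc M" using N by (cases N) auto
  have "(LBINT s:{0<..<S}. R.E (\<mu> m - 1) (of_real s) * F s) =
    (\<Sum>n\<le>M. (-1) ^ Suc n * R.P (\<mu> m) n 0 * nth_deriv_on n {0..S} F 0) +
    (-1) ^ Suc M * (LBINT s:{0<..<S}. R.P (\<mu> m) M s * nth_deriv_on (Suc M) {0..S} F s)"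
    by (rule R.integration_by_parts)
       (use S_T \<mu> m C_on_cutoff_S nth_deriv_cutoff_S in \<open>auto simp: M F_def[abs_def]\<close>)
  also have "(\<Sum>n\<le>M. (-1) ^ Suc n * R.P (\<mu> m) n 0 * nth_deriv_on n {0..S} F 0) =
    of_real \<epsilon> * (\<Sum>n<N. Theta m (n + 1) (\<rho> m) (\<mu> m) * nth_deriv_on n {0..S} F 0 *
        of_real (\<omega> powr (- ((real n + \<mu> m) / \<rho> m))))"
    unfolding sum_distrib_left M lessThan_Suc_atMost
  proof (rule sum.cong[OF refl])
    fix n
    have "(-1) ^ Suc n * R.P (\<mu> m) n 0 =
      of_real \<epsilon> * Theta m (n + 1) (\<rho> m) (\<mu> m) * of_real (\<omega> powr (- ((real n + \<mu> m) / \<rho> m)))"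
      by (rule R.P_at_0) (use \<mu> m in \<open>auto simp: \<epsilon>_def\<close>)
    then show "(-1) ^ Suc n * R.P (\<mu> m) n 0 * nth_deriv_on n {0..S} F 0 =
      of_real \<epsilon> * (Theta m (n + 1) (\<rho> m) (\<mu> m) * nth_deriv_on n {0..S} F 0 *
        of_real (\<omega> powr (- ((real n + \<mu> m) / \<rho> m))))"
      by (simp only: mult_ac)
  qed
  also have "c * (of_real \<epsilon> * (\<Sum>n<N. Theta m (n + 1) (\<rho> m) (\<mu> m) * nth_deriv_on n {0..S} F 0 *
        of_real (\<omega> powr (- ((real n + \<mu> m) / \<rho> m)))) +
      (-1) ^ Suc M * (LBINT s:{0<..<S}. R.P (\<mu> m) M s * nth_deriv_on (Suc M) {0..S} F s)) =
    A_term p \<eta> \<rho> \<mu> \<psi> U m N \<omega> + R_term p \<eta> \<rho> \<mu> \<psi> U \<nu> m N \<omega>"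
  proof -
    \<comment> \<open>The sign in \<open>c\<close> meets the one from \<open>P_at_0\<close> and
      cancels in the expansion terms; in the remainder it survives.\<close>
    have alg: "(e * X) * (e * a + k * b) = (e * e) * (X * a) + e * k * X * b" for e X a k b :: complex
      by (simp add: algebra_simps)
    have "of_real \<epsilon> * of_real \<epsilon> = (1 :: complex)" by (simp flip: of_real_mult)
    moreover have "M = N - 1" "Suc M = N" by (simp_all add: M)
    ultimately show ?thesis
      unfolding A_term_eq R_term_eq[OF R.ray_axioms] c_def alg by (simp only: mult_1_left)
  qed
  finally show "(LBINT t:{p 1<..<p 2}. f t) = A_term p \<eta> \<rho> \<mu> \<psi> U m N \<omega> + R_term p \<eta> \<rho> \<mu> \<psi> U \<nu> m N \<omega>" .
qed

text \<open>Stated for an arbitrary power so that it serves twice: with a = \<mu> m - 1 for the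
  basic bound and with a = - \<gamma> for the sharper one. The condition a > -1 makes the weighted
  integral converge.\<close>

lemma norm_R_term_le:
  assumes "ray (\<rho> m) \<omega> \<epsilon>" and a: "a > -1"
    and bound: "\<And>s. 0 < s \<Longrightarrow> norm (ray.P (\<rho> m) \<omega> \<epsilon> (\<mu> m) (N - 1) s) \<le> C * s powr a"
  shows "norm (R_term p \<eta> \<rho> \<mu> \<psi> U \<nu> m N \<omega>) \<le>
    C * (LBINT s=0..s_end p \<eta> \<rho> \<psi> m. s powr a * norm (deriv_nu_k p \<eta> \<rho> \<mu> \<psi> U \<nu> m N s))"
proof -
  interpret R: ray "\<rho> m" \<omega> \<epsilon> by fact
  let ?D = "nth_deriv_on N {0..S} F"
  have D: "continuous_on {0..S} ?D"
    using C_on_cutoff_S by (simp add: C_on_def F_def[abs_def])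
  have P: "continuous_on {0..S} (R.P (\<mu> m) (N - 1))"
    by (rule continuous_on_subset[OF R.P_continuous]) (use \<mu> m in auto)
  have int: "set_integrable lborel {0<..<S} (\<lambda>s. R.P (\<mu> m) (N - 1) s * ?D s)"
    by (rule set_integrable_subset[OF borel_integrable_atLeastAtMost'[OF continuous_on_mult[OF P D]]]) auto
  have int': "set_integrable lborel {0<..<S} (\<lambda>s. s powr a * norm (?D s))"
    using set_integrable_powr_continuous[OF a continuous_on_norm[OF D]] by simp
  have "norm (R_term p \<eta> \<rho> \<mu> \<psi> U \<nu> m N \<omega>) = norm (LBINT s:{0<..<S}. R.P (\<mu> m) (N - 1) s * ?D s)"
    unfolding R_term_eq[OF R.ray_axioms] using \<epsilon> by (auto simp: norm_mult norm_power)
  also have "\<dots> \<le> (LBINT s:{0<..<S}. norm (R.P (\<mu> m) (N - 1) s * ?D s))"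
    by (rule set_integral_norm_bound[OF int])
  also have "\<dots> \<le> (LBINT s:{0<..<S}. C * (s powr a * norm (?D s)))"
  proof (rule set_integral_mono)
    show "norm (R.P (\<mu> m) (N - 1) s * ?D s) \<le> C * (s powr a * norm (?D s))" if "s \<in> {0<..<S}" for s
      using mult_right_mono[OF bound[of s], of "norm (?D s)"] that by (simp add: norm_mult mult.assoc)
  qed (use set_integrable_norm[OF int] int' in auto)
  also have "\<dots> = C * (LBINT s:{0<..<S}. s powr a * norm (?D s))"
    by (rule set_integral_mult_right)
  also have "(LBINT s:{0<..<S}. s powr a * norm (?D s)) =
      (LBINT s:{0<..<S}. s powr a * norm (deriv_nu_k p \<eta> \<rho> \<mu> \<psi> U \<nu> m N s))"
    by (rule set_lebesgue_integral_cong) (auto simp: deriv_nu_k_eq)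
  also have "\<dots> = (LBINT s=0..s_end p \<eta> \<rho> \<psi> m. s powr a * norm (deriv_nu_k p \<eta> \<rho> \<mu> \<psi> U \<nu> m N s))"
    using S_T by (simp add: s_end_eq interval_lebesgue_integral_def zero_ereal_def)
  finally show ?thesis .
qed

end

theorem theorem1p7:
  fixes p \<rho> \<mu> :: "nat \<Rightarrow> real" and \<eta> :: real and N j :: nat
    and \<psi> \<psi>t \<nu> :: "real \<Rightarrow> real" and U ut :: "real \<Rightarrow> complex"
  assumes "p 1 < p 2"
    and "N \<ge> 1"
    and "\<forall>m\<in>{1, 2}. \<rho> m \<ge> 1"
    and "\<forall>m\<in>{1, 2}. 0 < \<mu> m \<and> \<mu> m \<le> 1"
    and "C_on 1 {p 1..p 2} \<psi>"
    and "C_on N {p 1..p 2} \<psi>t"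
    and "\<forall>x\<in>{p 1..p 2}. \<psi>t x > 0"
    and "\<forall>x\<in>{p 1..p 2}. (\<psi> has_real_derivative
           rpow (x - p 1) (\<rho> 1 - 1) * rpow (p 2 - x) (\<rho> 2 - 1) * \<psi>t x) (at x within {p 1..p 2})"
    and "C_on N {p 1..p 2} ut"
    and "\<forall>m\<in>{1, 2}. \<mu> m \<noteq> 1 \<longrightarrow> ut (p m) \<noteq> 0"
    and "\<forall>x\<in>{p 1<..<p 2}.
           U x = of_real ((x - p 1) powr (\<mu> 1 - 1) * (p 2 - x) powr (\<mu> 2 - 1)) * ut x"
    and "j \<in> {1, 2}"
    and "\<mu> j = 1"
    and "\<rho> j \<ge> 2"
    and "0 < \<eta>" and "\<eta> < (p 2 - p 1) / 2"
    and "smooth_on {p 1..p 2} \<nu>"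
    and "\<forall>x\<in>{p 1..p 2}. 0 \<le> \<nu> x \<and> \<nu> x \<le> 1"
    and "\<forall>x\<in>{p 1..p 1 + \<eta>}. \<nu> x = 1"
    and "\<forall>x\<in>{p 2 - \<eta>..p 2}. \<nu> x = 0"
  shows "(\<forall>\<omega>>0.
      (LBINT x=p 1..p 2. U x * exp (\<i> * of_real (\<omega> * \<psi> x))) =
        (\<Sum>m\<in>{1, 2}. A_term p \<eta> \<rho> \<mu> \<psi> U m N \<omega> + R_term p \<eta> \<rho> \<mu> \<psi> U \<nu> m N \<omega>) \<and>
      (\<forall>m\<in>{1, 2}. cmod (R_term p \<eta> \<rho> \<mu> \<psi> U \<nu> m N \<omega>) \<le>
         1 / fact (N - 1) * (1 / \<rho> m) * Gamma (real N / \<rho> m) *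
         (LBINT s=0..s_end p \<eta> \<rho> \<psi> m.
            s powr (\<mu> m - 1) * cmod (deriv_nu_k p \<eta> \<rho> \<mu> \<psi> U \<nu> m N s)) *
         \<omega> powr (- (real N / \<rho> m)))) \<and>
    (\<forall>\<gamma>\<in>{0<..<1}. let \<delta> = (\<gamma> + real N) / \<rho> j in
      \<delta> \<in> {real N / \<rho> j<..<(real N + 1) / \<rho> j} \<and>
      L_const \<gamma> (\<rho> j) N > 0 \<and>
      (\<forall>\<omega>>0. cmod (R_term p \<eta> \<rho> \<mu> \<psi> U \<nu> j N \<omega>) \<le>
         L_const \<gamma> (\<rho> j) N *
         (LBINT s=0..s_end p \<eta> \<rho> \<psi> j.
            s powr (- \<gamma>) * cmod (deriv_nu_k p \<eta> \<rho> \<mu> \<psi> U \<nu> j N s)) *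
         \<omega> powr (- \<delta>)))"
proof -
  have "C_on N {p 1..p 2} \<nu>" using assms(17) by (simp add: smooth_on_def)
  then have osc: "oscillatory_end p \<rho> \<mu> \<eta> N \<psi> \<psi>t \<nu> U ut m" if "m \<in> {1, 2}" for m
    using assms that unfolding oscillatory_end_def by blast
  obtain M where M: "N = Suc M" using assms(2) by (cases N) auto
  have expansion: "(LBINT x=p 1..p 2. U x * exp (\<i> * of_real (\<omega> * \<psi> x))) =
        (\<Sum>m\<in>{1, 2}. A_term p \<eta> \<rho> \<mu> \<psi> U m N \<omega> + R_term p \<eta> \<rho> \<mu> \<psi> U \<nu> m N \<omega>)" if \<omega>: "\<omega> > 0" for \<omega>
  proof -
    define w where "w m t = (if m = 1 then \<nu> t else 1 - \<nu> t)" for m :: nat and t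
    let ?f = "\<lambda>m t. of_real (w m t) * (U t * exp (\<i> * of_real (\<omega> * \<psi> t)))"
    have w: "oscillatory_end.w \<nu> m = w m" if "m \<in> {1, 2}" for m
      using oscillatory_end.w_def[OF osc[OF that]] by (auto simp: w_def)
    note ends = oscillatory_end.end_integral[OF osc \<omega>, unfolded w]
    \<comment> \<open>Since \<open>w 1 t + w 2 t = 1\<close>, the integrand is the sum of the two
      pieces, each integrable on the whole interval.\<close>
    have "(LBINT x=p 1..p 2. U x * exp (\<i> * of_real (\<omega> * \<psi> x))) =
        (LBINT t:{p 1<..<p 2}. ?f 1 t + ?f 2 t)"
      using assms(1) unfolding interval_lebesgue_integral_def
      by (simp add: w_def distrib_right[symmetric])
    also have "\<dots> = (LBINT t:{p 1<..<p 2}. ?f 1 t) + (LBINT t:{p 1<..<p 2}. ?f 2 t)"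
      by (rule set_integral_add) (use ends(1)[of 1] ends(1)[of 2] w in auto)
    finally show ?thesis using ends(2)[of 1] ends(2)[of 2] w by simp
  qed
  have remainder: "cmod (R_term p \<eta> \<rho> \<mu> \<psi> U \<nu> m N \<omega>) \<le>
         1 / fact (N - 1) * (1 / \<rho> m) * Gamma (real N / \<rho> m) *
         (LBINT s=0..s_end p \<eta> \<rho> \<psi> m.
            s powr (\<mu> m - 1) * cmod (deriv_nu_k p \<eta> \<rho> \<mu> \<psi> U \<nu> m N s)) *
         \<omega> powr (- (real N / \<rho> m))" if \<omega>: "\<omega> > 0" and m: "m \<in> {1, 2}" for \<omega> m
  proof -
    interpret oscillatory_end p \<rho> \<mu> \<eta> N \<psi> \<psi>t \<nu> U ut m by (rule osc[OF m])
    interpret R: ray "\<rho> m" \<omega> \<epsilon> using assms(3) m \<omega> \<epsilon> by unfold_locales auto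
    have "cmod (R_term p \<eta> \<rho> \<mu> \<psi> U \<nu> m N \<omega>) \<le>
      (1 / fact (N - 1) * (1 / \<rho> m) * Gamma (real N / \<rho> m) * \<omega> powr (- (real N / \<rho> m))) *
      (LBINT s=0..s_end p \<eta> \<rho> \<psi> m. s powr (\<mu> m - 1) * cmod (deriv_nu_k p \<eta> \<rho> \<mu> \<psi> U \<nu> m N s))"
    proof (rule norm_R_term_le[OF R.ray_axioms])
      show "\<mu> m - 1 > -1" using assms(4) m by auto
      show "norm (R.P (\<mu> m) (N - 1) s) \<le>
        (1 / fact (N - 1) * (1 / \<rho> m) * Gamma (real N / \<rho> m) * \<omega> powr (- (real N / \<rho> m))) * s powr (\<mu> m - 1)"
        if "0 < s" for s
        using R.norm_P_le[OF that, of "\<mu> m" M] assms(4) m by (auto simp: M mult_ac add.commute)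
    qed
    then show ?thesis by (simp only: mult_ac)
  qed
  have sharp: "\<delta> \<in> {real N / \<rho> j<..<(real N + 1) / \<rho> j} \<and> L_const \<gamma> (\<rho> j) N > 0 \<and>
      (\<forall>\<omega>>0. cmod (R_term p \<eta> \<rho> \<mu> \<psi> U \<nu> j N \<omega>) \<le>
         L_const \<gamma> (\<rho> j) N *
         (LBINT s=0..s_end p \<eta> \<rho> \<psi> j.
            s powr (- \<gamma>) * cmod (deriv_nu_k p \<eta> \<rho> \<mu> \<psi> U \<nu> j N s)) *
         \<omega> powr (- \<delta>))" if \<gamma>: "\<gamma> \<in> {0<..<1}" and \<delta>: "\<delta> = (\<gamma> + real N) / \<rho> j" for \<gamma> \<delta>
  proof (intro conjI allI impI)
    have r: "\<rho> j > 1" using assms(14) by simp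
    show "\<delta> \<in> {real N / \<rho> j<..<(real N + 1) / \<rho> j}"
      using \<gamma> r by (auto simp: \<delta> divide_strict_right_mono)
    show "L_const \<gamma> (\<rho> j) N > 0"
      using L_coefficients_pos(1)[OF r assms(2)] L_K(1)[OF r assms(2)] by (simp add: L_const_def)
    fix \<omega> :: real assume \<omega>: "\<omega> > 0"
    interpret oscillatory_end p \<rho> \<mu> \<eta> N \<psi> \<psi>t \<nu> U ut j by (rule osc[OF assms(12)])
    interpret R: ray "\<rho> j" \<omega> \<epsilon> using r \<omega> \<epsilon> by unfold_locales auto
    have "cmod (R_term p \<eta> \<rho> \<mu> \<psi> U \<nu> j N \<omega>) \<le> (L_const \<gamma> (\<rho> j) N * \<omega> powr (- \<delta>)) *
      (LBINT s=0..s_end p \<eta> \<rho> \<psi> j. s powr (- \<gamma>) * cmod (deriv_nu_k p \<eta> \<rho> \<mu> \<psi> U \<nu> j N s))"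
    proof (rule norm_R_term_le[OF R.ray_axioms])
      show "- \<gamma> > -1" using \<gamma> by simp
      \<comment> \<open>The condition \<mu> j = 1 enters here: the interpolated bound is about
        \<open>P 1\<close>.\<close>
      show "norm (R.P (\<mu> j) (N - 1) s) \<le> (L_const \<gamma> (\<rho> j) N * \<omega> powr (- \<delta>)) * s powr (- \<gamma>)" if "0 < s" for s
        using R.norm_P_le_interpolated[OF that assms(14), of \<gamma> M] \<gamma>
        unfolding assms(13) M \<delta> by (simp add: mult_ac)
    qed
    then show "cmod (R_term p \<eta> \<rho> \<mu> \<psi> U \<nu> j N \<omega>) \<le>
         L_const \<gamma> (\<rho> j) N *
         (LBINT s=0..s_end p \<eta> \<rho> \<psi> j.
            s powr (- \<gamma>) * cmod (deriv_nu_k p \<eta> \<rho> \<mu> \<psi> U \<nu> j N s)) *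
         \<omega> powr (- \<delta>)" by (simp only: mult_ac)
  qed
  show ?thesis
    unfolding Let_def using expansion remainder sharp by blast
qed

end
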